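(* Let $a,b,c$ be non-negative integers, not all zero, let $f=x^ay^b(x+y)^c\in\mathbb{Z}[x,y]$, and let $t\ge 0$ be a rational number. Let $(X,\Delta)=(\operatorname{Spec}\mathbb{Z}[x,y],\operatorname{div}(f^t))$, where $\operatorname{div}(f^t)=t\operatorname{div}(f)$. Let $(X_{\mathbb{C}},\Delta_{\mathbb{C}})$ and $(X_p,\Delta_p)$ be the base changes to $\mathbb{C}$ and to $\mathbb{F}_p$ respectively, localized at $(x,y)$. Then $$\frac{\widehat{\mathrm{vol}}(X_{\mathbb{C}},\Delta_{\mathbb{C}})}{4}=\lim_{p\to\infty}s(X_p,\Delta_p),$$ where the limit is over primes $p$.
   Context: Normalized volume: for a KLT pair $(X,\Delta)$ over $\mathbb{C}$ with $\dim X=n$ and a closed point $x\in X$, $$\widehat{\mathrm{vol}}(X,\Delta,x)=\inf\{A_{X,\Delta}(v)^n\,\mathrm{vol}(v)\mid v\text{ a divisorial valuation centered at }x\},$$ where $A_{X,\Delta}(v)$ is the log discrepancy of $v$ with respect to $(X,\Delta)$ and $\mathrm{vol}(v)=\lim_{m\to\infty}\ell(\mathcal{O}_{X,x}/\mathfrak{a}_m(v))/(m^n/n!)$ with $\mathfrak{a}_m(v)=\{h\mid v(h)\ge m\}$. Here $n=2$ and $x$ is the origin, which is omitted from the notation. If the pair is not KLT at the origin, $\widehat{\mathrm{vol}}$ is set equal to $0$. $F$-signature: with $R=\mathbb{F}_p[x,y]_{(x,y)}$, $$s(X_p,\Delta_p)=s(R,f^t)=\lim_{e\to\infty}\frac{1}{p^{2e}}\,\ell\!\left(\frac{R}{(x^{p^e},y^{p^e}):f^{\lceil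 tp^e\rceil}}\right),$$ where $\ell$ denotes length. *)

theory Defs
  imports
    "HOL-Analysis.Analysis"
    "HOL-Library.Extended_Nat"
    "HOL-Computational_Algebra.Computational_Algebra"
    "HOL-Computational_Algebra.Field_as_Ring"
    "HOL-Algebra.Generated_Rings"
    "HOL-Algebra.QuotRing"
    "HOL-Algebra.Algebraic_Closure_Type"
begin

section \<open>Length and localization\<close>

text \<open>
  For an ideal \<open>I\<close> of a commutative ring \<open>R\<close>, the length of the \<open>R\<close>-module \<open>R/I\<close> is
  \<open>ring_length (R Quot I)\<close>: its submodules are the ideals of the quotient ring.
\<close>

definition ring_length :: "('a, 'b) ring_scheme \<Rightarrow> enat" where
  "ring_length A = Sup {enat n | n. \<exists>J :: nat \<Rightarrow> 'a set.
     (\<forall>i\<le>n. ideal (J i) A) \<and> (\<forall>i<n. J i \<subset> J (Suc i))}"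

definition colength :: "('a, 'b) ring_scheme \<Rightarrow> 'a set \<Rightarrow> real" where
  "colength R I = real (the_enat (ring_length (R Quot I)))"

text \<open>
  The fraction \<open>r/s\<close> is the class of all pairs \<open>(r', s')\<close> with \<open>u (r s' - r' s) = 0\<close> for some
  \<open>u \<in> S\<close>. As in the library's definition of the multiplication of cosets, the operations on
  classes are unions over all choices of representatives.
\<close>

definition loc_frac :: "('a, 'b) ring_scheme \<Rightarrow> 'a set \<Rightarrow> 'a \<Rightarrow> 'a \<Rightarrow> ('a \<times> 'a) set" where
  "loc_frac R S r s = {(r', s'). r' \<in> carrier R \<and> s' \<in> S \<and>
     (\<exists>u\<in>S. u \<otimes>\<^bsub>R\<^esub> ((r \<otimes>\<^bsub>R\<^esub> s') \<ominus>\<^bsub>R\<^esub> (r' \<otimes>\<^bsub>R\<^esub> s)) = \<zero>\<^bsub>R\<^esub>)}"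

definition localization :: "('a, 'b) ring_scheme \<Rightarrow> 'a set \<Rightarrow> ('a \<times> 'a) set ring" where
  "localization R S =
    \<lparr>carrier = {loc_frac R S r s | r s. r \<in> carrier R \<and> s \<in> S},
     monoid.mult = (\<lambda>A B. \<Union>(r, s)\<in>A. \<Union>(r', s')\<in>B. loc_frac R S (r \<otimes>\<^bsub>R\<^esub> r') (s \<otimes>\<^bsub>R\<^esub> s')),
     one = loc_frac R S \<one>\<^bsub>R\<^esub> \<one>\<^bsub>R\<^esub>,
     ring.zero = loc_frac R S \<zero>\<^bsub>R\<^esub> \<one>\<^bsub>R\<^esub>,
     add = (\<lambda>A B. \<Union>(r, s)\<in>A. \<Union>(r', s')\<in>B.
              loc_frac R S ((r \<otimes>\<^bsub>R\<^esub> s') \<oplus>\<^bsub>R\<^esub> (r' \<otimes>\<^bsub>R\<^esub> s)) (s \<otimes>\<^bsub>R\<^esub> s'))\<rparr>"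

section \<open>The affine plane and its base changes\<close>

text \<open>
  The type \<open>'a poly poly\<close> represents the polynomial ring in two variables: the inner variable
  is \<open>x\<close>, the outer one is \<open>y\<close>.
\<close>

definition var_x :: "'a::comm_ring_1 poly poly" where
  "var_x = [:[:0, 1:]:]"

definition var_y :: "'a::comm_ring_1 poly poly" where
  "var_y = [:0, 1:]"

abbreviation plane :: "int poly poly ring" where
  "plane \<equiv> ring_of_type_algebra"

definition base_change_C :: "int poly poly \<Rightarrow> complex poly poly" where
  "base_change_C g = map_poly (map_poly of_int) g"

text \<open>The ring \<open>F\<^sub>p[x,y]\<close> is obtained by base change, as \<open>Z[x,y]/(p)\<close>.\<close>

definition plane_p :: "nat \<Rightarrow> int poly poly set ring" where
  "plane_p p = plane Quot (PIdl\<^bsub>plane\<^esub> (of_nat p))"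

definition base_change_p :: "nat \<Rightarrow> int poly poly \<Rightarrow> int poly poly set" where
  "base_change_p p g = (PIdl\<^bsub>plane\<^esub> (of_nat p)) +>\<^bsub>plane\<^esub> g"

definition away_from_origin_p :: "nat \<Rightarrow> int poly poly set set" where
  "away_from_origin_p p = carrier (plane_p p) -
     (Idl\<^bsub>plane_p p\<^esub> {base_change_p p var_x, base_change_p p var_y})"

definition local_plane_p :: "nat \<Rightarrow> (int poly poly set \<times> int poly poly set) set ring" where
  "local_plane_p p = localization (plane_p p) (away_from_origin_p p)"

definition local_p :: "nat \<Rightarrow> int poly poly \<Rightarrow> (int poly poly set \<times> int poly poly set) set" where
  "local_p p g =
     loc_frac (plane_p p) (away_from_origin_p p) (base_change_p p g) \<one>\<^bsub>plane_p p\<^esub>"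

section \<open>F-signature of a pair\<close>

definition colon_ideal :: "('a, 'b) ring_scheme \<Rightarrow> 'a set \<Rightarrow> 'a \<Rightarrow> 'a set" where
  "colon_ideal R I g = {r \<in> carrier R. r \<otimes>\<^bsub>R\<^esub> g \<in> I}"

definition F_signature :: "nat \<Rightarrow> int poly poly \<Rightarrow> rat \<Rightarrow> real" where
  "F_signature p f t = lim (\<lambda>e. 1 / real p ^ (2 * e) *
     colength (local_plane_p p)
       (colon_ideal (local_plane_p p)
          (Idl\<^bsub>local_plane_p p\<^esub> {local_p p (var_x ^ (p ^ e)), local_p p (var_y ^ (p ^ e))})
          (local_p p (f ^ nat \<lceil>t * of_nat (p ^ e)\<rceil>))))"

section \<open>Divisors over the complex plane\<close>

type_synonym cfun = "complex poly poly fract"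

abbreviation cfun_field :: "cfun ring" where
  "cfun_field \<equiv> ring_of_type_algebra"

definition at_origin :: "'a::comm_ring_1 poly poly \<Rightarrow> 'a" where
  "at_origin g = poly (poly g 0) 0"

definition local_plane_C :: "cfun ring" where
  "local_plane_C = cfun_field
     \<lparr>carrier := {to_fract g / to_fract h | g h. at_origin h \<noteq> 0}\<rparr>"

text \<open>
  A normal affine model is the coordinate ring \<open>B\<close> of a normal affine variety with a birational
  morphism to the affine plane, regarded as a subring of the function field. Such varieties are
  precisely the affine open subsets of the normal varieties that are proper and birational over the
  plane.
\<close>

definition integral_over :: "cfun set \<Rightarrow> cfun \<Rightarrow> bool" where
  "integral_over B z \<longleftrightarrow>
     (\<exists>q. Polynomial.lead_coeff q = 1 \<and> (\<forall>i. Polynomial.coeff q i \<in> B) \<and> poly q z = 0)"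

definition normal_affine_model :: "cfun set \<Rightarrow> bool" where
  "normal_affine_model B \<longleftrightarrow>
     (\<exists>G. finite G \<and>
        B = generate_ring cfun_field (range (\<lambda>c. to_fract [:[:c:]:]) \<union> G)) \<and>
     to_fract var_x \<in> B \<and> to_fract var_y \<in> B \<and>
     (\<forall>z. integral_over B z \<longrightarrow> z \<in> B)"

definition height_one_prime :: "cfun set \<Rightarrow> cfun set \<Rightarrow> bool" where
  "height_one_prime B P \<longleftrightarrow>
     primeideal P (cfun_field\<lparr>carrier := B\<rparr>) \<and> P \<noteq> {0} \<and>
     (\<forall>Q. primeideal Q (cfun_field\<lparr>carrier := B\<rparr>) \<and> Q \<subseteq> P \<longrightarrow> Q = {0} \<or> Q = P)"

text \<open>
  Valuations are functions to the integers; their value at \<open>0\<close> is irrelevant, and all conditions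
  below concern nonzero arguments only.
\<close>

definition discrete_valuation :: "(cfun \<Rightarrow> int) \<Rightarrow> bool" where
  "discrete_valuation v \<longleftrightarrow>
     (\<forall>g h. g \<noteq> 0 \<longrightarrow> h \<noteq> 0 \<longrightarrow> v (g * h) = v g + v h) \<and>
     (\<forall>g h. g \<noteq> 0 \<longrightarrow> h \<noteq> 0 \<longrightarrow> g + h \<noteq> 0 \<longrightarrow> min (v g) (v h) \<le> v (g + h)) \<and>
     v ` (- {0}) = UNIV"

definition valuation_ring :: "(cfun \<Rightarrow> int) \<Rightarrow> cfun set" where
  "valuation_ring v = {g. g = 0 \<or> 0 \<le> v g}"

text \<open>
  The order of vanishing along the prime divisor given by \<open>P\<close> is the normalized valuation of the
  discrete valuation ring \<open>B\<^sub>P\<close>.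
\<close>

definition order_of_vanishing :: "cfun set \<Rightarrow> cfun set \<Rightarrow> (cfun \<Rightarrow> int) \<Rightarrow> bool" where
  "order_of_vanishing B P v \<longleftrightarrow>
     discrete_valuation v \<and> valuation_ring v = {g / h | g h. g \<in> B \<and> h \<in> B - P}"

definition divisorial_valuation :: "(cfun \<Rightarrow> int) \<Rightarrow> bool" where
  "divisorial_valuation v \<longleftrightarrow>
     (\<exists>B P. normal_affine_model B \<and> height_one_prime B P \<and> order_of_vanishing B P v)"

definition center_contains_origin :: "(cfun \<Rightarrow> int) \<Rightarrow> bool" where
  "center_contains_origin v \<longleftrightarrow> (\<forall>g. g \<noteq> 0 \<longrightarrow> 0 < v (to_fract g) \<longrightarrow> at_origin g = 0)"

definition centered_at_origin :: "(cfun \<Rightarrow> int) \<Rightarrow> bool" where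
  "centered_at_origin v \<longleftrightarrow> (\<forall>g. g \<noteq> 0 \<longrightarrow> (0 < v (to_fract g) \<longleftrightarrow> at_origin g = 0))"

section \<open>Log discrepancy\<close>

definition fract_deriv ::
    "(complex poly poly \<Rightarrow> complex poly poly) \<Rightarrow> cfun \<Rightarrow> cfun" where
  "fract_deriv D u = (case quot_of_fract u of (g, h) \<Rightarrow>
     to_fract (D g * h - g * D h) / to_fract (h\<^sup>2))"

definition deriv_x :: "cfun \<Rightarrow> cfun" where
  "deriv_x = fract_deriv (map_poly pderiv)"

definition deriv_y :: "cfun \<Rightarrow> cfun" where
  "deriv_y = fract_deriv pderiv"

definition jacobian :: "cfun \<Rightarrow> cfun \<Rightarrow> cfun" where
  "jacobian g h = deriv_x g * deriv_y h - deriv_y g * deriv_x h"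

text \<open>
  The coefficient along \<open>E\<close> of the relative canonical divisor of \<open>Y\<close> over the plane is the order
  along \<open>E\<close> of the pullback of \<open>dx \<and> dy\<close>. The 2-forms on \<open>Y\<close> regular at the generic point of
  \<open>E\<close> form a free module of rank one over the valuation ring, and some
  \<open>dg \<and> dh = jacobian g h dx \<and> dy\<close> with \<open>g\<close>, \<open>h\<close> in the valuation ring is a generator; the order of
  \<open>dx \<and> dy\<close> is minus the valuation of that Jacobian, which is the smallest one occurring.
\<close>

definition relative_canonical_order :: "(cfun \<Rightarrow> int) \<Rightarrow> int" where
  "relative_canonical_order v = Sup {- v (jacobian g h) | g h.
     g \<in> valuation_ring v \<and> h \<in> valuation_ring v \<and> jacobian g h \<noteq> 0}"

text \<open>The boundary divisor is \<open>div (f\<^sup>t)\<close>, that is, \<open>t\<close> times the divisor of \<open>f\<close>.\<close>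

definition log_discrepancy :: "complex poly poly \<Rightarrow> rat \<Rightarrow> (cfun \<Rightarrow> int) \<Rightarrow> real" where
  "log_discrepancy f t v =
     1 + of_int (relative_canonical_order v) - of_rat t * of_int (v (to_fract f))"

definition klt_at_origin :: "complex poly poly \<Rightarrow> rat \<Rightarrow> bool" where
  "klt_at_origin f t \<longleftrightarrow>
     (\<forall>v. divisorial_valuation v \<and> center_contains_origin v \<longrightarrow> 0 < log_discrepancy f t v)"

section \<open>Normalized volume\<close>

definition valuation_ideal :: "(cfun \<Rightarrow> int) \<Rightarrow> nat \<Rightarrow> cfun set" where
  "valuation_ideal v m = {h \<in> carrier local_plane_C. h = 0 \<or> int m \<le> v h}"

definition valuation_volume :: "(cfun \<Rightarrow> int) \<Rightarrow> real" where
  "valuation_volume v =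
     lim (\<lambda>m. colength local_plane_C (valuation_ideal v m) / (real m ^ 2 / fact 2))"

definition normalized_volume :: "complex poly poly \<Rightarrow> rat \<Rightarrow> real" where
  "normalized_volume f t =
     (if klt_at_origin f t
      then Inf {(log_discrepancy f t v)\<^sup>2 * valuation_volume v | v.
                  divisorial_valuation v \<and> centered_at_origin v}
      else 0)"

end

theory Submission imports Defs begin

text \<open>
  Both sides equal the same piecewise quadratic function of \<open>(\<alpha>, \<beta>, \<gamma>) = (ta, tb, tc)\<close>: it is
  \<open>0\<close> unless all three are less than \<open>1\<close> with sum less than \<open>2\<close>, and otherwise it is
  \<open>(1 - \<alpha>)(1 - \<beta> - \<gamma>)\<close> when \<open>\<alpha> \<ge> \<beta> + \<gamma>\<close> (similarly for \<open>\<beta>\<close>, \<open>\<gamma>\<close>), and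
  \<open>(1 - (\<alpha> + \<beta> + \<gamma>)/2)\<^sup>2\<close> when the triangle inequalities hold.

  In characteristic \<open>p\<close>, counting monomials bounds the colength of
  \<open>(x\<^sup>q, y\<^sup>q) : x\<^sup>A y\<^sup>B (x + y)\<^sup>C\<close> from above. For \<open>q = p\<close> there is a matching lower bound: the
  ideal \<open>(x\<^sup>p, y\<^sup>p)\<close> is stable under derivations, and differentiating repeatedly shows that many
  monomials are not leading terms of elements of the colon ideal. By Frobenius the colength
  divided by \<open>q\<^sup>2\<close> does not decrease along the powers \<open>q\<close> of \<open>p\<close>, so the F-signature lies between
  the two bounds, which differ by \<open>O(1/p)\<close>.

  Over the complex numbers, let \<open>v\<close> have log discrepancy \<open>A\<close> and let \<open>l\<close> be one of the three lines.
  A derivation along \<open>l\<close> lowers \<open>v\<close> by at most \<open>A - v(l)\<close>, so \<open>v(g)\<close> is at most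
  \<open>A - v(l)\<close> times the order of \<open>g\<close> restricted to \<open>l\<close>. This gives
  \<open>vol(v) v(l) (A - v(l)) \<ge> 1\<close>, and the inequality of arithmetic and geometric means yields the
  lower bound. It is attained by a monomial valuation.
\<close>

section \<open>Length\<close>

text \<open>The formula comes from an optimization over two weights. If the exponent of one line is
  at least the sum of the others, the best weights on that line and on a transversal one are
  proportional to \<open>1 - \<beta> - \<gamma>\<close> and \<open>1 - \<alpha>\<close>, the
  equality case of the arithmetic-geometric inequality; in the balanced case both are 1. The cut-off
  degrees of the monomial count follow the same two regimes.

  The obstacle in characteristic p is that binomial coefficients may vanish, so no exact count is
  attempted for general \<open>q\<close>. At \<open>q = p\<close> the factorials and binomial
  coefficients in the lower bound are units, and monotonicity carries this single estimate to the
  limit.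

  Over the complex numbers the infimum ranges over valuations without explicit form. They are
  controlled by a bound on logarithmic 2-forms and by slicing the length of a valuation ideal by
  powers of one line; monomial valuations serve as test divisors and as minimizers. Lengths are
  defined by chains of ideals in actual quotient rings, so both halves go through towers with simple
  steps, which in characteristic p also count residue classes.\<close>

definition sub_ideal :: "'a::comm_ring_1 set \<Rightarrow> 'a set \<Rightarrow> bool" where
  "sub_ideal R K \<longleftrightarrow> K \<subseteq> R \<and> 0 \<in> K \<and> (\<forall>a\<in>K. \<forall>b\<in>K. a + b \<in> K) \<and> (\<forall>r\<in>R. \<forall>a\<in>K. r * a \<in> K)"

definition adjoin :: "'a::comm_ring_1 set \<Rightarrow> 'a set \<Rightarrow> 'a \<Rightarrow> 'a set" where
  "adjoin R I g = {i + r * g | i r. i \<in> I \<and> r \<in> R}"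

text \<open>A composition series read from the bottom: \<open>M\<close> kills the adjoined
  \<open>g\<close> modulo \<open>I\<close>, so each step is a cyclic module over the quotient by
  \<open>M\<close>. When the elements outside \<open>M\<close> are units modulo \<open>I\<close>,
  the steps are simple.\<close>

inductive ideal_tower :: "'a::comm_ring_1 set \<Rightarrow> 'a set \<Rightarrow> 'a set \<Rightarrow> 'a set \<Rightarrow> nat \<Rightarrow> bool" for R M where
  tower_refl: "ideal_tower R M K K 0"
| tower_step: "g \<in> R \<Longrightarrow> g \<notin> I \<Longrightarrow> (\<And>z. z \<in> M \<Longrightarrow> z * g \<in> I) \<Longrightarrow>
     ideal_tower R M (adjoin R I g) K n \<Longrightarrow> ideal_tower R M I K (Suc n)"

text \<open>A strictly increasing function with values at most \<open>n\<close> bounds the length of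
  every chain of ideals between \<open>I\<close> and \<open>K\<close>, which is how a single tower
  controls all chains.\<close>

definition rank_on :: "'a::comm_ring_1 set \<Rightarrow> 'a set \<Rightarrow> 'a set \<Rightarrow> nat \<Rightarrow> ('a set \<Rightarrow> nat) \<Rightarrow> bool" where
  "rank_on R I K n rk \<longleftrightarrow>
     (\<forall>J. sub_ideal R J \<and> I \<subseteq> J \<and> J \<subseteq> K \<longrightarrow> rk J \<le> n) \<and>
     (\<forall>J J'. sub_ideal R J \<and> sub_ideal R J' \<and> I \<subseteq> J \<and> J \<subset> J' \<and> J' \<subseteq> K \<longrightarrow> rk J < rk J')"

lemma sub_idealD:
  assumes "sub_ideal R K"
  shows "a \<in> K \<Longrightarrow> a \<in> R" "0 \<in> K" "a \<in> K \<Longrightarrow> b \<in> K \<Longrightarrow> a + b \<in> K"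
    "r \<in> R \<Longrightarrow> a \<in> K \<Longrightarrow> r * a \<in> K"
  using assms by (auto simp: sub_ideal_def)

text \<open>Rings as subsets of a type with its own arithmetic. Two instances matter: all integral
  polynomials in two variables, and the local ring at the origin inside the function field.\<close>

locale type_subring =
  fixes R :: "'a::comm_ring_1 set"
  assumes one_closed: "1 \<in> R"
    and uminus_closed: "a \<in> R \<Longrightarrow> - a \<in> R"
    and add_closed: "a \<in> R \<Longrightarrow> b \<in> R \<Longrightarrow> a + b \<in> R"
    and mult_closed: "a \<in> R \<Longrightarrow> b \<in> R \<Longrightarrow> a * b \<in> R"
begin

lemma zero_closed: "0 \<in> R"
  using add_closed[OF one_closed uminus_closed[OF one_closed]] by simp

lemma diff_closed: "a \<in> R \<Longrightarrow> b \<in> R \<Longrightarrow> a - b \<in> R"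
  using add_closed[of a "- b"] uminus_closed[of b] by simp

lemma power_closed: "a \<in> R \<Longrightarrow> a ^ n \<in> R"
  by (induction n) (auto intro: mult_closed one_closed)

lemma sub_ideal_uminus: "sub_ideal R K \<Longrightarrow> a \<in> K \<Longrightarrow> - a \<in> K"
  using sub_idealD(4)[of R K "- 1" a] uminus_closed[OF one_closed] by simp

lemma sub_ideal_diff: "sub_ideal R K \<Longrightarrow> a \<in> K \<Longrightarrow> b \<in> K \<Longrightarrow> a - b \<in> K"
  using sub_idealD(3)[of R K a "- b"] sub_ideal_uminus[of K b] by simp

lemma sub_ideal_self: "sub_ideal R R"
  by (auto simp: sub_ideal_def zero_closed add_closed mult_closed)

lemma sub_ideal_adjoin:
  assumes "sub_ideal R I" "g \<in> R"
  shows "sub_ideal R (adjoin R I g)"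
  unfolding sub_ideal_def
proof (intro conjI ballI)
  show "adjoin R I g \<subseteq> R"
    using assms by (auto simp: adjoin_def intro!: add_closed mult_closed dest: sub_idealD(1))
  show "0 \<in> adjoin R I g"
    using sub_idealD(2)[OF assms(1)] zero_closed
    by (auto simp: adjoin_def intro!: exI[of _ "0::'a"])
next
  fix a b assume "a \<in> adjoin R I g" "b \<in> adjoin R I g"
  then obtain i r j s where "a = i + r * g" "b = j + s * g" "i \<in> I" "j \<in> I" "r \<in> R" "s \<in> R"
    by (auto simp: adjoin_def)
  then have "a + b = (i + j) + (r + s) * g" "i + j \<in> I" "r + s \<in> R"
    using sub_idealD(3)[OF assms(1)] add_closed by (auto simp: algebra_simps)
  then show "a + b \<in> adjoin R I g" unfolding adjoin_def by blast
next
  fix c a assume "c \<in> R" "a \<in> adjoin R I g"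
  then obtain i r where "a = i + r * g" "i \<in> I" "r \<in> R" by (auto simp: adjoin_def)
  then have "c * a = (c * i) + (c * r) * g" "c * i \<in> I" "c * r \<in> R"
    using sub_idealD(4)[OF assms(1)] mult_closed \<open>c \<in> R\<close> by (auto simp: algebra_simps)
  then show "c * a \<in> adjoin R I g" unfolding adjoin_def by blast
qed

lemma adjoin_superset: "sub_ideal R I \<Longrightarrow> I \<subseteq> adjoin R I g"
  unfolding adjoin_def using zero_closed by force

lemma adjoin_mem: "sub_ideal R I \<Longrightarrow> g \<in> adjoin R I g"
  unfolding adjoin_def using one_closed sub_idealD(2)[of R I] by force

lemma adjoin_least:
  assumes "sub_ideal R J" "I \<subseteq> J" "g \<in> J"
  shows "adjoin R I g \<subseteq> J"
  using assms unfolding adjoin_def by (auto intro!: sub_idealD(3)[OF assms(1)] sub_idealD(4)[OF assms(1)])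

lemma adjoin_mono: "I \<subseteq> J \<Longrightarrow> adjoin R I g \<subseteq> adjoin R J g"
  unfolding adjoin_def by blast

lemma tower_trans:
  "ideal_tower R M I K n \<Longrightarrow> ideal_tower R M K L m \<Longrightarrow> ideal_tower R M I L (n + m)"
  by (induction rule: ideal_tower.induct) (auto intro: tower_step)

lemma sub_ideal_scaled:
  assumes "sub_ideal R I" "sub_ideal R K" "x \<in> R"
  shows "sub_ideal R {i + x * k | i k. i \<in> I \<and> k \<in> K}"
  unfolding sub_ideal_def
proof (intro conjI ballI)
  show "{i + x * k | i k. i \<in> I \<and> k \<in> K} \<subseteq> R"
    using assms sub_idealD(1) by (auto intro!: add_closed mult_closed)
  show "0 \<in> {i + x * k | i k. i \<in> I \<and> k \<in> K}"
    using sub_idealD(2)[OF assms(1)] sub_idealD(2)[OF assms(2)] by force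
next
  fix a b assume "a \<in> {i + x * k | i k. i \<in> I \<and> k \<in> K}" "b \<in> {i + x * k | i k. i \<in> I \<and> k \<in> K}"
  then obtain i k j l where "a = i + x * k" "b = j + x * l" "i \<in> I" "j \<in> I" "k \<in> K" "l \<in> K" by blast
  then have "a + b = (i + j) + x * (k + l)" "i + j \<in> I" "k + l \<in> K"
    using sub_idealD(3)[OF assms(1)] sub_idealD(3)[OF assms(2)] by (auto simp: algebra_simps)
  then show "a + b \<in> {i + x * k | i k. i \<in> I \<and> k \<in> K}" by blast
next
  fix r a assume "r \<in> R" "a \<in> {i + x * k | i k. i \<in> I \<and> k \<in> K}"
  then obtain i k where "a = i + x * k" "i \<in> I" "k \<in> K" by blast
  then have "r * a = r * i + x * (r * k)" "r * i \<in> I" "r * k \<in> K"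
    using sub_idealD(4)[OF assms(1)] sub_idealD(4)[OF assms(2)] \<open>r \<in> R\<close>
    by (simp_all add: distrib_left mult.left_commute)
  then show "r * a \<in> {i + x * k | i k. i \<in> I \<and> k \<in> K}" by blast
qed

text \<open>Multiplication by \<open>x\<close> embeds the quotient by the colon of \<open>I\<close>
  and \<open>x\<close> into the quotient by \<open>I\<close>. The hypothesis that this colon lies in
  \<open>I'\<close> keeps the steps proper, so that the length of a valuation ideal can be sliced by
  powers of \<open>x\<close>.\<close>

lemma tower_scale:
  assumes "ideal_tower R M I' K n" "sub_ideal R I'" "sub_ideal R I" "x \<in> R"
    and "\<And>r. r \<in> R \<Longrightarrow> x * r \<in> I \<Longrightarrow> r \<in> I'"
  shows "ideal_tower R M {i + x * k | i k. i \<in> I \<and> k \<in> I'} {i + x * k | i k. i \<in> I \<and> k \<in> K} n"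
  using assms
proof (induction rule: ideal_tower.induct)
  case (tower_refl K)
  show ?case by (rule ideal_tower.tower_refl)
next
  case (tower_step g I' K n)
  note sI' = tower_step.prems(1) and sI = tower_step.prems(2) and col = tower_step.prems(4)
  let ?S = "\<lambda>K. {i + x * k | i k. i \<in> I \<and> k \<in> K}"
  have "adjoin R (?S I') (x * g) = ?S (adjoin R I' g)"
  proof (intro equalityI subsetI)
    fix a assume "a \<in> adjoin R (?S I') (x * g)"
    then obtain i k r where a: "a = (i + x * k) + r * (x * g)" "i \<in> I" "k \<in> I'" "r \<in> R"
      by (auto simp: adjoin_def)
    then have "a = i + x * (k + r * g)" by (simp add: algebra_simps)
    with a show "a \<in> ?S (adjoin R I' g)" unfolding adjoin_def by blast
  next
    fix a assume "a \<in> ?S (adjoin R I' g)"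
    then obtain i k r where a: "a = i + x * (k + r * g)" "i \<in> I" "k \<in> I'" "r \<in> R"
      by (auto simp: adjoin_def)
    then have "a = (i + x * k) + r * (x * g)" by (simp add: algebra_simps)
    with a show "a \<in> adjoin R (?S I') (x * g)" unfolding adjoin_def by blast
  qed
  moreover have "ideal_tower R M (?S (adjoin R I' g)) (?S K) n"
  proof (rule tower_step.IH)
    show "sub_ideal R (adjoin R I' g)" using sub_ideal_adjoin[OF sI' tower_step.hyps(1)] .
    show "r \<in> adjoin R I' g" if "r \<in> R" "x * r \<in> I" for r
      using col[OF that] adjoin_superset[OF sI'] by blast
  qed fact+
  moreover have "x * g \<notin> ?S I'"
  proof
    assume "x * g \<in> ?S I'"
    then obtain i k where ik: "x * g = i + x * k" "i \<in> I" "k \<in> I'" by blast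
    then have "x * (g - k) = i" by (simp add: algebra_simps)
    then have "g - k \<in> I'"
      using col[of "g - k"] ik diff_closed[OF tower_step.hyps(1) sub_idealD(1)[OF sI' ik(3)]] by simp
    from sub_idealD(3)[OF sI' this ik(3)] show False using tower_step.hyps(2) by simp
  qed
  moreover have "z * (x * g) \<in> ?S I'" if "z \<in> M" for z
  proof -
    have "z * (x * g) = 0 + x * (z * g)" by (simp add: algebra_simps)
    then show ?thesis using tower_step.hyps(3)[OF that] sub_idealD(2)[OF sI] by blast
  qed
  ultimately show ?case
    using mult_closed[OF tower_step.prems(3) tower_step.hyps(1)] by (auto intro: ideal_tower.tower_step)
qed

lemma tower_chain:
  "ideal_tower R M I K n \<Longrightarrow> sub_ideal R I \<Longrightarrow>
     \<exists>J. (\<forall>i\<le>n. sub_ideal R (J i) \<and> I \<subseteq> J i) \<and> (\<forall>i<n. J i \<subset> J (Suc i))"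
proof (induction rule: ideal_tower.induct)
  case (tower_refl K)
  then show ?case by (intro exI[of _ "\<lambda>_. K"]) auto
next
  case (tower_step g I K n)
  obtain J where J: "\<And>i. i \<le> n \<Longrightarrow> sub_ideal R (J i) \<and> adjoin R I g \<subseteq> J i"
      "\<And>i. i < n \<Longrightarrow> J i \<subset> J (Suc i)"
    using tower_step.IH sub_ideal_adjoin[OF tower_step.prems tower_step.hyps(1)] by blast
  note sup = adjoin_superset[OF tower_step.prems, of g] adjoin_mem[OF tower_step.prems, of g]
  show ?case
  proof (intro exI[of _ "\<lambda>i. case i of 0 \<Rightarrow> I | Suc k \<Rightarrow> J k"] conjI allI impI)
    fix i assume "i \<le> Suc n"
    then show "sub_ideal R (case i of 0 \<Rightarrow> I | Suc k \<Rightarrow> J k)" "I \<subseteq> (case i of 0 \<Rightarrow> I | Suc k \<Rightarrow> J k)"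
      using J(1)[of "i - 1"] tower_step.prems sup by (cases i; force)+
  next
    fix i assume "i < Suc n"
    then show "(case i of 0 \<Rightarrow> I | Suc k \<Rightarrow> J k) \<subset> (case Suc i of 0 \<Rightarrow> I | Suc k \<Rightarrow> J k)"
      using J(1)[of i] J(2)[of "i - 1"] sup tower_step.hyps(2) by (cases i) auto
  qed
qed

text \<open>
  The subquotients of a tower are simple modules, so the number of jumps along the tower is a
  strictly increasing function of the ideal (Jordan--Hoelder).
\<close>

lemma tower_rank:
  assumes "ideal_tower R M I K n" "sub_ideal R I"
    and "\<forall>r\<in>R - M. \<exists>s\<in>R. s * r - 1 \<in> I"
  shows "\<exists>rk. rank_on R I K n rk"
  using assms
proof (induction rule: ideal_tower.induct)
  case (tower_refl K)
  then show ?case by (intro exI[of _ "\<lambda>_. 0"]) (auto simp: rank_on_def)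
next
  case (tower_step g I K n)
  let ?I' = "adjoin R I g"
  note sub = tower_step.prems(1)
  have sI': "sub_ideal R ?I'" "I \<subseteq> ?I'" "g \<in> ?I'"
    using sub_ideal_adjoin[OF sub tower_step.hyps(1)] adjoin_superset[OF sub] adjoin_mem[OF sub] by auto
  obtain rk where rk: "rank_on R ?I' K n rk"
  proof -
    have "\<forall>r\<in>R - M. \<exists>s\<in>R. s * r - 1 \<in> ?I'"
      using tower_step.prems(2) sI'(2) by blast
    from tower_step.IH[OF sI'(1) this] show ?thesis
      by (elim exE, intro that)
  qed
  have rk1: "rk J \<le> n" if "sub_ideal R J" "?I' \<subseteq> J" "J \<subseteq> K" for J
    using rk that by (simp add: rank_on_def)
  have rk2: "rk J < rk J'"
    if "sub_ideal R J" "sub_ideal R J'" "?I' \<subseteq> J" "J \<subset> J'" "J' \<subseteq> K" for J J'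
    using rk that by (simp add: rank_on_def)
  have IK: "?I' \<subseteq> K"
    using tower_step.hyps(4) sI'(1)
  proof (induction rule: ideal_tower.induct)
    case (tower_step h I K n)
    then show ?case using adjoin_superset[OF tower_step.prems, of h]
        sub_ideal_adjoin[OF tower_step.prems tower_step.hyps(1)] by auto
  qed auto
  \<comment> \<open>The new bottom step contributes one exactly when \<open>J\<close> contains
    \<open>g\<close>; the remaining steps are seen through \<open>J\<close> enlarged by
    \<open>g\<close>.\<close>
  define f where "f J = rk (adjoin R J g) + (if g \<in> J then 1 else 0)" for J
  have ad: "sub_ideal R (adjoin R J g)" "?I' \<subseteq> adjoin R J g" "J \<subseteq> adjoin R J g"
    if "sub_ideal R J" "I \<subseteq> J" for J
    using that sub_ideal_adjoin[OF that(1) tower_step.hyps(1)] adjoin_mono[OF that(2)]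
      adjoin_superset[OF that(1)] by auto
  have adK: "adjoin R J g \<subseteq> K" if "sub_ideal R J" "J \<subseteq> K" "sub_ideal R K" for J
    using that adjoin_least[of K J g] IK sI' by auto
  have adeq: "adjoin R J g = J" if "sub_ideal R J" "g \<in> J" for J
    using adjoin_least[OF that(1) order_refl that(2)] adjoin_superset[OF that(1)] by blast
  have sK: "sub_ideal R K"
    using tower_step.hyps(4) sI'(1)
  proof (induction rule: ideal_tower.induct)
    case (tower_step h I K n)
    then show ?case using sub_ideal_adjoin[OF tower_step.prems tower_step.hyps(1)] by auto
  qed auto
  show ?case
    unfolding rank_on_def
  proof (intro exI[of _ f] conjI allI impI; elim conjE)
    fix J assume J: "sub_ideal R J" "I \<subseteq> J" "J \<subseteq> K"
    then have "rk (adjoin R J g) \<le> n" using rk1 ad adK sK by auto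
    then show "f J \<le> Suc n" by (auto simp: f_def)
  next
    fix J J' assume J: "sub_ideal R J" "sub_ideal R J'" "I \<subseteq> J" "J \<subset> J'" "J' \<subseteq> K"
    have IJ': "I \<subseteq> J'" and JK: "J \<subseteq> K" using J by auto
    note a1 = ad[OF J(1,3)] and a2 = ad[OF J(2) IJ']
    have mono: "adjoin R J g \<subseteq> adjoin R J' g" using J by (intro adjoin_mono) auto
    then have le: "rk (adjoin R J g) \<le> rk (adjoin R J' g)"
  proof (cases "adjoin R J g = adjoin R J' g")
    case False
    then have "adjoin R J g \<subset> adjoin R J' g" using mono by blast
    then show ?thesis using rk2[OF a1(1) a2(1) a1(2)] adK[OF J(2) J(5) sK] by (simp add: less_imp_le)
  qed simp
    show "f J < f J'"
    proof (cases "g \<in> J")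
      case True
      then have "g \<in> J'" using J by auto
      then show ?thesis
        using rk2[OF J(1,2) _ J(4,5)] a1(2) True J by (auto simp: f_def adeq)
    next
      case False
      show ?thesis
      proof (cases "g \<in> J'")
        case True then show ?thesis using le False by (auto simp: f_def)
      next
        case g': False
        \<comment> \<open>Otherwise some \<open>j\<close> in \<open>J'\<close> outside
          \<open>J\<close> equals \<open>i + r * g\<close>. If \<open>r\<close> is in
          \<open>M\<close>, then \<open>r * g\<close> lies in \<open>I\<close> and \<open>j\<close>
          in \<open>J\<close>; if not, \<open>r\<close> is invertible modulo \<open>I\<close> and
          \<open>g\<close> is forced into \<open>J'\<close>.\<close>
        have "adjoin R J g \<noteq> adjoin R J' g"
        proof
          assume eq: "adjoin R J g = adjoin R J' g"
          obtain j where j: "j \<in> J'" "j \<notin> J" using J by auto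
          then have "j \<in> adjoin R J g" using eq a2 by auto
          then obtain i r where ir: "j = i + r * g" "i \<in> J" "r \<in> R" by (auto simp: adjoin_def)
          show False
          proof (cases "r \<in> M")
            case True
            then have "r * g \<in> J" using tower_step.hyps(3) J by auto
            then show False using ir j sub_idealD(3)[OF J(1)] by auto
          next
            case False
            then obtain s where s: "s \<in> R" "s * r - 1 \<in> I" using tower_step.prems(2) ir by auto
            have rg: "r * g \<in> J'" using ir j sub_ideal_diff[OF J(2) j(1), of i] J by auto
            have "g * (s * r - 1) \<in> J'"
              using sub_idealD(4)[OF J(2) tower_step.hyps(1)] s IJ' by auto
            moreover have "s * (r * g) \<in> J'" using sub_idealD(4)[OF J(2) s(1) rg] .
            ultimately have "s * (r * g) - g * (s * r - 1) \<in> J'" using sub_ideal_diff[OF J(2)] by auto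
            then show False using g' by (simp add: algebra_simps)
          qed
        qed
        then show ?thesis
          using rk2[OF a1(1) a2(1) a1(2)] mono adK[OF J(2) J(5) sK] False g'
          by (auto simp: f_def)
      qed
    qed
  qed
qed

lemma tower_chain_bound:
  assumes "ideal_tower R M I R n" "sub_ideal R I"
    and "\<forall>r\<in>R - M. \<exists>s\<in>R. s * r - 1 \<in> I"
    and J: "\<And>i. i \<le> k \<Longrightarrow> sub_ideal R (J i) \<and> I \<subseteq> J i" "\<And>i. i < k \<Longrightarrow> J i \<subset> J (Suc i)"
  shows "k \<le> n"
proof -
  obtain rk where rk: "rank_on R I R n rk"
    using tower_rank[OF assms(1-3)] by blast
  have rk1: "rk J \<le> n" if "sub_ideal R J" "I \<subseteq> J" "J \<subseteq> R" for J
    using rk that by (simp add: rank_on_def)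
  have rk2: "rk J < rk J'"
    if "sub_ideal R J" "sub_ideal R J'" "I \<subseteq> J" "J \<subset> J'" "J' \<subseteq> R" for J J'
    using rk that by (simp add: rank_on_def)
  have "i \<le> rk (J i)" if "i \<le> k" for i
    using that
  proof (induction i)
    case (Suc i)
    then have "rk (J i) < rk (J (Suc i))"
      using J(1)[of i] J(1)[of "Suc i"] J(2)[of i] by (intro rk2) (auto dest: sub_idealD(1))
    then show ?case using Suc by auto
  qed auto
  from this[of k] rk1[of "J k"] J(1)[of k] show ?thesis by (force dest: sub_idealD(1))
qed

text \<open>Ideals of \<open>A\<close> correspond to the ideals of \<open>R\<close> containing the
  kernel: preimages of a chain in \<open>A\<close> are bounded by the rank function of the tower,
  while the images of the tower form a chain of full length.\<close>

lemma ring_length_eq: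
  fixes A :: "('b, 'c) ring_scheme" and \<psi> :: "'a \<Rightarrow> 'b"
  assumes A: "ring A" and surj: "carrier A = \<psi> ` R"
    and hom: "\<And>a b. a \<in> R \<Longrightarrow> b \<in> R \<Longrightarrow> \<psi> (a + b) = \<psi> a \<oplus>\<^bsub>A\<^esub> \<psi> b"
      "\<And>a b. a \<in> R \<Longrightarrow> b \<in> R \<Longrightarrow> \<psi> (a * b) = \<psi> a \<otimes>\<^bsub>A\<^esub> \<psi> b"
    and ker: "\<And>a. a \<in> R \<Longrightarrow> \<psi> a = \<zero>\<^bsub>A\<^esub> \<longleftrightarrow> a \<in> I"
    and tow: "ideal_tower R M I R n" "sub_ideal R I"
      "\<forall>r\<in>R - M. \<exists>s\<in>R. s * r - 1 \<in> I"
  shows "ring_length A = enat n"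
proof -
  interpret A: ring A by fact
  have cl: "\<psi> a \<in> carrier A" if "a \<in> R" for a using that surj by auto
  have z: "\<psi> 0 = \<zero>\<^bsub>A\<^esub>" using ker[OF zero_closed] sub_idealD(2)[OF tow(2)] by simp
  have um: "\<psi> (- a) = \<ominus>\<^bsub>A\<^esub> \<psi> a" if "a \<in> R" for a
  proof -
    have "\<psi> (- a) \<oplus>\<^bsub>A\<^esub> \<psi> a = \<zero>\<^bsub>A\<^esub>"
      using hom(1)[OF uminus_closed[OF that] that] z by simp
    from A.minus_equality[OF this cl[OF that] cl[OF uminus_closed[OF that]]] show ?thesis by simp
  qed
  have pre: "sub_ideal R {r \<in> R. \<psi> r \<in> J} \<and> I \<subseteq> {r \<in> R. \<psi> r \<in> J}" if "ideal J A" for J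
  proof -
    interpret J: ideal J A by fact
    have "a \<in> R \<and> \<psi> a = \<zero>\<^bsub>A\<^esub>" if "a \<in> I" for a
      using ker[of a] sub_idealD(1)[OF tow(2)] that by simp
    then show ?thesis
      unfolding sub_ideal_def
      by (auto simp: zero_closed z add_closed mult_closed hom cl J.I_l_closed)
  qed
  have img: "ideal (\<psi> ` K) A" if K: "sub_ideal R K" for K
  proof (rule idealI[OF A])
    show "subgroup (\<psi> ` K) (add_monoid A)"
    proof (rule A.add.subgroupI)
      show "\<psi> ` K \<subseteq> carrier A" using cl sub_idealD(1)[OF K] by auto
      show "\<psi> ` K \<noteq> {}" using sub_idealD(2)[OF K] by auto
      show "\<ominus>\<^bsub>A\<^esub> a \<in> \<psi> ` K" if ak: "a \<in> \<psi> ` K" for a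
      proof -
        obtain k where k: "k \<in> K" "a = \<psi> k" using ak by auto
        then have "\<ominus>\<^bsub>A\<^esub> a = \<psi> (- k)" using um[of k] sub_idealD(1)[OF K] by simp
        then show ?thesis using sub_ideal_uminus[OF K k(1)] by blast
      qed
      show "a \<oplus>\<^bsub>A\<^esub> b \<in> \<psi> ` K" if ab: "a \<in> \<psi> ` K" "b \<in> \<psi> ` K" for a b
      proof -
        obtain k l where k: "k \<in> K" "a = \<psi> k" "l \<in> K" "b = \<psi> l" using ab by auto
        then have "a \<oplus>\<^bsub>A\<^esub> b = \<psi> (k + l)" using hom(1)[of k l] sub_idealD(1)[OF K] by simp
        then show ?thesis using sub_idealD(3)[OF K k(1,3)] by blast
      qed
    qed
    show "x \<otimes>\<^bsub>A\<^esub> a \<in> \<psi> ` K" if xa: "a \<in> \<psi> ` K" "x \<in> carrier A" for a x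
    proof -
      obtain k r where kr: "a = \<psi> k" "x = \<psi> r" "k \<in> K" "r \<in> R" using xa surj by auto
      then have "x \<otimes>\<^bsub>A\<^esub> a = \<psi> (r * k)" using hom(2)[of r k] sub_idealD(1)[OF K] by simp
      then show ?thesis using sub_idealD(4)[OF K] kr by blast
    qed
    show "a \<otimes>\<^bsub>A\<^esub> x \<in> \<psi> ` K" if ax: "a \<in> \<psi> ` K" "x \<in> carrier A" for a x
    proof -
      obtain k r where kr: "a = \<psi> k" "x = \<psi> r" "k \<in> K" "r \<in> R" using ax surj by auto
      then have "a \<otimes>\<^bsub>A\<^esub> x = \<psi> (r * k)" using hom(2)[of k r] sub_idealD(1)[OF K] by (simp add: mult.commute)
      then show ?thesis using sub_idealD(4)[OF K] kr by blast
    qed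
  qed
  have le: "k \<le> n" if J: "\<forall>i\<le>k. ideal (J i) A" "\<forall>i<k. J i \<subset> J (Suc i)" for k and J :: "nat \<Rightarrow> 'b set"
  proof (rule tower_chain_bound[OF tow, where J = "\<lambda>i. {r \<in> R. \<psi> r \<in> J i}"])
    show "sub_ideal R {r \<in> R. \<psi> r \<in> J i} \<and> I \<subseteq> {r \<in> R. \<psi> r \<in> J i}" if "i \<le> k" for i
      using pre J that by auto
    show "{r \<in> R. \<psi> r \<in> J i} \<subset> {r \<in> R. \<psi> r \<in> J (Suc i)}" if "i < k" for i
    proof -
      have 1: "J i \<subset> J (Suc i)" using J that by auto
      have "J (Suc i) \<subseteq> carrier A" using J that ideal.Icarr[of "J (Suc i)" A] by (auto simp: Suc_le_eq)
      then have "\<exists>r\<in>R. \<psi> r \<in> J (Suc i) \<and> \<psi> r \<notin> J i" using 1 unfolding surj by blast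
      then show ?thesis using 1 by auto
    qed
  qed
  obtain J where J: "\<And>i. i \<le> n \<Longrightarrow> sub_ideal R (J i) \<and> I \<subseteq> J i" "\<And>i. i < n \<Longrightarrow> J i \<subset> J (Suc i)"
    using tower_chain[OF tow(1,2)] by blast
  have ex: "\<exists>J. (\<forall>i\<le>n. ideal (J i) A) \<and> (\<forall>i<n. J i \<subset> J (Suc i))"
  proof (intro exI[of _ "\<lambda>i. \<psi> ` J i"] conjI allI impI)
    fix i assume "i \<le> n" then show "ideal (\<psi> ` J i) A" using img J by auto
  next
    fix i assume i: "i < n"
    then obtain a where a: "a \<in> J (Suc i)" "a \<notin> J i" using J(2) by blast
    have s: "sub_ideal R (J i)" "I \<subseteq> J i" "sub_ideal R (J (Suc i))" using J(1)[of i] J(1)[of "Suc i"] i by auto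
    have "\<psi> a \<notin> \<psi> ` J i"
    proof
      assume "\<psi> a \<in> \<psi> ` J i"
      then obtain k where k: "k \<in> J i" "\<psi> a = \<psi> k" by auto
      have R: "a \<in> R" "k \<in> R" using k a s by (auto dest: sub_idealD(1))
      have "\<psi> (a + - k) = \<zero>\<^bsub>A\<^esub>"
        using hom(1)[OF R(1) uminus_closed[OF R(2)]] um[OF R(2)] k cl R by (simp add: A.r_neg)
      then have "a + - k \<in> I" using ker[OF add_closed[OF R(1) uminus_closed[OF R(2)]]] by simp
      then have "(a + - k) + k \<in> J i" using sub_idealD(3)[OF s(1) _ k(1)] s(2) by blast
      then show False using a by simp
    qed
    then show "\<psi> ` J i \<subset> \<psi> ` J (Suc i)" using J(2)[OF i] a by blast
  qed
  show ?thesis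
    unfolding ring_length_def
  proof (rule antisym)
    show "Sup {enat n |n. \<exists>J. (\<forall>i\<le>n. ideal (J i) A) \<and> (\<forall>i<n. J i \<subset> J (Suc i))} \<le> enat n"
      by (rule Sup_least) (auto dest: le)
    show "enat n \<le> Sup {enat n |n. \<exists>J. (\<forall>i\<le>n. ideal (J i) A) \<and> (\<forall>i<n. J i \<subset> J (Suc i))}"
      by (rule Sup_upper) (use ex in blast)
  qed
qed

text \<open>Surjectivity of \<open>\<phi>\<close> is asked only modulo \<open>I\<^sub>0\<close>.
  Thus the length of a quotient of a localization can be computed in the ring before localizing,
  where no fractions occur.\<close>

lemma colength_eq:
  fixes A :: "('b, 'c) ring_scheme" and \<phi> :: "'a \<Rightarrow> 'b"
  assumes "ideal I\<^sub>0 A" and cl: "\<And>a. a \<in> R \<Longrightarrow> \<phi> a \<in> carrier A"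
    and surj: "\<And>z. z \<in> carrier A \<Longrightarrow> \<exists>r\<in>R. z \<ominus>\<^bsub>A\<^esub> \<phi> r \<in> I\<^sub>0"
    and hom: "\<And>a b. a \<in> R \<Longrightarrow> b \<in> R \<Longrightarrow> \<phi> (a + b) = \<phi> a \<oplus>\<^bsub>A\<^esub> \<phi> b"
      "\<And>a b. a \<in> R \<Longrightarrow> b \<in> R \<Longrightarrow> \<phi> (a * b) = \<phi> a \<otimes>\<^bsub>A\<^esub> \<phi> b"
    and tow: "ideal_tower R M {r \<in> R. \<phi> r \<in> I\<^sub>0} R n" "sub_ideal R {r \<in> R. \<phi> r \<in> I\<^sub>0}"
      "\<forall>r\<in>R - M. \<exists>s\<in>R. \<phi> (s * r - 1) \<in> I\<^sub>0"
  shows "colength A I\<^sub>0 = real n"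
proof -
  interpret I: ideal I\<^sub>0 A by fact
  note qh = I.rcos_ring_hom
  have "ring_length (A Quot I\<^sub>0) = enat n"
  proof (rule ring_length_eq[where \<psi> = "\<lambda>a. I\<^sub>0 +>\<^bsub>A\<^esub> \<phi> a", OF I.quotient_is_ring _ _ _ _ tow(1,2)])
    show "carrier (A Quot I\<^sub>0) = (\<lambda>a. I\<^sub>0 +>\<^bsub>A\<^esub> \<phi> a) ` R"
    proof (intro equalityI subsetI)
      fix C assume "C \<in> carrier (A Quot I\<^sub>0)"
      then obtain z where z: "z \<in> carrier A" "C = I\<^sub>0 +>\<^bsub>A\<^esub> z"
        by (auto simp: FactRing_def A_RCOSETS_def')
      obtain r where r: "r \<in> R" "z \<ominus>\<^bsub>A\<^esub> \<phi> r \<in> I\<^sub>0" using surj z by auto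
      then have "C = I\<^sub>0 +>\<^bsub>A\<^esub> \<phi> r"
        using I.quotient_eq_iff_same_a_r_cos[OF I.is_ideal z(1) cl[OF r(1)]] z by auto
      then show "C \<in> (\<lambda>a. I\<^sub>0 +>\<^bsub>A\<^esub> \<phi> a) ` R" using r by auto
    qed (use cl ring_hom_closed[OF qh] in auto)
    show "I\<^sub>0 +>\<^bsub>A\<^esub> \<phi> (a + b) = (I\<^sub>0 +>\<^bsub>A\<^esub> \<phi> a) \<oplus>\<^bsub>A Quot I\<^sub>0\<^esub> (I\<^sub>0 +>\<^bsub>A\<^esub> \<phi> b)" if "a \<in> R" "b \<in> R" for a b
      using that hom cl ring_hom_add[OF qh] by simp
    show "I\<^sub>0 +>\<^bsub>A\<^esub> \<phi> (a * b) = (I\<^sub>0 +>\<^bsub>A\<^esub> \<phi> a) \<otimes>\<^bsub>A Quot I\<^sub>0\<^esub> (I\<^sub>0 +>\<^bsub>A\<^esub> \<phi> b)" if "a \<in> R" "b \<in> R" for a b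
      using that hom cl ring_hom_mult[OF qh] by simp
    show "(I\<^sub>0 +>\<^bsub>A\<^esub> \<phi> a = \<zero>\<^bsub>A Quot I\<^sub>0\<^esub>) = (a \<in> {r \<in> R. \<phi> r \<in> I\<^sub>0})" if "a \<in> R" for a
      using I.a_rcos_const[of "\<phi> a"] I.a_rcos_self[OF cl[OF that]] that by (auto simp: FactRing_def)
    show "\<forall>r\<in>R - M. \<exists>s\<in>R. s * r - 1 \<in> {r \<in> R. \<phi> r \<in> I\<^sub>0}"
      using tow(3) diff_closed mult_closed one_closed by blast
  qed
  then show ?thesis by (simp add: colength_def)
qed

end

section \<open>Polynomials in two variables\<close>

definition cf :: "'a::zero poly poly \<Rightarrow> nat \<Rightarrow> nat \<Rightarrow> 'a" where
  "cf g i j = Polynomial.coeff (Polynomial.coeff g j) i"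

lemma cf_add [simp]: "cf (g + h) i j = cf g i j + cf h i j"
  and cf_diff [simp]: "cf (g' - h') i j = cf g' i j - cf h' i j"
  and cf_0 [simp]: "cf 0 i j = 0"
  for g h :: "'a::comm_ring_1 poly poly" and g' h' :: "'a::comm_ring_1 poly poly"
  by (simp_all add: cf_def)

lemma cf_mult:
  "cf (g * h) i j = (\<Sum>b\<le>j. \<Sum>a\<le>i. cf g a b * cf h (i - a) (j - b))"
  for g h :: "'a::comm_ring_1 poly poly"
  by (simp add: cf_def coeff_mult coeff_sum)

lemma poly2_eqI: "(\<And>i j. cf g i j = cf h i j) \<Longrightarrow> g = h"
  by (simp add: cf_def poly_eq_iff)

lemma var_x_power: "var_x ^ n = [:Polynomial.monom 1 n:]"
  by (induction n) (simp_all add: var_x_def monom_Suc one_pCons monom_0)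

lemma var_y_power: "var_y ^ n = Polynomial.monom 1 n"
  by (induction n) (simp_all add: var_y_def monom_Suc monom_0 flip: one_pCons)

lemma cf_x_power_mult: "cf (var_x ^ n * g) i j = (if n \<le> i then cf g (i - n) j else 0)"
  for g :: "'a::comm_ring_1 poly poly"
  by (simp add: cf_def var_x_power coeff_monom_mult)

lemma cf_y_power_mult: "cf (var_y ^ n * g) i j = (if n \<le> j then cf g i (j - n) else 0)"
  for g :: "'a::comm_ring_1 poly poly"
  by (simp add: cf_def var_y_power coeff_monom_mult)

lemma cf_const_mult: "cf ([:[:c:]:] * g) i j = c * cf g i j"
  for g :: "'a::comm_ring_1 poly poly"
  by (simp add: cf_def)

lemma cf_const: "cf [:[:c:]:] i j = (if i = 0 \<and> j = 0 then c else 0)"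
  by (cases i; cases j) (auto simp: cf_def)

lemma cf_1: "cf 1 i j = (if i = 0 \<and> j = 0 then 1 else 0)"
  by (simp add: one_pCons cf_const)

lemma cf_monomial: "cf (var_x ^ m * var_y ^ n) i j = (if i = m \<and> j = n then 1 else 0)"
proof -
  have "cf (var_x ^ m * (var_y ^ n * 1)) i j = (if i = m \<and> j = n then 1 else (0::'a))"
    unfolding cf_x_power_mult cf_y_power_mult cf_1 by auto
  then show ?thesis by simp
qed

lemma cf_sum: "cf (sum f A) i j = (\<Sum>a\<in>A. cf (f a) i j)"
  for f :: "'b \<Rightarrow> 'a::comm_ring_1 poly poly"
  by (simp add: cf_def coeff_sum)

lemma of_int_poly2: "of_int n = [:[:of_int n:]:]" for n :: int
  by (simp add: of_int_poly)

lemma cf_of_int: "cf (of_int n * g) i j = of_int n * cf g i j"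
  for g :: "'a::comm_ring_1 poly poly"
  by (simp only: of_int_poly2 cf_const_mult)

lemma cf_of_nat: "cf (of_nat n * g) i j = of_nat n * cf g i j"
  for g :: "'a::comm_ring_1 poly poly"
  using cf_of_int[of "int n" g i j] by simp

lemma at_origin_cf: "at_origin g = cf g 0 0"
  by (simp add: at_origin_def cf_def poly_0_coeff_0)

lemma at_origin_simps [simp]:
  "at_origin (g + h) = at_origin g + at_origin h" "at_origin (g - h) = at_origin g - at_origin h"
  "at_origin (- g) = - at_origin g"
  "at_origin (g * h) = at_origin g * at_origin h" "at_origin 0 = 0" "at_origin 1 = 1"
  "at_origin var_x = 0" "at_origin var_y = 0" "at_origin (g ^ n) = at_origin g ^ n"
  "at_origin [:[:c:]:] = c"
  "at_origin (of_nat n) = of_nat n"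
  for g h :: "'a::comm_ring_1 poly poly"
  by (simp_all add: at_origin_def var_x_def var_y_def)

lemma split_origin:
  fixes g :: "'a::comm_ring_1 poly poly"
  obtains a b where "g = [:[:at_origin g:]:] + var_x * a + var_y * b"
proof -
  obtain c g' where g: "g = pCons c g'" by (cases g)
  obtain c0 c' where c: "c = pCons c0 c'" by (cases c)
  have "g = [:[:at_origin g:]:] + var_x * [:c':] + var_y * g'"
    by (simp add: g c at_origin_def var_x_def var_y_def)
  then show ?thesis using that by blast
qed

lemma poly2_induct [case_names const x y add mult]:
  fixes g :: "'a::comm_ring_1 poly poly"
  assumes const: "\<And>c. Q [:[:c:]:]" and x: "Q var_x" and y: "Q var_y"
    and add: "\<And>g h. Q g \<Longrightarrow> Q h \<Longrightarrow> Q (g + h)" and mult: "\<And>g h. Q g \<Longrightarrow> Q h \<Longrightarrow> Q (g * h)"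
  shows "Q g"
proof -
  have inner: "Q [:c:]" for c
  proof (induction c)
    case 0 show ?case using const[of 0] by simp
  next
    case (pCons a c)
    have "[:pCons a c:] = [:[:a:]:] + var_x * [:c:]" by (simp add: var_x_def)
    then show ?case using add[OF const mult[OF x pCons.IH]] by simp
  qed
  show ?thesis
  proof (induction g)
    case 0 show ?case using const[of 0] by simp
  next
    case (pCons c g)
    have "pCons c g = [:c:] + var_y * g" by (simp add: var_y_def)
    then show ?case using add[OF inner mult[OF y pCons.IH]] by simp
  qed
qed

section \<open>Congruences and substitution homomorphisms\<close>

lemma power_dvd_cong:
  fixes a b :: "'a::comm_ring_1"
  shows "d dvd a - b \<Longrightarrow> d dvd a ^ n - b ^ n"
  by (metis power_diff_sumr2 dvd_triv_left dvd_trans)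

definition unital_hom :: "('a::comm_ring_1 \<Rightarrow> 'b::comm_ring_1) \<Rightarrow> bool" where
  "unital_hom k \<longleftrightarrow> k 1 = 1 \<and> (\<forall>a b. k (a + b) = k a + k b) \<and> (\<forall>a b. k (a * b) = k a * k b)"

lemma unital_homD:
  assumes "unital_hom k"
  shows "k 0 = 0" "k 1 = 1" "k (a + b) = k a + k b" "k (a * b) = k a * k b" "k (- a) = - k a"
    "k (a - b) = k a - k b" "k (a ^ n) = k a ^ n" "k (sum h A) = (\<Sum>s\<in>A. k (h s))"
    "k (of_nat m) = of_nat m"
proof -
  have a: "k (a + b) = k a + k b" for a b using assms by (simp add: unital_hom_def)
  show 0: "k 0 = 0" using a[of 0 0] by simp
  show 1: "k 1 = 1" "k (a + b) = k a + k b" using assms by (simp_all add: unital_hom_def)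
  show m: "k (a * b) = k a * k b" for a b using assms by (simp add: unital_hom_def)
  show u: "k (- a) = - k a" for a using a[of "- a" a] 0 by (simp add: eq_neg_iff_add_eq_0)
  show "k (a - b) = k a - k b" using a[of a "- b"] u by simp
  show "k (a ^ n) = k a ^ n" by (induction n) (simp_all add: 1 m)
  show "k (sum h A) = (\<Sum>s\<in>A. k (h s))"
    by (induction A rule: infinite_finite_induct) (simp_all add: 0 a)
  show "k (of_nat m) = of_nat m" by (induction m) (simp_all add: 0 1 a)
qed

lemma unital_hom_map_poly:
  assumes "unital_hom k"
  shows "unital_hom (map_poly k)"
proof -
  note k = unital_homD[OF assms]
  have c: "Polynomial.coeff (map_poly k p) n = k (Polynomial.coeff p n)" for p n by (simp add: coeff_map_poly k)
  show ?thesis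
    unfolding unital_hom_def
    by (auto simp: poly_eq_iff c coeff_mult k one_pCons map_poly_pCons)
qed

lemma unital_hom_poly: "unital_hom (\<lambda>p. poly p z)"
  by (simp add: unital_hom_def)

lemma unital_hom_comp: "unital_hom k \<Longrightarrow> unital_hom l \<Longrightarrow> unital_hom (\<lambda>a. l (k a))"
  by (simp add: unital_hom_def)

lemma unital_hom_const: "unital_hom (\<lambda>c::'a::comm_ring_1. [:c:])"
  by (simp add: unital_hom_def one_pCons)

lemma unital_hom_const2: "unital_hom (\<lambda>c::'a::comm_ring_1. [:[:c:]:])"
  by (simp add: unital_hom_def one_pCons)

text \<open>Evaluation of both variables, with coefficients moved along \<open>k\<close>. Linear
  changes of coordinates, restriction to a line, the lift of Frobenius and the weight grading are
  all instances.\<close>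

definition bieval :: "('a::comm_ring_1 \<Rightarrow> 'b::comm_ring_1) \<Rightarrow> 'b \<Rightarrow> 'b \<Rightarrow> 'a poly poly \<Rightarrow> 'b" where
  "bieval k u v g = poly (map_poly (\<lambda>c. poly (map_poly k c) u) g) v"

lemma unital_hom_bieval:
  assumes "unital_hom k"
  shows "unital_hom (bieval k u v)"
  unfolding bieval_def
  by (intro unital_hom_comp[OF _ unital_hom_poly, of "map_poly (\<lambda>c. poly (map_poly k c) u)"]
      unital_hom_map_poly unital_hom_comp[OF _ unital_hom_poly, of "map_poly k"] assms)

lemma bieval_simps:
  assumes "unital_hom k"
  shows "bieval k u v [:[:c:]:] = k c" "bieval k u v var_x = u" "bieval k u v var_y = v"
  by (simp_all add: bieval_def var_x_def var_y_def map_poly_pCons unital_homD[OF assms])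

lemma hom_ext:
  assumes "unital_hom h" "unital_hom h'" "\<And>c. h [:[:c:]:] = h' [:[:c:]:]"
    "h var_x = h' var_x" "h var_y = h' var_y"
  shows "h g = h' g"
  by (induction g rule: poly2_induct)
    (simp_all add: assms unital_homD(3,4)[OF assms(1)] unital_homD(3,4)[OF assms(2)])

section \<open>The colon ideals in characteristic p\<close>

interpretation UNIV: type_subring UNIV
  by unfold_locales auto

text \<open>The ideal generated by \<open>p\<close>, \<open>x^q\<close> and \<open>y^q\<close> in
  the integral polynomials. Keeping \<open>p\<close> among the generators replaces the quotient ring
  over the prime field by congruences of integer coefficients.\<close>

definition box_ideal :: "nat \<Rightarrow> nat \<Rightarrow> int poly poly set" where
  "box_ideal p q = {g. \<forall>i<q. \<forall>j<q. int p dvd cf g i j}"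

definition colon_box :: "nat \<Rightarrow> nat \<Rightarrow> int poly poly \<Rightarrow> int poly poly set" where
  "colon_box p q F = {g. g * F \<in> box_ideal p q}"

lemma box_ideal_add: "g \<in> box_ideal p q \<Longrightarrow> h \<in> box_ideal p q \<Longrightarrow> g + h \<in> box_ideal p q"
  by (simp add: box_ideal_def)

lemma box_ideal_diff: "g \<in> box_ideal p q \<Longrightarrow> h \<in> box_ideal p q \<Longrightarrow> g - h \<in> box_ideal p q"
  by (simp add: box_ideal_def)

lemma box_ideal_mult: "g \<in> box_ideal p q \<Longrightarrow> r * g \<in> box_ideal p q"
  by (auto simp: box_ideal_def cf_mult intro!: dvd_sum dvd_mult)

lemma box_ideal_mult_right: "g \<in> box_ideal p q \<Longrightarrow> g * r \<in> box_ideal p q"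
  using box_ideal_mult[of g p q r] by (simp add: mult.commute)

lemma sub_ideal_box: "sub_ideal UNIV (box_ideal p q)"
  by (auto simp: sub_ideal_def box_ideal_add box_ideal_mult) (simp add: box_ideal_def)

lemma box_ideal_gens:
  "of_nat p * g \<in> box_ideal p q" "var_x ^ q * g \<in> box_ideal p q" "var_y ^ q * g \<in> box_ideal p q"
  by (auto simp: box_ideal_def cf_of_nat cf_x_power_mult cf_y_power_mult)

lemma sub_ideal_colon: "sub_ideal UNIV (colon_box p q F)"
  by (auto simp: sub_ideal_def colon_box_def box_ideal_add box_ideal_mult distrib_right mult.assoc)
    (simp add: box_ideal_def)

lemma box_subset_colon: "box_ideal p q \<subseteq> colon_box p q F"
  by (auto simp: colon_box_def box_ideal_mult_right)

lemma split_x_power: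
  fixes g :: "'a::comm_ring_1 poly poly"
  obtains g0 g1 where "g = g0 + var_x ^ q * g1" "\<And>i j. cf g0 i j = (if i < q then cf g i j else 0)"
proof -
  have c: "Polynomial.coeff (map_poly (poly_shift q) g) j = poly_shift q (Polynomial.coeff g j)"
    "Polynomial.coeff (map_poly (poly_cutoff q) g) j = poly_cutoff q (Polynomial.coeff g j)" for j
    by (simp_all add: coeff_map_poly)
  have "g = map_poly (poly_cutoff q) g + var_x ^ q * map_poly (poly_shift q) g"
  proof (rule poly2_eqI)
    fix i j
    show "cf g i j = cf (map_poly (poly_cutoff q) g + var_x ^ q * map_poly (poly_shift q) g) i j"
      unfolding cf_add cf_x_power_mult
      by (simp add: cf_def c coeff_poly_cutoff coeff_poly_shift)
  qed
  moreover have "cf (map_poly (poly_cutoff q) g) i j = (if i < q then cf g i j else 0)" for i j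
    by (simp add: cf_def c coeff_poly_cutoff)
  ultimately show ?thesis using that by blast
qed

lemma split_y_power:
  fixes g :: "'a::comm_ring_1 poly poly"
  obtains g0 g1 where "g = g0 + var_y ^ q * g1" "\<And>i j. cf g0 i j = (if j < q then cf g i j else 0)"
proof -
  have "g = poly_cutoff q g + var_y ^ q * poly_shift q g"
  proof (rule poly2_eqI)
    fix i j
    show "cf g i j = cf (poly_cutoff q g + var_y ^ q * poly_shift q g) i j"
      unfolding cf_add cf_y_power_mult
      by (simp add: cf_def coeff_poly_cutoff coeff_poly_shift)
  qed
  moreover have "cf (poly_cutoff q g) i j = (if j < q then cf g i j else 0)" for i j
    by (simp add: cf_def coeff_poly_cutoff)
  ultimately show ?thesis using that by blast
qed

lemma dvd_cf_imp_multiple: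
  assumes "\<And>i j. int p dvd cf g i j"
  obtains h where "g = of_nat p * h"
proof -
  define h where "h = map_poly (map_poly (\<lambda>c. c div int p)) g"
  have "g = of_nat p * h"
  proof (rule poly2_eqI)
    fix i j
    show "cf g i j = cf (of_nat p * h) i j"
      using assms[of i j] unfolding cf_of_nat by (simp add: cf_def h_def coeff_map_poly)
  qed
  then show ?thesis using that by blast
qed

lemma box_ideal_decomp:
  assumes "g \<in> box_ideal p q"
  obtains a b c where "g = of_nat p * a + var_x ^ q * b + var_y ^ q * c"
proof -
  obtain g0 b where g0: "g = g0 + var_x ^ q * b" "\<And>i j. cf g0 i j = (if i < q then cf g i j else 0)"
    using split_x_power by blast
  obtain g1 c where g1: "g0 = g1 + var_y ^ q * c" "\<And>i j. cf g1 i j = (if j < q then cf g0 i j else 0)"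
    using split_y_power by blast
  have "int p dvd cf g1 i j" for i j
    using assms by (auto simp: g1(2) g0(2) box_ideal_def)
  then obtain a where "g1 = of_nat p * a" using dvd_cf_imp_multiple by blast
  then show ?thesis using that[of a b c] g0 g1 by (simp add: algebra_simps)
qed

section \<open>Units, residue classes and lengths modulo the box ideal\<close>

lemma int_unit_mod_prime:
  assumes "Factorial_Ring.prime p" "\<not> int p dvd u"
  obtains w where "int p dvd w * u - 1"
proof -
  have "gcd u (int p) = 1"
    using prime_imp_coprime[of "int p" u] assms by (simp add: coprime_iff_gcd_eq_1 gcd.commute)
  then have "fst (bezout_coefficients u (int p)) * u - 1 = int p * (- snd (bezout_coefficients u (int p)))"
    using bezout_coefficients_fst_snd[of u "int p"] by (simp add: algebra_simps)
  then show ?thesis using that dvdI by blast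
qed

lemma sum_in_box_ideal: "(\<And>a. a \<in> A \<Longrightarrow> f a \<in> box_ideal p q) \<Longrightarrow> sum f A \<in> box_ideal p q"
  by (auto simp: box_ideal_def cf_sum intro!: dvd_sum)

text \<open>In a monomial of degree \<open>2 * q\<close> one of the two exponents reaches
  \<open>q\<close>; the multiple of \<open>p\<close> is discarded by a congruence. So the maximal
  ideal of the origin is nilpotent modulo the box ideal.\<close>

lemma nilpotent_mod_box: "(of_nat p * a + var_x * b + var_y * c) ^ (2 * q) \<in> box_ideal p q"
proof -
  let ?n = "var_x * b + var_y * c" and ?m = "of_nat p * a + var_x * b + var_y * c"
  have "(var_x * b) ^ k * (var_y * c) ^ (2 * q - k) \<in> box_ideal p q" if "k \<le> 2 * q" for k
  proof (cases "q \<le> k")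
    case True
    then have "(var_x * b) ^ k = var_x ^ q * (var_x ^ (k - q) * b ^ k)"
      by (simp add: power_mult_distrib flip: mult.assoc power_add)
    then have "(var_x * b) ^ k * (var_y * c) ^ (2 * q - k) =
        var_x ^ q * (var_x ^ (k - q) * b ^ k * (var_y * c) ^ (2 * q - k))"
      by (simp only: mult.assoc)
    then show ?thesis by (simp only: box_ideal_gens)
  next
    case False
    then have "(var_y * c) ^ (2 * q - k) = var_y ^ q * (var_y ^ (q - k) * c ^ (2 * q - k))"
      by (simp add: power_mult_distrib mult_2 flip: mult.assoc power_add)
    then have "(var_x * b) ^ k * (var_y * c) ^ (2 * q - k) =
        var_y ^ q * (var_y ^ (q - k) * c ^ (2 * q - k) * (var_x * b) ^ k)"
      by (simp only: mult_ac)
    then show ?thesis by (simp only: box_ideal_gens)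
  qed
  then have "?n ^ (2 * q) \<in> box_ideal p q"
    unfolding binomial_ring mult.assoc[of "of_nat _"]
    by - (rule sum_in_box_ideal, rule box_ideal_mult, simp)
  moreover have "of_nat p dvd ?m ^ (2 * q) - ?n ^ (2 * q)"
    by (rule power_dvd_cong) simp
  then have "?m ^ (2 * q) - ?n ^ (2 * q) \<in> box_ideal p q"
    by (auto simp: dvd_def box_ideal_gens mult.assoc)
  ultimately show ?thesis using box_ideal_add by fastforce
qed

text \<open>After normalizing the constant term, \<open>u\<close> becomes \<open>1 - n\<close> with
  \<open>n\<close> nilpotent, and a finite geometric series inverts it. Denominators of the local
  ring are therefore already units modulo the box ideal.\<close>

lemma unit_mod_box:
  assumes "Factorial_Ring.prime p" "\<not> int p dvd at_origin u"
  obtains w where "w * u - 1 \<in> box_ideal p q"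
proof -
  obtain w0 where "int p dvd w0 * at_origin u - 1" using int_unit_mod_prime[OF assms] by blast
  then obtain k where k: "w0 * at_origin u - 1 = int p * k" by (auto simp: dvd_def)
  obtain a b where ab: "u = [:[:at_origin u:]:] + var_x * a + var_y * b" by (rule split_origin)
  define W K :: "int poly poly" where "W = [:[:w0:]:]" and "K = [:[:k:]:]"
  define n where "n = of_nat p * - K + var_x * - (W * a) + var_y * - (W * b)"
  have "W * u = [:[:w0 * at_origin u:]:] + W * (var_x * a) + W * (var_y * b)"
    by (subst ab) (simp add: W_def algebra_simps)
  also have "w0 * at_origin u = 1 + int p * k" using k by simp
  also have "[:[:1 + int p * k:]:] = 1 + of_nat p * K"
    by (simp add: of_nat_poly one_pCons K_def)
  finally have e: "W * u = 1 - n" by (simp add: n_def algebra_simps)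
  have "(\<Sum>i<2 * q. n ^ i) * (W * u) = 1 - n ^ (2 * q)"
    unfolding e by (simp add: one_diff_power_eq mult.commute)
  moreover have "n ^ (2 * q) \<in> box_ideal p q" unfolding n_def by (rule nilpotent_mod_box)
  ultimately have "((\<Sum>i<2 * q. n ^ i) * W) * u - 1 \<in> box_ideal p q"
    using sub_idealD(4)[OF sub_ideal_box, of "- 1" "n ^ (2 * q)"] by (simp add: mult.assoc)
  then show ?thesis using that by blast
qed

text \<open>Coset representatives. Over the prime field the number of cosets is \<open>p\<close> to
  the length, so lengths can be compared through injections of finite sets instead of exact
  sequences.\<close>

definition transversal :: "'a::comm_ring_1 set \<Rightarrow> 'a set \<Rightarrow> bool" where
  "transversal I T \<longleftrightarrow> finite T \<and> (\<forall>g. \<exists>!t. t \<in> T \<and> g - t \<in> I)"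

lemma transversal_card_le:
  assumes T: "transversal I T" and I: "sub_ideal UNIV I" and S: "finite S" "\<And>g. \<psi> g \<in> S"
    and inj: "\<And>g h. \<psi> g = \<psi> h \<Longrightarrow> g - h \<in> I"
  shows "card T \<le> card S"
proof (rule card_inj_on_le)
  show "inj_on \<psi> T"
  proof (rule inj_onI)
    fix s t assume "s \<in> T" "t \<in> T" "\<psi> s = \<psi> t"
    moreover have "s - s \<in> I" using sub_idealD(2)[OF I] by simp
    ultimately show "s = t" using T inj by (metis transversal_def)
  qed
qed (use S in auto)

lemma transversal_card_ge:
  assumes T: "transversal I T" and I: "sub_ideal UNIV I"
    and U: "\<And>u v. u \<in> U \<Longrightarrow> v \<in> U \<Longrightarrow> u - v \<in> I \<Longrightarrow> u = v"
  shows "finite U \<and> card U \<le> card T"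
proof -
  obtain r where r: "\<And>g. r g \<in> T \<and> g - r g \<in> I" using T unfolding transversal_def by metis
  have "inj_on r U"
  proof (rule inj_onI)
    fix u v assume uv: "u \<in> U" "v \<in> U" "r u = r v"
    have "(u - r u) - (v - r v) \<in> I" using UNIV.sub_ideal_diff[OF I] r by blast
    then show "u = v" using uv U by simp
  qed
  moreover have "r ` U \<subseteq> T" "finite T" using r T by (auto simp: transversal_def)
  ultimately show ?thesis using card_inj_on_le inj_on_finite by blast
qed

text \<open>Induction on the number of monomials of the box outside \<open>I\<close>. Such a
  monomial of largest degree is killed by \<open>p\<close>, \<open>x\<close> and \<open>y\<close>
  modulo \<open>I\<close>; adjoining it adds one step and multiplies the number of cosets by
  \<open>p\<close>.\<close>

lemma tower_and_transversal:
  assumes p: "Factorial_Ring.prime p" and I: "sub_ideal UNIV I" "box_ideal p q \<subseteq> I"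
  shows "\<exists>n T. ideal_tower UNIV {g. int p dvd at_origin g} I UNIV n \<and> transversal I T \<and> card T = p ^ n"
  using I
proof (induction "card {(i, j). i < q \<and> j < q \<and> var_x ^ i * var_y ^ j \<notin> I}" arbitrary: I rule: less_induct)
  case less
  let ?E = "\<lambda>I. {(i, j). i < q \<and> j < q \<and> var_x ^ i * var_y ^ j \<notin> I}"
  note I = less.prems(1) and bI = less.prems(2)
  have fin: "finite (?E I)" for I :: "int poly poly set"
    by (rule finite_subset[of _ "{..<q} \<times> {..<q}"]) auto
  show ?case
  proof (cases "1 \<in> I")
    case True
    then have "I = UNIV" using sub_idealD(4)[OF I _ True] by auto
    moreover have "transversal UNIV {0::int poly poly}" by (auto simp: transversal_def)
    ultimately show ?thesis
      by (intro exI[of _ 0] exI[of _ "{0}"]) (auto intro: ideal_tower.tower_refl)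
  next
    case False
    have "q > 0"
    proof (rule ccontr)
      assume "\<not> q > 0" then have "1 \<in> box_ideal p q" by (simp add: box_ideal_def)
      then show False using False bI by auto
    qed
    then have ne: "(0, 0) \<in> ?E I" using False by simp
    then obtain m n where mn: "(m, n) \<in> ?E I" "\<And>i j. (i, j) \<in> ?E I \<Longrightarrow> i + j \<le> m + n"
    proof -
      let ?s = "\<lambda>e::nat \<times> nat. fst e + snd e"
      have "Max (?s ` ?E I) \<in> ?s ` ?E I" by (rule Max_in) (use fin ne in blast)+
      then obtain e where "e \<in> ?E I" "?s e = Max (?s ` ?E I)" by auto
      then have e: "e \<in> ?E I" "\<And>e'. e' \<in> ?E I \<Longrightarrow> ?s e' \<le> ?s e"
        using Max_ge[of "?s ` ?E I"] fin by auto
      show ?thesis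
        by (rule that[of "fst e" "snd e"]) (use e in \<open>force+\<close>)
    qed
    define g where "g = (var_x ^ m * var_y ^ n :: int poly poly)"
    have gI: "g \<notin> I" using mn by (simp add: g_def)
    have pg: "of_nat p * h \<in> I" "var_x ^ q * h \<in> I" "var_y ^ q * h \<in> I" for h
      using box_ideal_gens bI by blast+
    have xg: "var_x * g \<in> I"
    proof (cases "Suc m < q")
      case True
      then have "(Suc m, n) \<notin> ?E I" using mn(2)[of "Suc m" n] by auto
      then show ?thesis using True mn(1) by (auto simp: g_def mult.assoc)
    next
      case False
      then have "Suc m = q" using mn(1) by auto
      then show ?thesis using pg(2)[of "var_y ^ n"] by (auto simp: g_def mult.assoc)
    qed
    have yg: "var_y * g \<in> I"
    proof (cases "Suc n < q")
      case True
      then have "(m, Suc n) \<notin> ?E I" using mn(2)[of m "Suc n"] by auto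
      then show ?thesis using True mn(1) by (auto simp: g_def mult_ac)
    next
      case False
      then have "Suc n = q" using mn(1) by auto
      then show ?thesis using pg(3)[of "var_x ^ m"] by (auto simp: g_def mult_ac)
    qed
    have const: "r * g - of_int (at_origin r) * g \<in> I" for r
    proof -
      obtain a b where ab: "r = [:[:at_origin r:]:] + var_x * a + var_y * b" by (rule split_origin)
      have "r * g = [:[:at_origin r:]:] * g + (a * (var_x * g) + b * (var_y * g))"
        by (subst ab) (simp add: algebra_simps)
      moreover have "a * (var_x * g) + b * (var_y * g) \<in> I"
        using sub_idealD(3,4)[OF I] xg yg by simp
      ultimately show ?thesis by (simp add: of_int_poly2)
    qed
    have ig: "of_int c * g \<in> I \<longleftrightarrow> int p dvd c" for c
    proof
      assume "int p dvd c"
      then obtain d where "c = int p * d" by (auto simp: dvd_def)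
      then have "of_int c * g = of_nat p * (of_int d * g)" by simp
      then show "of_int c * g \<in> I" by (simp only: pg)
    next
      assume *: "of_int c * g \<in> I"
      show "int p dvd c"
      proof (rule ccontr)
        assume "\<not> int p dvd c"
        then obtain w where "int p dvd w * c - 1" using int_unit_mod_prime[OF p] by blast
        then obtain k where "w * c - 1 = int p * k" by (auto simp: dvd_def)
        then have "w * c = 1 + int p * k" by simp
        then have "of_int w * (of_int c * g) = g + of_nat p * (of_int k * g)"
          by (metis (no_types, opaque_lifting) mult.assoc of_int_mult of_int_add of_int_1 of_int_of_nat_eq distrib_right mult_1)
        moreover have "of_int w * (of_int c * g) \<in> I" using sub_idealD(4)[OF I] * by simp
        ultimately have "(g + of_nat p * (of_int k * g)) - of_nat p * (of_int k * g) \<in> I"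
          using UNIV.sub_ideal_diff[OF I _ pg(1)] by metis
        then show False using gI by simp
      qed
    qed
    have zg: "z * g \<in> I" if "int p dvd at_origin z" for z
      using sub_idealD(3)[OF I const[of z]] ig[of "at_origin z"] that by fastforce
    let ?I' = "adjoin UNIV I g"
    have I': "sub_ideal UNIV ?I'" "I \<subseteq> ?I'" "g \<in> ?I'"
      using UNIV.sub_ideal_adjoin[OF I] UNIV.adjoin_superset[OF I] UNIV.adjoin_mem[OF I] by auto
    have "?E ?I' \<subset> ?E I" using I' mn(1) by (auto simp: g_def)
    then have "card (?E ?I') < card (?E I)" using fin by (simp add: psubset_card_mono)
    then obtain k T where kT: "ideal_tower UNIV {g. int p dvd at_origin g} ?I' UNIV k"
      "transversal ?I' T" "card T = p ^ k"
      using less.hyps[of ?I'] I' bI by blast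
    have tow: "ideal_tower UNIV {g. int p dvd at_origin g} I UNIV (Suc k)"
      by (rule ideal_tower.tower_step[of g]) (use gI zg kT in auto)
    \<comment> \<open>Modulo \<open>I\<close> a multiple \<open>r * g\<close> depends only on the
      constant term of \<open>r\<close> modulo \<open>p\<close>, so every old representative splits
      into exactly \<open>p\<close> new ones.\<close>
    define \<theta> where "\<theta> = (\<lambda>(t, c::nat). t + of_nat c * g)"
    define T' where "T' = \<theta> ` (T \<times> {..<p})"
    have uniq: "t = t' \<and> c = c'"
      if "h - \<theta> (t, c) \<in> I" "h - \<theta> (t', c') \<in> I" "t \<in> T" "t' \<in> T" "c < p" "c' < p" for h t t' c c'
    proof -
      have "h - t = (h - \<theta> (t, c)) + of_nat c * g" "h - t' = (h - \<theta> (t', c')) + of_nat c' * g"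
        by (simp_all add: \<theta>_def)
      then have "h - t \<in> ?I'" "h - t' \<in> ?I'" using that unfolding adjoin_def by blast+
      then have tt: "t = t'" using kT(2) that by (metis transversal_def)
      have "(h - \<theta> (t, c)) - (h - \<theta> (t', c')) \<in> I" using UNIV.sub_ideal_diff[OF I] that by blast
      then have "of_int (int c' - int c) * g \<in> I" by (simp add: tt \<theta>_def algebra_simps)
      then have "int p dvd int c' - int c" using ig by blast
      then have "c = c'" using that(5,6) dvd_imp_le_int[of "int c' - int c" "int p"] by force
      then show ?thesis using tt by simp
    qed
    have "inj_on \<theta> (T \<times> {..<p})"
    proof (rule inj_onI)
      fix e e' assume e: "e \<in> T \<times> {..<p}" "e' \<in> T \<times> {..<p}" "\<theta> e = \<theta> e'"
      obtain t c t' c' where tc: "e = (t, c)" "e' = (t', c')" by (cases e; cases e')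
      have a: "t \<in> T" "c < p" "t' \<in> T" "c' < p" "\<theta> (t, c) = \<theta> (t', c')"
        using e by (simp_all add: tc)
      then have z: "\<theta> (t, c) - \<theta> (t, c) \<in> I" "\<theta> (t, c) - \<theta> (t', c') \<in> I"
        using sub_idealD(2)[OF I] by (simp_all add: a(5))
      from uniq[OF z] a(1-4) show "e = e'" by (simp add: tc)
    qed
    then have card: "card T' = p ^ Suc k" unfolding T'_def using kT(3) by (simp add: card_image card_cartesian_product)
    have "\<exists>!s. s \<in> T' \<and> h - s \<in> I" for h
    proof -
      obtain t where t: "t \<in> T" "h - t \<in> ?I'" using kT(2) unfolding transversal_def by blast
      then obtain i r where ir: "h - t = i + r * g" "i \<in> I" by (auto simp: adjoin_def)
      define c where "c = nat (at_origin r mod int p)"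
      have pp: "int p > 0" using p prime_gt_0_nat by simp
      have c: "c < p" "int c = at_origin r mod int p" using pp by (simp_all add: c_def nat_less_iff)
      have "of_int (at_origin r - int c) * g \<in> I" unfolding ig c by simp
      then have "(r * g - of_int (at_origin r) * g) + of_int (at_origin r - int c) * g \<in> I"
        using sub_idealD(3)[OF I const] by blast
      then have "i + ((r * g - of_int (at_origin r) * g) + of_int (at_origin r - int c) * g) \<in> I"
        using sub_idealD(3)[OF I ir(2)] by blast
      moreover have "i + ((r * g - of_int (at_origin r) * g) + of_int (at_origin r - int c) * g) = h - \<theta> (t, c)"
        using ir(1) by (simp add: \<theta>_def algebra_simps)
      ultimately have "h - \<theta> (t, c) \<in> I" by simp
      then have ex: "\<theta> (t, c) \<in> T' \<and> h - \<theta> (t, c) \<in> I" using t c by (auto simp: T'_def)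
      show ?thesis
      proof (rule ex1I[of _ "\<theta> (t, c)"])
        show "s = \<theta> (t, c)" if s: "s \<in> T' \<and> h - s \<in> I" for s
        proof -
          obtain t' c' where "s = \<theta> (t', c')" "t' \<in> T" "c' < p" using s by (auto simp: T'_def)
          then show ?thesis using uniq[of h t' c' t c] s ex t c by simp
        qed
      qed (rule ex)
    qed
    then have "transversal I T'" using kT(2) by (simp add: transversal_def T'_def)
    then show ?thesis using tow card by blast
  qed
qed

text \<open>The chosen number serves for a tower and for a transversal at once, hence is both the
  length and the base \<open>p\<close> logarithm of the number of residue classes.\<close>

definition box_length :: "nat \<Rightarrow> nat \<Rightarrow> int poly poly \<Rightarrow> nat" where
  "box_length p q F = (SOME n. \<exists>T. ideal_tower UNIV {g. int p dvd at_origin g} (colon_box p q F) UNIV n \<and>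
     transversal (colon_box p q F) T \<and> card T = p ^ n)"

lemma box_length:
  assumes "Factorial_Ring.prime p"
  obtains T where "ideal_tower UNIV {g. int p dvd at_origin g} (colon_box p q F) UNIV (box_length p q F)"
    "transversal (colon_box p q F) T" "card T = p ^ box_length p q F"
proof -
  have "\<exists>T. ideal_tower UNIV {g. int p dvd at_origin g} (colon_box p q F) UNIV (box_length p q F) \<and>
     transversal (colon_box p q F) T \<and> card T = p ^ box_length p q F"
    unfolding box_length_def
    using tower_and_transversal[OF assms sub_ideal_colon box_subset_colon] by (rule someI_ex)
  then show ?thesis using that by blast
qed

text \<open>Linear algebra over the prime field in counting form: \<open>\<psi>\<close> plays the
  role of \<open>n\<close> linear conditions whose common kernel lies in the colon ideal.\<close>

lemma box_length_le:
  assumes p: "Factorial_Ring.prime p" and S: "finite S" "\<And>g. \<psi> g \<in> S" "card S \<le> p ^ n"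
    and inj: "\<And>g h. \<psi> g = \<psi> h \<Longrightarrow> (g - h) * F \<in> box_ideal p q"
  shows "box_length p q F \<le> n"
proof -
  obtain T where T: "transversal (colon_box p q F) T" "card T = p ^ box_length p q F"
    using box_length[OF p] by metis
  have "card T \<le> card S"
    by (rule transversal_card_le[OF T(1) sub_ideal_colon S(1), where \<psi> = \<psi>])
      (simp_all add: colon_box_def S(2) inj)
  then have "p ^ box_length p q F \<le> p ^ n" using T S by simp
  then show ?thesis using p prime_gt_1_nat power_le_imp_le_exp by blast
qed

lemma box_length_ge:
  assumes p: "Factorial_Ring.prime p" and U: "p ^ n \<le> card U"
    and indep: "\<And>u v. u \<in> U \<Longrightarrow> v \<in> U \<Longrightarrow> (u - v) * F \<in> box_ideal p q \<Longrightarrow> u = v"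
  shows "n \<le> box_length p q F"
proof -
  obtain T where T: "transversal (colon_box p q F) T" "card T = p ^ box_length p q F"
    using box_length[OF p] by metis
  have "finite U \<and> card U \<le> card T"
    by (rule transversal_card_ge[OF T(1) sub_ideal_colon]) (simp add: colon_box_def indep)
  then have "p ^ n \<le> p ^ box_length p q F" using T U by simp
  then show ?thesis using p prime_gt_1_nat power_le_imp_le_exp by blast
qed

text \<open>An automorphism preserving the box ideal maps the colon ideal of \<open>F\<close> onto
  that of \<open>\<sigma> F\<close>. As \<open>\<sigma>\<close> is an involution, the reverse
  inequality follows by applying the same bound to \<open>\<sigma> F\<close>.\<close>

lemma box_length_involution_le:
  assumes p: "Factorial_Ring.prime p" and \<sigma>: "unital_hom \<sigma>" "\<And>g. \<sigma> (\<sigma> g) = g"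
    "\<And>g. g \<in> box_ideal p q \<Longrightarrow> \<sigma> g \<in> box_ideal p q"
  shows "box_length p q F \<le> box_length p q (\<sigma> F)"
proof -
  obtain T where T: "transversal (colon_box p q F) T" "card T = p ^ box_length p q F"
    using box_length[OF p] by metis
  note hom = unital_homD[OF \<sigma>(1)]
  have inj: "inj \<sigma>" using \<sigma>(2) by (metis injI)
  show ?thesis
  proof (rule box_length_ge[OF p, where U = "\<sigma> ` T"])
    show "p ^ box_length p q F \<le> card (\<sigma> ` T)"
      using T inj by (simp add: card_image inj_on_subset)
    fix u v assume uv: "u \<in> \<sigma> ` T" "v \<in> \<sigma> ` T" "(u - v) * \<sigma> F \<in> box_ideal p q"
    then obtain s t where st: "s \<in> T" "t \<in> T" "u = \<sigma> s" "v = \<sigma> t" by auto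
    have "\<sigma> ((u - v) * \<sigma> F) = (s - t) * F" by (simp add: hom \<sigma>(2) st)
    then have "s - t \<in> colon_box p q F" using \<sigma>(3)[OF uv(3)] by (simp add: colon_box_def)
    moreover have "s - s \<in> colon_box p q F" by (simp add: colon_box_def box_ideal_def)
    ultimately have "s = t" using T(1) st(1,2) unfolding transversal_def by blast
    then show "u = v" using st by simp
  qed
qed

lemma box_length_involution:
  assumes p: "Factorial_Ring.prime p" and \<sigma>: "unital_hom \<sigma>" "\<And>g. \<sigma> (\<sigma> g) = g"
    "\<And>g. g \<in> box_ideal p q \<Longrightarrow> \<sigma> g \<in> box_ideal p q"
  shows "box_length p q (\<sigma> F) = box_length p q F"
  using box_length_involution_le[OF assms, of F] box_length_involution_le[OF assms, of "\<sigma> F"] \<sigma>(2)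
  by simp

section \<open>Symmetries of the three lines\<close>

abbreviation (input) lines :: "nat \<Rightarrow> nat \<Rightarrow> nat \<Rightarrow> 'a::comm_ring_1 poly poly" where
  "lines A B C \<equiv> var_x ^ A * var_y ^ B * (var_x + var_y) ^ C"

lemma box_length_swap:
  assumes p: "Factorial_Ring.prime p"
  shows "box_length p q (lines B A C) = box_length p q (lines A B C)"
proof -
  let ?\<sigma> = "bieval (\<lambda>c::int. [:[:c:]:]) var_y var_x"
  have h: "unital_hom ?\<sigma>" by (intro unital_hom_bieval unital_hom_const2)
  note hs = unital_homD[OF h] bieval_simps[OF unital_hom_const2]
  have inv: "?\<sigma> (?\<sigma> g) = g" for g
    by (rule hom_ext[of "\<lambda>g. ?\<sigma> (?\<sigma> g)" "\<lambda>g. g"]) (simp_all add: unital_hom_comp[OF h h] hs, simp add: unital_hom_def)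
  have "?\<sigma> g \<in> box_ideal p q" if gb: "g \<in> box_ideal p q" for g
  proof -
    obtain a b c where "g = of_nat p * a + var_x ^ q * b + var_y ^ q * c" using box_ideal_decomp[OF gb] .
    then show ?thesis by (simp add: hs box_ideal_add box_ideal_gens)
  qed
  from box_length_involution[OF p h inv this, of "lines A B C"] show ?thesis
    by (simp add: hs mult_ac add.commute)
qed

lemma power_add_mod_prime:
  fixes a b :: "'a::comm_ring_1"
  assumes p: "Factorial_Ring.prime p"
  shows "of_nat p dvd (a + b) ^ p ^ e - (a ^ p ^ e + b ^ p ^ e)"
proof (induction e)
  case (Suc e)
  have 1: "of_nat p dvd (a + b) ^ p - (a ^ p + b ^ p)" for a b :: 'a
  proof -
    have "p > 0" using p prime_gt_0_nat by blast
    then have s: "{..p} = {0, p} \<union> {0<..<p}" "{0, p} \<inter> {0<..<p} = {}" by auto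
    have "(a + b) ^ p = (\<Sum>k\<in>{0, p}. of_nat (p choose k) * a ^ k * b ^ (p - k)) +
        (\<Sum>k\<in>{0<..<p}. of_nat (p choose k) * a ^ k * b ^ (p - k))"
      unfolding binomial_ring s(1) by (rule sum.union_disjoint) (use s in auto)
    also have "(\<Sum>k\<in>{0, p}. of_nat (p choose k) * a ^ k * b ^ (p - k)) = a ^ p + b ^ p"
      using \<open>p > 0\<close> by simp
    finally have "(a + b) ^ p - (a ^ p + b ^ p) = (\<Sum>k\<in>{0<..<p}. of_nat (p choose k) * a ^ k * b ^ (p - k))"
      by simp
    moreover have "of_nat p dvd (of_nat (p choose k) * a ^ k * b ^ (p - k))" if "k \<in> {0<..<p}" for k
    proof -
      have "p dvd p choose k" using that p by (intro dvd_choose_prime) auto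
      then obtain m where "p choose k = p * m" by (elim dvdE)
      then show ?thesis by (simp add: mult.assoc)
    qed
    ultimately show ?thesis by (metis (no_types, lifting) dvd_sum)
  qed
  have pe: "c ^ p ^ Suc e = (c ^ p ^ e) ^ p" for c :: 'a by (simp add: power_mult[symmetric] mult.commute)
  have "of_nat p dvd ((a + b) ^ p ^ e) ^ p - (a ^ p ^ e + b ^ p ^ e) ^ p"
    using Suc by (rule power_dvd_cong)
  from dvd_add[OF this 1[of "a ^ p ^ e" "b ^ p ^ e"]] show ?case unfolding pe by (simp add: add_diff_eq)
qed simp

text \<open>The involution \<open>x -> x + y\<close>, \<open>y -> - y\<close> exchanges
  \<open>x\<close> with \<open>x + y\<close>. It preserves the box ideal because \<open>q\<close> is
  a power of \<open>p\<close>, so that \<open>(x + y)^q\<close> is \<open>x^q + y^q\<close> modulo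
  \<open>p\<close>; the sign produced by \<open>y\<close> does not affect the colon ideal.\<close>

lemma box_length_shear:
  assumes p: "Factorial_Ring.prime p"
  shows "box_length p (p ^ e) (lines C B A) = box_length p (p ^ e) (lines A B C)"
proof -
  let ?q = "p ^ e"
  let ?\<sigma> = "bieval (\<lambda>c::int. [:[:c:]:]) (var_x + var_y) (- var_y)"
  have h: "unital_hom ?\<sigma>" by (intro unital_hom_bieval unital_hom_const2)
  note hs = unital_homD[OF h] bieval_simps[OF unital_hom_const2]
  have inv: "?\<sigma> (?\<sigma> g) = g" for g
    by (rule hom_ext[of "\<lambda>g. ?\<sigma> (?\<sigma> g)" "\<lambda>g. g"]) (simp_all add: unital_hom_comp[OF h h] hs, simp add: unital_hom_def)
  have xy: "(var_x + var_y) ^ ?q * b \<in> box_ideal p ?q" for b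
  proof -
    obtain k where k: "(var_x + var_y) ^ ?q - (var_x ^ ?q + var_y ^ ?q) = (of_nat p * k :: int poly poly)"
      using power_add_mod_prime[OF p, of var_x var_y e] by (auto simp: dvd_def)
    then have "(var_x + var_y) ^ ?q = of_nat p * k + (var_x ^ ?q + var_y ^ ?q)" by (simp add: algebra_simps)
    then have "(var_x + var_y) ^ ?q * b = of_nat p * (k * b) + (var_x ^ ?q * b + var_y ^ ?q * b)"
      by (simp only:) (simp add: algebra_simps)
    then show ?thesis by (simp add: box_ideal_add box_ideal_gens)
  qed
  have my: "(- var_y) ^ n = ((- 1) ^ n * var_y ^ n :: int poly poly)" for n
    by (simp flip: power_mult_distrib)
  have "?\<sigma> g \<in> box_ideal p ?q" if gb: "g \<in> box_ideal p ?q" for g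
  proof -
    obtain a b c where g: "g = of_nat p * a + var_x ^ ?q * b + var_y ^ ?q * c" using box_ideal_decomp[OF gb] .
    have "?\<sigma> g = of_nat p * ?\<sigma> a + (var_x + var_y) ^ ?q * ?\<sigma> b + var_y ^ ?q * ((- 1) ^ ?q * ?\<sigma> c)"
      by (simp add: g hs my mult_ac)
    then show ?thesis by (simp only: box_ideal_add box_ideal_gens xy)
  qed
  from box_length_involution[OF p h inv this, of "lines A B C"]
  have "box_length p ?q ((- 1) ^ B * lines C B A) = box_length p ?q (lines A B C)"
    by (simp add: hs my mult_ac add.commute)
  moreover have "colon_box p ?q ((- 1) ^ B * G) = colon_box p ?q G" for G
  proof (cases "even B")
    case False
    have "- (g * G) \<in> box_ideal p ?q \<longleftrightarrow> g * G \<in> box_ideal p ?q" for g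
      using UNIV.sub_ideal_uminus[OF sub_ideal_box] by fastforce
    then show ?thesis using False by (simp add: colon_box_def)
  qed simp
  ultimately show ?thesis by (simp only: box_length_def)
qed

section \<open>Frobenius and monotonicity of the normalized lengths\<close>

lemma cf_bieval_power:
  assumes "p > 0"
  shows "cf (bieval (\<lambda>c::int. [:[:c:]:]) (var_x ^ p) (var_y ^ p) g) i j =
    (if p dvd i \<and> p dvd j then cf g (i div p) (j div p) else 0)"
proof -
  let ?\<phi> = "bieval (\<lambda>c::int. [:[:c:]:]) (var_x ^ p) (var_y ^ p)"
  have h: "unital_hom ?\<phi>" by (intro unital_hom_bieval unital_hom_const2)
  note hs = unital_homD[OF h] bieval_simps[OF unital_hom_const2]
  have d: "p dvd i - p \<longleftrightarrow> p dvd i" "i div p = Suc ((i - p) div p)" if "p \<le> i" for i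
    using that assms by (auto simp: dvd_minus_self le_div_geq)
  have z: "p dvd i \<longleftrightarrow> i = 0" if "i < p" for i using that assms by (auto dest: dvd_imp_le)
  have inner: "cf (?\<phi> [:c:]) i j = (if p dvd i \<and> j = 0 then Polynomial.coeff c (i div p) else 0)" for c i j
  proof (induction c arbitrary: i)
    case 0 then show ?case by (simp add: hs)
  next
    case (pCons a c)
    have "[:pCons a c:] = [:[:a:]:] + var_x * [:c:]" by (simp add: var_x_def)
    then have "?\<phi> [:pCons a c:] = [:[:a:]:] + var_x ^ p * ?\<phi> [:c:]" by (simp only: hs)
    then show ?case
      using assms by (cases "p \<le> i") (auto simp: cf_const cf_x_power_mult pCons.IH d z)
  qed
  show ?thesis
  proof (induction g arbitrary: j)
    case 0 then show ?case by (simp add: hs)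
  next
    case (pCons c g)
    have "pCons c g = [:c:] + var_y * g" by (simp add: var_y_def)
    then have "?\<phi> (pCons c g) = ?\<phi> [:c:] + var_y ^ p * ?\<phi> g" by (simp only: hs)
    then show ?case
      using assms by (cases "p \<le> j") (auto simp: inner cf_y_power_mult pCons.IH d z cf_def[of "pCons c g"] cf_def[of g])
  qed
qed

lemma cong_mult_ring:
  fixes a b a' b' :: "'a::comm_ring_1"
  assumes "d dvd a - a'" "d dvd b - b'"
  shows "d dvd a * b - a' * b'"
proof -
  have "a * b - a' * b' = a * (b - b') + (a - a') * b'" by (simp add: algebra_simps)
  then show ?thesis using assms by simp
qed

text \<open>The substitution \<open>?\<phi>\<close> lifts Frobenius, and the polynomials are free
  over its image with basis \<open>x^i y^j\<close> for \<open>i, j < p\<close>. Tuples of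
  \<open>p^2\<close> representatives for \<open>?F\<close> therefore give inequivalent elements for
  \<open>?F ^ p\<close>, which agrees with \<open>?\<phi> ?F\<close> modulo \<open>p\<close>; and
  \<open>N' \<le> p * N\<close> makes the colon ideal of the smaller power the smaller one.\<close>

lemma box_length_frobenius:
  assumes p: "Factorial_Ring.prime p" and N: "N' \<le> p * N"
  shows "p\<^sup>2 * box_length p q (lines a b c ^ N) \<le> box_length p (p * q) (lines a b c ^ N')"
proof -
  let ?\<phi> = "bieval (\<lambda>c::int. [:[:c:]:]) (var_x ^ p) (var_y ^ p)"
  let ?F = "lines a b c ^ N :: int poly poly"
  have pp: "p > 0" using p prime_gt_0_nat by blast
  have h: "unital_hom ?\<phi>" by (intro unital_hom_bieval unital_hom_const2)
  note hs = unital_homD[OF h] bieval_simps[OF unital_hom_const2]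
  have F: "of_nat p dvd ?\<phi> ?F - ?F ^ p"
  proof -
    have 1: "of_nat p dvd (var_x ^ p + var_y ^ p) - (var_x + var_y :: int poly poly) ^ p"
      using power_add_mod_prime[OF p, of "var_x :: int poly poly" var_y 1] dvd_minus_iff by fastforce
    have "of_nat p dvd (lines (p * a) (p * b) 0 * (var_x ^ p + var_y ^ p) ^ c) ^ N -
        (lines (p * a) (p * b) 0 * ((var_x + var_y :: int poly poly) ^ p) ^ c) ^ N"
      by (intro power_dvd_cong cong_mult_ring 1) simp_all
    then show ?thesis
      by (simp add: hs power_mult_distrib flip: power_mult) (simp add: mult_ac power_mult_distrib flip: power_mult)
  qed
  obtain T where T: "transversal (colon_box p q ?F) T" "card T = p ^ box_length p q ?F"
    using box_length[OF p] by metis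
  let ?I = "{..<p} \<times> {..<p}"
  define \<Sigma> where "\<Sigma> t = (\<Sum>(i, j)\<in>?I. var_x ^ i * (var_y ^ j * ?\<phi> (t (i, j))))" for t
  have cf\<Sigma>: "cf (\<Sigma> t) (p * m + i) (p * n + j) = cf (t (i, j)) m n" if ij: "i < p" "j < p" for t m n i j
  proof -
    have "cf (\<Sigma> t) (p * m + i) (p * n + j) =
       (\<Sum>e\<in>?I. if e = (i, j) then cf (t (i, j)) m n else 0)"
      unfolding \<Sigma>_def cf_sum
    proof (rule sum.cong[OF refl])
      fix e assume e: "e \<in> ?I"
      obtain k l where kl: "e = (k, l)" "k < p" "l < p" using e by (cases e) auto
      have dv: "k \<le> p * m + i \<and> p dvd p * m + i - k \<longleftrightarrow> k = i" "(p * m + i - i) div p = m"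
        if "k < p" "i < p" for k i m
      proof
        assume *: "k \<le> p * m + i \<and> p dvd p * m + i - k"
        then have "(p * m + i) mod p = k mod p" using mod_eq_dvd_iff_nat[of k "p * m + i" p] by simp
        then show "k = i" using that by simp
      qed (use that in auto)
      show "cf (case e of (i, j) \<Rightarrow> var_x ^ i * (var_y ^ j * ?\<phi> (t (i, j)))) (p * m + i) (p * n + j) =
         (if e = (i, j) then cf (t (i, j)) m n else 0)"
        using dv(1)[OF kl(2) ij(1), of m] dv(1)[OF kl(3) ij(2), of n] dv(2)[OF ij(1) ij(1), of m] dv(2)[OF ij(2) ij(2), of n]
        by (auto simp: kl cf_x_power_mult cf_y_power_mult cf_bieval_power[OF pp])
    qed
    also have "\<dots> = cf (t (i, j)) m n" using ij by simp
    finally show ?thesis .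
  qed
  have \<Sigma>_diff: "\<Sigma> s - \<Sigma> t = \<Sigma> (\<lambda>e. s e - t e)" for s t
    unfolding \<Sigma>_def by (simp add: hs algebra_simps case_prod_unfold flip: sum_subtractf)
  have \<Sigma>_mult: "\<Sigma> t * ?\<phi> g = \<Sigma> (\<lambda>e. t e * g)" for t g
    unfolding \<Sigma>_def by (simp add: hs sum_distrib_right case_prod_unfold mult.assoc)
  have key: "t e \<in> colon_box p q ?F" if *: "\<Sigma> t * lines a b c ^ N' \<in> box_ideal p (p * q)" and e: "e \<in> ?I" for t e
  proof -
    have "?F ^ p = lines a b c ^ N' * lines a b c ^ (p * N - N')"
      using N by (simp add: mult.commute flip: power_mult power_add)
    then have 1: "\<Sigma> t * ?F ^ p \<in> box_ideal p (p * q)" using box_ideal_mult_right[OF *] by (simp only: mult.assoc)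
    obtain k where "?\<phi> ?F - ?F ^ p = of_nat p * k" using F by (auto simp: dvd_def)
    then have "?\<phi> ?F = of_nat p * k + ?F ^ p" by (simp add: algebra_simps)
    then have "\<Sigma> t * ?\<phi> ?F = of_nat p * (\<Sigma> t * k) + \<Sigma> t * ?F ^ p" by (simp only:) (simp add: algebra_simps)
    then have "\<Sigma> t * ?\<phi> ?F \<in> box_ideal p (p * q)" using 1 box_ideal_add box_ideal_gens(1) by simp
    then have 2: "\<Sigma> (\<lambda>e. t e * ?F) \<in> box_ideal p (p * q)" by (simp only: \<Sigma>_mult)
    obtain i j where ij: "e = (i, j)" "i < p" "j < p" using e by auto
    have "int p dvd cf (t e * ?F) m n" if "m < q" "n < q" for m n
    proof -
      have "p * m + i < p * Suc m" "p * Suc m \<le> p * q" "p * n + j < p * Suc n" "p * Suc n \<le> p * q"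
        using that ij by (auto simp: Suc_le_eq simp del: mult_Suc_right) (auto)
      then have "p * m + i < p * q" "p * n + j < p * q" by linarith+
      then have "int p dvd cf (\<Sigma> (\<lambda>e. t e * ?F)) (p * m + i) (p * n + j)"
        using 2 unfolding box_ideal_def by blast
      then show ?thesis unfolding cf\<Sigma>[OF ij(2,3)] ij(1) .
    qed
    then show ?thesis by (simp add: colon_box_def box_ideal_def)
  qed
  have inj: "s = t"
    if st: "s \<in> ?I \<rightarrow>\<^sub>E T" "t \<in> ?I \<rightarrow>\<^sub>E T" "(\<Sigma> s - \<Sigma> t) * lines a b c ^ N' \<in> box_ideal p (p * q)" for s t
  proof (rule PiE_ext[OF st(1,2)])
    fix e assume e: "e \<in> ?I"
    have "s e - t e \<in> colon_box p q ?F" using key[OF st(3)[unfolded \<Sigma>_diff] e] .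
    moreover have "s e - s e \<in> colon_box p q ?F" by (simp add: colon_box_def box_ideal_def)
    moreover have "s e \<in> T" "t e \<in> T" using st e by auto
    ultimately show "s e = t e" using T(1) unfolding transversal_def by blast
  qed
  show ?thesis
  proof (rule box_length_ge[OF p, where U = "\<Sigma> ` (?I \<rightarrow>\<^sub>E T)"])
    have "inj_on \<Sigma> (?I \<rightarrow>\<^sub>E T)"
      by (rule inj_onI, rule inj) (simp_all add: box_ideal_def)
    then have "card (\<Sigma> ` (?I \<rightarrow>\<^sub>E T)) = card T ^ card ?I"
      by (simp only: card_image) (simp add: card_PiE)
    also have "\<dots> = p ^ (p\<^sup>2 * box_length p q ?F)"
      by (simp add: T(2) power2_eq_square mult.commute flip: power_mult)
    finally show "p ^ (p\<^sup>2 * box_length p q ?F) \<le> card (\<Sigma> ` (?I \<rightarrow>\<^sub>E T))" by simp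
  qed (use inj in blast)
qed

section \<open>Upper bound by counting monomials\<close>

lemma cf_line_power:
  "cf ((var_x + var_y) ^ C) i j = (if i + j = C then of_nat (C choose i) else 0 :: 'a::comm_ring_1)"
proof -
  have "cf ((var_x + var_y :: 'a poly poly) ^ C) i j =
      (\<Sum>k\<le>C. of_nat (C choose k) * cf (var_x ^ k * var_y ^ (C - k)) i j)"
    unfolding binomial_ring cf_sum by (simp add: cf_of_nat mult.assoc)
  also have "\<dots> = (\<Sum>k\<le>C. if k = i then (if i + j = C then of_nat (C choose i) else 0) else 0)"
    by (rule sum.cong) (auto simp: cf_monomial)
  also have "\<dots> = (if i + j = C then of_nat (C choose i) else 0)" by auto
  finally show ?thesis .
qed

lemma cf_lines_mult:
  "cf (g * lines A B C) i j =
    (if A \<le> i \<and> B \<le> j then cf (g * (var_x + var_y) ^ C) (i - A) (j - B) else 0)"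
  for g :: "'a::comm_ring_1 poly poly"
proof -
  have "g * lines A B C = var_x ^ A * (var_y ^ B * (g * (var_x + var_y) ^ C))" by (simp add: mult_ac)
  then show ?thesis by (simp only: cf_x_power_mult cf_y_power_mult) simp
qed

text \<open>The cut-off \<open>m\<close> is free. First the relevant coefficients of
  \<open>g\<close> below degree \<open>m\<close> are made to vanish; a monomial of the product
  inside the box then has degree at least \<open>m + A + B + C\<close>. The two cardinalities count
  the linear conditions.\<close>

lemma box_length_upper:
  assumes p: "Factorial_Ring.prime p"
  shows "box_length p q (lines A B C) \<le>
    card {(i, j). i < q - A \<and> j < q - B \<and> i + j < m} +
    card {(i, j). A \<le> i \<and> i < q \<and> B \<le> j \<and> j < q \<and> m + A + B + C \<le> i + j}"
proof -
  let ?F = "lines A B C :: int poly poly"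
  define S1 where "S1 = {(i, j). i < q - A \<and> j < q - B \<and> i + j < m}"
  define S2 where "S2 = {(i, j). A \<le> i \<and> i < q \<and> B \<le> j \<and> j < q \<and> m + A + B + C \<le> i + j}"
  have fin: "finite S1" "finite S2"
    by (rule finite_subset[of _ "{..<q} \<times> {..<q}"], auto simp: S1_def S2_def)+
  have pp: "p > 0" using p prime_gt_0_nat by blast
  define low where "low g = (\<Sum>(i, j)\<in>S1. [:[:cf g i j:]:] * (var_x ^ i * var_y ^ j))" for g :: "int poly poly"
  have cf_low: "cf (low g) i j = (if (i, j) \<in> S1 then cf g i j else 0)" for g i j
  proof -
    have "cf (low g) i j = (\<Sum>e\<in>S1. if e = (i, j) then cf g i j else 0)"
      unfolding low_def cf_sum
      by (rule sum.cong[OF refl]) (auto simp: cf_const_mult cf_monomial simp del: mult_pCons_left split: if_splits)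
    then show ?thesis using fin by simp
  qed
  define \<psi> where "\<psi> g = (restrict (\<lambda>(i, j). cf g i j mod int p) S1,
      restrict (\<lambda>(i, j). cf ((g - low g) * ?F) i j mod int p) S2)" for g
  let ?S = "(S1 \<rightarrow>\<^sub>E {0..<int p}) \<times> (S2 \<rightarrow>\<^sub>E {0..<int p})"
  have "box_length p q ?F \<le> card S1 + card S2"
  proof (rule box_length_le[OF p, where \<psi> = \<psi> and S = ?S])
    show "finite ?S" using fin by (intro finite_cartesian_product finite_PiE) auto
    show "\<psi> g \<in> ?S" for g using pp by (auto simp: \<psi>_def)
    show "card ?S \<le> p ^ (card S1 + card S2)"
      using fin by (simp add: card_cartesian_product card_PiE power_add)
  next
    fix g h assume eq: "\<psi> g = \<psi> h"
    have c1: "int p dvd cf g i j - cf h i j" if "(i, j) \<in> S1" for i j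
    proof -
      have "cf g i j mod int p = cf h i j mod int p"
        using fun_cong[OF arg_cong[OF eq, of fst], of "(i, j)"] that by (simp add: \<psi>_def)
      then show ?thesis by (simp add: mod_eq_dvd_iff)
    qed
    have c2: "int p dvd cf ((g - low g) * ?F) i j - cf ((h - low h) * ?F) i j" if "(i, j) \<in> S2" for i j
    proof -
      have "cf ((g - low g) * ?F) i j mod int p = cf ((h - low h) * ?F) i j mod int p"
        using fun_cong[OF arg_cong[OF eq, of snd], of "(i, j)"] that by (simp add: \<psi>_def)
      then show ?thesis by (simp add: mod_eq_dvd_iff)
    qed
    \<comment> \<open>A term contributing to this coefficient comes from a monomial with
      \<open>a < q - A\<close> and \<open>b < q - B\<close>; off \<open>S2\<close> its degree is
      below \<open>m\<close>, so it has been subtracted.\<close>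
    have z: "cf ((g - low g) * ?F) i j = 0" if ij: "i < q" "j < q" "(i, j) \<notin> S2" for g i j
    proof (cases "A \<le> i \<and> B \<le> j")
      case True
      have "cf (g - low g) a b * cf ((var_x + var_y) ^ C) (i - A - a) (j - B - b) = 0"
        if "a \<le> i - A" "b \<le> j - B" for a b
      proof (cases "i - A - a + (j - B - b) = C")
        case C: True
        have "a < q - A" "b < q - B" "a + b < m"
          using that ij True C by (auto simp: S2_def)
        then have "(a, b) \<in> S1" by (simp add: S1_def)
        then show ?thesis by (simp add: cf_low)
      qed (simp add: cf_line_power)
      then show ?thesis unfolding cf_lines_mult cf_mult[of "g - low g"]
        by (auto intro!: sum.neutral simp del: cf_diff)
    qed (auto simp: cf_lines_mult)
    have "int p dvd cf (low g - low h) i j" for i j using c1 by (auto simp: cf_low)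
    then obtain d where d: "low g - low h = of_nat p * d" using dvd_cf_imp_multiple by blast
    have "(g - low g) * ?F - (h - low h) * ?F \<in> box_ideal p q"
      unfolding box_ideal_def
    proof (clarify)
      fix i j assume "i < q" "j < q"
      then show "int p dvd cf ((g - low g) * ?F - (h - low h) * ?F) i j"
        using c2[of i j] z[of i j] by (cases "(i, j) \<in> S2") auto
    qed
    then have "of_nat p * (d * ?F) + ((g - low g) * ?F - (h - low h) * ?F) \<in> box_ideal p q"
      by (intro box_ideal_add box_ideal_gens)
    moreover have "of_nat p * (d * ?F) + ((g - low g) * ?F - (h - low h) * ?F) = (g - h) * ?F"
      unfolding mult.assoc[symmetric] d[symmetric] by (simp add: algebra_simps)
    ultimately show "(g - h) * ?F \<in> box_ideal p q" by simp
  qed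
  then show ?thesis by (simp only: S1_def S2_def)
qed

section \<open>Lower bound by differentiation\<close>

lemma box_ideal_pderiv:
  assumes "p dvd q" "g \<in> box_ideal p q"
  shows "pderiv g \<in> box_ideal p q"
  unfolding box_ideal_def
proof (clarify)
  fix i j assume ij: "i < q" "j < q"
  have "cf (pderiv g) i j = of_nat (Suc j) * cf g i (Suc j)"
    by (simp add: cf_def coeff_pderiv of_nat_poly del: of_nat_Suc)
  moreover have "int p dvd of_nat (Suc j) * cf g i (Suc j)"
  proof (cases "Suc j < q")
    case True
    then show ?thesis using assms(2) ij by (auto simp: box_ideal_def)
  next
    \<comment> \<open>The coefficient entering from outside the box sits at exponent
      \<open>q\<close> and is multiplied by \<open>q\<close>, a multiple of
      \<open>p\<close>.\<close>
    case False
    then have "Suc j = q" using ij by simp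
    then show ?thesis using assms(1) by (simp del: of_nat_Suc)
  qed
  ultimately show "int p dvd cf (pderiv g) i j" by simp
qed

lemma pderiv_lines:
  "pderiv (lines A (Suc B) (Suc C) :: int poly poly) =
    lines A B C * (of_nat (Suc B) * (var_x + var_y) + of_nat (Suc C) * var_y)"
proof -
  have x: "pderiv (var_x ^ A) = (0 :: int poly poly)" by (simp add: var_x_power pderiv_pCons)
  have 1: "pderiv (var_y :: int poly poly) = 1" "pderiv (var_x + var_y :: int poly poly) = 1"
    by (simp_all add: var_x_def var_y_def pderiv_pCons one_pCons)
  have s: "Polynomial.smult (of_nat n) g = of_nat n * g" for n and g :: "int poly poly"
    by (simp add: of_nat_poly)
  have "pderiv (lines A (Suc B) (Suc C) :: int poly poly) = var_x ^ A *
     (of_nat (Suc B) * var_y ^ B * (var_x + var_y) ^ Suc C + var_y ^ Suc B * (of_nat (Suc C) * (var_x + var_y) ^ C))"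
    unfolding pderiv_mult x pderiv_power_Suc 1 s mult_1_right
    by (simp add: algebra_simps del: of_nat_Suc power_Suc)
  then show ?thesis by (simp add: algebra_simps del: of_nat_Suc)
qed

text \<open>
  In characteristic \<open>p\<close> the ideal is stable under derivations, so differentiating
  \<open>h \<cdot> x\<^sup>A y\<^bsup>B+1\<^esup> (x + y)\<^bsup>C+1\<^esup>\<close> lowers the order of \<open>h\<close> at the cost of one more factor \<open>y (x + y)\<close>.
\<close>

lemma colon_box_pderiv:
  assumes "p dvd q" "h * lines A B C \<in> box_ideal p q"
  shows "pderiv h * lines A (Suc B) (Suc C) \<in> box_ideal p q"
proof -
  let ?F = "lines A (Suc B) (Suc C) :: int poly poly"
  have "h * ?F = (h * lines A B C) * (var_y * (var_x + var_y))" by (simp add: mult_ac)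
  then have "h * ?F \<in> box_ideal p q" using box_ideal_mult_right[OF assms(2)] by (simp only:)
  then have 1: "pderiv (h * ?F) \<in> box_ideal p q" by (rule box_ideal_pderiv[OF assms(1)])
  have "h * pderiv ?F = (h * lines A B C) * (of_nat (Suc B) * (var_x + var_y) + of_nat (Suc C) * var_y)"
    unfolding pderiv_lines by (simp only: mult.assoc)
  then have 2: "h * pderiv ?F \<in> box_ideal p q" using box_ideal_mult_right[OF assms(2)] by (simp only:)
  have "pderiv h * ?F = pderiv (h * ?F) - h * pderiv ?F"
    unfolding pderiv_mult[of h ?F] by (simp add: mult.commute)
  then show ?thesis using box_ideal_diff[OF 1 2] by simp
qed

lemma colon_box_pderiv_iter:
  assumes "p dvd q" "h * lines A B C \<in> box_ideal p q"
  shows "(pderiv ^^ k) h * lines A (B + k) (C + k) \<in> box_ideal p q"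
  by (induction k) (use colon_box_pderiv[OF assms(1)] assms(2) in auto)

lemma cf_pderiv_iter: "cf ((pderiv ^^ k) h) 0 j = of_nat (pochhammer (Suc j) k) * cf h 0 (j + k)"
  for h :: "int poly poly"
proof (induction k arbitrary: h)
  case (Suc k)
  have "cf ((pderiv ^^ Suc k) h) 0 j = of_nat (pochhammer (Suc j) k) * cf (pderiv h) 0 (j + k)"
    by (simp only: funpow_Suc_right comp_apply Suc)
  also have "cf (pderiv h) 0 (j + k) = of_nat (Suc (j + k)) * cf h 0 (Suc (j + k))"
    by (simp add: cf_def coeff_pderiv of_nat_poly del: of_nat_Suc)
  finally show ?case by (simp add: pochhammer_Suc algebra_simps)
qed simp

lemma unit_mult_box:
  assumes p: "Factorial_Ring.prime p" "\<not> int p dvd at_origin u" and u: "u * g \<in> box_ideal p q"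
  shows "g \<in> box_ideal p q"
proof -
  obtain w where w: "w * u - 1 \<in> box_ideal p q" using unit_mod_box[OF p] .
  have "w * (u * g) - (w * u - 1) * g \<in> box_ideal p q"
    by (intro box_ideal_diff box_ideal_mult[OF u] box_ideal_mult_right[OF w])
  then show ?thesis by (simp add: algebra_simps)
qed

text \<open>The degree bound leaves a monomial of the product inside the box, and
  \<open>C < p\<close> keeps its binomial coefficient prime to \<open>p\<close>.\<close>

lemma lines_not_in_box:
  assumes p: "Factorial_Ring.prime p" and "A < q" "B < q" "C < p" "A + B + C \<le> 2 * (q - 1)"
  shows "lines A B C \<notin> box_ideal p q"
proof
  assume *: "lines A B C \<in> box_ideal p q"
  \<comment> \<open>The least exponent of \<open>x\<close> that is at least \<open>A\<close> and
    leaves an exponent of \<open>y\<close> below \<open>q\<close>.\<close>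
  define i where "i = max A (A + B + C - (q - 1))"
  define j where "j = A + B + C - i"
  have ij: "A \<le> i" "i < q" "B \<le> j" "j < q" "i - A + (j - B) = C"
    using assms by (auto simp: i_def j_def)
  have "cf (1 * lines A B C) i j = int (C choose (i - A))"
    unfolding cf_lines_mult using ij by (simp add: cf_line_power)
  moreover have "int p dvd cf (lines A B C) i j" using * ij by (simp add: box_ideal_def)
  ultimately have "p dvd C choose (i - A)" by simp
  moreover have "C choose (i - A) dvd fact C"
    using binomial_fact_lemma[of "i - A" C] ij by (metis dvd_triv_right le_add1)
  ultimately have "p dvd fact C" using dvd_trans by blast
  then show False using p \<open>C < p\<close> by (simp add: prime_dvd_fact_iff)
qed

text \<open>The \<open>k\<close>-th derivative in \<open>y\<close> has constant term
  \<open>k!\<close> times the coefficient of \<open>y^k\<close>. Were this prime to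
  \<open>p\<close>, the derivative could be cancelled from its product with the lines, which would
  then lie in the box ideal.\<close>

lemma colon_box_order:
  assumes p: "Factorial_Ring.prime p" and h: "h * lines A B C \<in> box_ideal p q" and pq: "p dvd q"
    and k: "A < q" "B + k < q" "k < p" "C + k < p" "A + B + C + 2 * k \<le> 2 * (q - 1)"
  shows "int p dvd cf h 0 k"
proof (rule ccontr)
  assume n: "\<not> int p dvd cf h 0 k"
  let ?u = "(pderiv ^^ k) h"
  have "at_origin ?u = int (fact k) * cf h 0 k"
    unfolding at_origin_cf cf_pderiv_iter by (simp add: pochhammer_fact)
  moreover have "\<not> int p dvd int (fact k)"
    using p k(3) by (simp only: of_nat_dvd_iff prime_dvd_fact_iff)
  ultimately have u: "\<not> int p dvd at_origin ?u"
    using n p by (simp add: prime_dvd_mult_iff)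
  from unit_mult_box[OF p u colon_box_pderiv_iter[OF pq h, of k]] show False
    using lines_not_in_box[OF p, of A q "B + k" "C + k"] k by simp
qed

text \<open>Leading terms are taken with respect to the least exponent of \<open>x\<close>. If
  \<open>k + B + C < p\<close>, the product has a coefficient inside the box to which, modulo
  \<open>p\<close>, only the pure power of \<open>y\<close> in \<open>(x + y)^C\<close> contributes;
  otherwise dividing by \<open>x^i\<close> replaces \<open>A\<close> by \<open>A + i\<close> and the
  derivative argument applies.\<close>

lemma colon_box_leading:
  assumes p: "Factorial_Ring.prime p" and g: "g * lines A B C \<in> box_ideal p p"
    and i: "i < p - A" "\<And>i' k. i' < i \<Longrightarrow> int p dvd cf g i' k"
    and k: "k + B + C < p \<or> C + k < p \<and> B + k < p \<and> A + i + B + C + 2 * k \<le> 2 * (p - 1)"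
  shows "int p dvd cf g i k"
proof (cases "k + B + C < p")
  case True
  have pp: "int p dvd cf (g * lines A B C) (A + i) (B + (C + k))"
    using g i True by (simp add: box_ideal_def)
  have "cf (g * lines A B C) (A + i) (B + (C + k)) =
     (\<Sum>b\<le>C + k. \<Sum>a\<le>i. cf g a b * cf ((var_x + var_y) ^ C) (i - a) (C + k - b))"
    unfolding cf_lines_mult by (simp add: cf_mult)
  also have "int p dvd \<dots> - (\<Sum>b\<le>C + k. \<Sum>a\<le>i. if a = i then (if b = k then cf g i k else 0) else 0)"
    unfolding sum_subtractf[symmetric]
  proof (intro dvd_sum)
    fix a b assume "a \<in> {..i}" "b \<in> {..C + k}"
    then show "int p dvd cf g a b * cf ((var_x + var_y) ^ C) (i - a) (C + k - b) -
       (if a = i then (if b = k then cf g i k else 0) else 0)"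
      using i(2)[of a b] by (cases "a = i") (auto simp: cf_line_power)
  qed
  finally have "int p dvd cf (g * lines A B C) (A + i) (B + (C + k)) - cf g i k" by simp
  from dvd_diff[OF pp this] show ?thesis by simp
next
  case False
  then have k: "C + k < p" "B + k < p" "A + i + B + C + 2 * k \<le> 2 * (p - 1)" using k by auto
  obtain g0 h where g0: "g = g0 + var_x ^ i * h" "\<And>a b. cf g0 a b = (if a < i then cf g a b else 0)"
    using split_x_power by blast
  have "int p dvd cf g0 a b" for a b using i(2) by (simp add: g0(2))
  then obtain d where d: "g0 = of_nat p * d" using dvd_cf_imp_multiple by blast
  have "g * lines A B C - of_nat p * (d * lines A B C) \<in> box_ideal p p"
    by (intro box_ideal_diff g box_ideal_gens)
  moreover have "g * lines A B C - of_nat p * (d * lines A B C) = h * lines (A + i) B C"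
    unfolding g0(1) d by (simp add: algebra_simps power_add)
  ultimately have h: "h * lines (A + i) B C \<in> box_ideal p p" by simp
  have "int p dvd cf h 0 k" by (rule colon_box_order[OF p h]) (use k i in auto)
  moreover have "cf g i k = cf h 0 k"
    by (subst g0(1)) (simp add: cf_x_power_mult g0(2))
  ultimately show ?thesis by simp
qed

text \<open>Polynomials supported on \<open>\<Omega>\<close> with coefficients in
  \<open>0..<p\<close> are pairwise inequivalent: if a difference lies in the colon ideal, all its
  coefficients are divisible by \<open>p\<close>, one exponent of \<open>x\<close> after the
  other.\<close>

lemma box_length_lower:
  assumes p: "Factorial_Ring.prime p"
  shows "card {(i, k). i < p - A \<and>
      (k + B + C < p \<or> C + k < p \<and> B + k < p \<and> A + i + B + C + 2 * k \<le> 2 * (p - 1))}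
    \<le> box_length p p (lines A B C)"
proof -
  define \<Omega> where "\<Omega> = {(i, k). i < p - A \<and>
      (k + B + C < p \<or> C + k < p \<and> B + k < p \<and> A + i + B + C + 2 * k \<le> 2 * (p - 1))}"
  have fin: "finite \<Omega>"
    by (rule finite_subset[of _ "{..<p} \<times> {..<p}"]) (auto simp: \<Omega>_def)
  define comb where "comb d = (\<Sum>(i, k)\<in>\<Omega>. [:[:d (i, k):]:] * (var_x ^ i * var_y ^ k))"
    for d :: "nat \<times> nat \<Rightarrow> int"
  have cf_comb: "cf (comb d) i j = (if (i, j) \<in> \<Omega> then d (i, j) else 0)" for d i j
  proof -
    have "cf (comb d) i j = (\<Sum>e\<in>\<Omega>. if e = (i, j) then d (i, j) else 0)"
      unfolding comb_def cf_sum
      by (rule sum.cong[OF refl]) (auto simp: cf_const_mult cf_monomial simp del: mult_pCons_left split: if_splits)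
    then show ?thesis using fin by simp
  qed
  have key: "int p dvd cf g i k" if g: "g * lines A B C \<in> box_ideal p p"
    "\<And>i j. (i, j) \<notin> \<Omega> \<Longrightarrow> cf g i j = 0" for g i k
  proof (induction i arbitrary: k rule: less_induct)
    case (less i)
    show ?case
    proof (cases "(i, k) \<in> \<Omega>")
      case True
      show ?thesis
      proof (rule colon_box_leading[OF p g(1)])
        show "int p dvd cf g i' k" if "i' < i" for i' k using less that .
      qed (use True in \<open>simp_all add: \<Omega>_def\<close>)
    qed (simp add: g(2))
  qed
  have eq: "d = d'" if d: "d \<in> \<Omega> \<rightarrow>\<^sub>E {0..<int p}" "d' \<in> \<Omega> \<rightarrow>\<^sub>E {0..<int p}"
    "(comb d - comb d') * lines A B C \<in> box_ideal p p" for d d'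
  proof (rule PiE_ext[OF d(1,2)])
    fix e assume e: "e \<in> \<Omega>"
    obtain i j where ij: "e = (i, j)" by (cases e)
    have "int p dvd cf (comb d - comb d') i j"
      by (rule key[OF d(3)]) (simp add: cf_comb)
    then have "int p dvd d e - d' e" using e by (simp add: cf_comb ij)
    moreover have "d e \<in> {0..<int p}" "d' e \<in> {0..<int p}" using d(1,2) e by auto
    ultimately show "d e = d' e" using dvd_imp_le_int[of "d e - d' e" "int p"] by force
  qed
  have "card \<Omega> \<le> box_length p p (lines A B C)"
  proof (rule box_length_ge[OF p, where U = "comb ` (\<Omega> \<rightarrow>\<^sub>E {0..<int p})"])
    have "inj_on comb (\<Omega> \<rightarrow>\<^sub>E {0..<int p})"
      by (rule inj_onI, rule eq) (simp_all add: box_ideal_def)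
    then have "card (comb ` (\<Omega> \<rightarrow>\<^sub>E {0..<int p})) = p ^ card \<Omega>"
      using fin by (simp add: card_image card_PiE)
    then show "p ^ card \<Omega> \<le> card (comb ` (\<Omega> \<rightarrow>\<^sub>E {0..<int p}))" by simp
  qed (use eq in blast)
  then show ?thesis by (simp only: \<Omega>_def)
qed

section \<open>The local ring in characteristic p\<close>

lemma plane_simps [simp]:
  "carrier plane = UNIV" "g \<otimes>\<^bsub>plane\<^esub> h = g * h" "g \<oplus>\<^bsub>plane\<^esub> h = g + h"
  "\<one>\<^bsub>plane\<^esub> = 1" "\<zero>\<^bsub>plane\<^esub> = 0"
  by (simp_all add: ring_of_type_algebra_def)

lemma plane_minus: "g \<ominus>\<^bsub>plane\<^esub> h = g - h"
proof -
  interpret cring plane by (rule cring_from_type_algebra)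
  have "\<ominus>\<^bsub>plane\<^esub> h = - h" by (rule minus_equality) simp_all
  then show ?thesis by (simp add: a_minus_def)
qed

locale prime_plane =
  fixes p :: nat
  assumes prime: "Factorial_Ring.prime p"
begin

abbreviation "bc \<equiv> base_change_p p"
abbreviation "A\<^sub>p \<equiv> plane_p p"

definition off :: "int poly poly \<Rightarrow> bool" where
  "off s \<longleftrightarrow> \<not> int p dvd at_origin s"

lemma prime_const: "prime_elem (of_nat p :: int poly poly)"
proof -
  have "prime_elem (int p)" using prime by simp
  then show ?thesis by (simp add: of_nat_poly prime_elem_const_poly_iff)
qed

lemma off_mult [simp]: "off (r * s) \<longleftrightarrow> off r \<and> off s"
  using prime by (auto simp: off_def prime_dvd_mult_iff)

lemma off_1 [simp]: "off 1"
  using prime prime_gt_1_nat[of p] by (auto simp: off_def)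

lemma off_not_dvd: "off s \<Longrightarrow> \<not> of_nat p dvd s"
  by (auto simp: off_def dvd_def)

lemma off_cancel: "off u \<Longrightarrow> of_nat p dvd u * g \<longleftrightarrow> of_nat p dvd g"
  using prime_elem_dvd_mult_iff[OF prime_const] off_not_dvd by blast

lemma ideal_p: "ideal (PIdl\<^bsub>plane\<^esub> (of_nat p)) plane"
  by (rule cring.cgenideal_ideal[OF cring_from_type_algebra]) simp

lemma bc_eq: "bc g = bc h \<longleftrightarrow> of_nat p dvd g - h"
proof -
  have "bc g = bc h \<longleftrightarrow> g \<ominus>\<^bsub>plane\<^esub> h \<in> PIdl\<^bsub>plane\<^esub> (of_nat p)"
    unfolding base_change_p_def
    using ring.quotient_eq_iff_same_a_r_cos[OF cring.axioms(1)[OF cring_from_type_algebra] ideal_p, of g h]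
    by simp
  also have "\<dots> \<longleftrightarrow> of_nat p dvd g - h"
    by (auto simp: plane_minus cgenideal_def dvd_def mult.commute)
  finally show ?thesis .
qed

lemma bc_hom: "bc \<in> ring_hom plane A\<^sub>p"
  using ideal.rcos_ring_hom[OF ideal_p] unfolding base_change_p_def plane_p_def .

lemma bc_simps:
  "bc g \<otimes>\<^bsub>A\<^sub>p\<^esub> bc h = bc (g * h)" "bc g \<oplus>\<^bsub>A\<^sub>p\<^esub> bc h = bc (g + h)" "\<one>\<^bsub>A\<^sub>p\<^esub> = bc 1"
  "bc g \<in> carrier A\<^sub>p"
  using ring_hom_mult[OF bc_hom, of g h] ring_hom_add[OF bc_hom, of g h] ring_hom_one[OF bc_hom]
    ring_hom_closed[OF bc_hom, of g] by simp_all

lemma cring_Ap: "cring A\<^sub>p"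
  unfolding plane_p_def by (rule ideal.quotient_is_cring[OF ideal_p cring_from_type_algebra])

lemma bc_zero: "\<zero>\<^bsub>A\<^sub>p\<^esub> = bc 0"
proof -
  interpret A: cring A\<^sub>p by (rule cring_Ap)
  have "bc 0 \<oplus>\<^bsub>A\<^sub>p\<^esub> bc 0 = bc 0" by (simp add: bc_simps)
  then show ?thesis by (metis A.a_assoc A.r_neg A.r_zero A.a_inv_closed bc_simps(4))
qed

lemma bc_minus: "bc g \<ominus>\<^bsub>A\<^sub>p\<^esub> bc h = bc (g - h)"
proof -
  interpret A: cring A\<^sub>p by (rule cring_Ap)
  have "\<ominus>\<^bsub>A\<^sub>p\<^esub> bc h = bc (- h)" by (rule A.minus_equality) (simp_all add: bc_simps bc_zero)
  then show ?thesis by (simp add: a_minus_def bc_simps)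
qed

lemma carrier_Ap: "carrier A\<^sub>p = range bc"
  by (auto simp: plane_p_def base_change_p_def FactRing_def A_RCOSETS_def')

lemma dvd_const:
  assumes "int p dvd c"
  shows "of_nat p dvd [:[:c:]:]"
proof -
  obtain k where "c = int p * k" using assms by (elim dvdE)
  then have "[:[:c:]:] = of_nat p * [:[:k:]:]" by (simp add: of_nat_poly)
  then show ?thesis by (rule dvdI)
qed

lemma origin_ideal:
  "Idl\<^bsub>A\<^sub>p\<^esub> {bc var_x, bc var_y} = {bc g | g. int p dvd at_origin g}" (is "_ = ?M")
proof
  interpret A: cring A\<^sub>p by (rule cring_Ap)
  have um: "\<ominus>\<^bsub>A\<^sub>p\<^esub> bc h = bc (- h)" for h by (rule A.minus_equality) (simp_all add: bc_simps bc_zero)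
  have "ideal ?M A\<^sub>p"
  proof (rule idealI[OF A.ring_axioms])
    show "subgroup ?M (add_monoid A\<^sub>p)"
    proof (rule A.add.subgroupI)
      show "?M \<subseteq> carrier A\<^sub>p" by (auto simp: bc_simps)
      show "?M \<noteq> {}" by (auto intro!: exI[of _ 0])
      show "\<ominus>\<^bsub>A\<^sub>p\<^esub> a \<in> ?M" if a: "a \<in> ?M" for a
      proof -
        obtain g where "a = bc g" "int p dvd at_origin g" using a by blast
        then have "\<ominus>\<^bsub>A\<^sub>p\<^esub> a = bc (- g)" "int p dvd at_origin (- g)" by (simp_all add: um)
        then show ?thesis by blast
      qed
      show "a \<oplus>\<^bsub>A\<^sub>p\<^esub> b \<in> ?M" if a: "a \<in> ?M" and b: "b \<in> ?M" for a b
      proof -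
        obtain g h where "a = bc g" "int p dvd at_origin g" "b = bc h" "int p dvd at_origin h"
          using a b by blast
        then have "a \<oplus>\<^bsub>A\<^sub>p\<^esub> b = bc (g + h)" "int p dvd at_origin (g + h)" by (simp_all add: bc_simps)
        then show ?thesis by blast
      qed
    qed
    have m: "bc x \<otimes>\<^bsub>A\<^sub>p\<^esub> bc g \<in> ?M" if "int p dvd at_origin g" for x g
    proof -
      have "int p dvd at_origin (x * g)" using that by simp
      then show ?thesis unfolding bc_simps by blast
    qed
    show "x \<otimes>\<^bsub>A\<^sub>p\<^esub> a \<in> ?M" if "a \<in> ?M" "x \<in> carrier A\<^sub>p" for a x
      using that m by (auto simp: carrier_Ap)
    show "a \<otimes>\<^bsub>A\<^sub>p\<^esub> x \<in> ?M" if ax: "a \<in> ?M" "x \<in> carrier A\<^sub>p" for a x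
    proof -
      obtain y g where "x = bc y" "a = bc g" "int p dvd at_origin g"
        using ax by (auto simp: carrier_Ap)
      then show ?thesis using m[of g y] by (simp add: bc_simps mult.commute)
    qed
  qed
  moreover have "{bc var_x, bc var_y} \<subseteq> ?M"
    by (auto intro: exI[of _ var_x] exI[of _ var_y])
  ultimately show "Idl\<^bsub>A\<^sub>p\<^esub> {bc var_x, bc var_y} \<subseteq> ?M" by (rule A.genideal_minimal)
  have I: "ideal (Idl\<^bsub>A\<^sub>p\<^esub> {bc var_x, bc var_y}) A\<^sub>p"
    by (rule A.genideal_ideal) (auto simp: bc_simps)
  have sub: "{bc var_x, bc var_y} \<subseteq> Idl\<^bsub>A\<^sub>p\<^esub> {bc var_x, bc var_y}"
    by (rule A.genideal_self) (auto simp: bc_simps)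
  interpret I: ideal "Idl\<^bsub>A\<^sub>p\<^esub> {bc var_x, bc var_y}" A\<^sub>p by (rule I)
  show "?M \<subseteq> Idl\<^bsub>A\<^sub>p\<^esub> {bc var_x, bc var_y}"
  proof clarify
    fix g assume g: "int p dvd at_origin g"
    obtain a b where ab: "g = [:[:at_origin g:]:] + var_x * a + var_y * b" by (rule split_origin)
    have "g - (a * var_x + b * var_y) = [:[:at_origin g:]:]" by (subst ab) (simp add: algebra_simps)
    then have "of_nat p dvd g - (a * var_x + b * var_y)" using dvd_const[OF g] by simp
    then have "bc g = bc (a * var_x + b * var_y)" by (simp add: bc_eq)
    also have "\<dots> = bc a \<otimes>\<^bsub>A\<^sub>p\<^esub> bc var_x \<oplus>\<^bsub>A\<^sub>p\<^esub> bc b \<otimes>\<^bsub>A\<^sub>p\<^esub> bc var_y" by (simp add: bc_simps)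
    finally show "bc g \<in> Idl\<^bsub>A\<^sub>p\<^esub> {bc var_x, bc var_y}"
      using sub by (simp add: I.I_l_closed bc_simps(4))
  qed
qed

abbreviation "S\<^sub>p \<equiv> away_from_origin_p p"
abbreviation "R\<^sub>p \<equiv> local_plane_p p"

section \<open>Fractions with integral polynomials as representatives\<close>

lemma bc_in_off: "bc s \<in> S\<^sub>p \<longleftrightarrow> off s"
proof -
  have "bc s \<in> {bc g | g. int p dvd at_origin g} \<longleftrightarrow> int p dvd at_origin s"
  proof
    assume "bc s \<in> {bc g | g. int p dvd at_origin g}"
    then obtain g where g: "of_nat p dvd s - g" "int p dvd at_origin g" by (auto simp: bc_eq)
    then obtain k where "s = g + of_nat p * k" by (auto simp: dvd_def algebra_simps)
    then show "int p dvd at_origin s" using g by simp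
  qed blast
  then show ?thesis
    by (simp add: away_from_origin_p_def origin_ideal bc_simps off_def)
qed

lemma Sp_eq: "S\<^sub>p = {bc s | s. off s}"
proof -
  have "S\<^sub>p \<subseteq> range bc" by (auto simp: away_from_origin_p_def carrier_Ap)
  then show ?thesis using bc_in_off by blast
qed

definition fr :: "int poly poly \<Rightarrow> int poly poly \<Rightarrow> (int poly poly set \<times> int poly poly set) set" where
  "fr g s = loc_frac A\<^sub>p S\<^sub>p (bc g) (bc s)"

text \<open>\<open>p\<close> is a prime element of the integral polynomials and does not divide
  \<open>u\<close>, so the auxiliary factor in the definition of a localization cancels and equality
  of fractions is cross-multiplication modulo \<open>p\<close>.\<close>

lemma mem_fr:
  "(bc h, bc r) \<in> fr g s \<longleftrightarrow> off r \<and> of_nat p dvd g * r - h * s"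
proof -
  have "(\<exists>u\<in>S\<^sub>p. u \<otimes>\<^bsub>A\<^sub>p\<^esub> (bc g \<otimes>\<^bsub>A\<^sub>p\<^esub> bc r \<ominus>\<^bsub>A\<^sub>p\<^esub> bc h \<otimes>\<^bsub>A\<^sub>p\<^esub> bc s) = \<zero>\<^bsub>A\<^sub>p\<^esub>) \<longleftrightarrow>
    (\<exists>u. off u \<and> of_nat p dvd u * (g * r - h * s))"
  proof -
    have "bc u \<otimes>\<^bsub>A\<^sub>p\<^esub> (bc g \<otimes>\<^bsub>A\<^sub>p\<^esub> bc r \<ominus>\<^bsub>A\<^sub>p\<^esub> bc h \<otimes>\<^bsub>A\<^sub>p\<^esub> bc s) = \<zero>\<^bsub>A\<^sub>p\<^esub> \<longleftrightarrow>
        of_nat p dvd u * (g * r - h * s)" for u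
      by (simp add: bc_simps bc_minus bc_zero bc_eq)
    then show ?thesis unfolding Sp_eq by blast
  qed
  also have "\<dots> \<longleftrightarrow> of_nat p dvd g * r - h * s"
    using off_cancel off_1 by blast
  finally show ?thesis by (simp add: fr_def loc_frac_def bc_simps(4) bc_in_off)
qed

lemma fr_subset: "fr g s \<subseteq> {(bc h, bc r) | h r. off r}"
  by (auto simp: fr_def loc_frac_def carrier_Ap Sp_eq)

lemma fr_trans:
  assumes "off s" "off r" "of_nat p dvd g * r - h * s"
  shows "fr g s \<subseteq> fr h r"
proof
  fix e assume e: "e \<in> fr g s"
  then obtain h' r' where e': "e = (bc h', bc r')" "off r'" using fr_subset by blast
  then have d: "of_nat p dvd g * r' - h' * s" using e by (simp add: mem_fr)
  have "s * (h * r' - h' * r) = r * (g * r' - h' * s) - r' * (g * r - h * s)" by (simp add: algebra_simps)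
  then have "of_nat p dvd s * (h * r' - h' * r)" using d assms(3) by (simp only:) simp
  then show "e \<in> fr h r" using off_cancel[OF assms(1)] e' by (simp add: mem_fr)
qed

lemma fr_eq:
  assumes "off s" "off r"
  shows "fr g s = fr h r \<longleftrightarrow> of_nat p dvd g * r - h * s"
proof
  assume "fr g s = fr h r"
  moreover have "(bc h, bc r) \<in> fr h r" using assms by (simp add: mem_fr)
  ultimately have "(bc h, bc r) \<in> fr g s" by simp
  then show "of_nat p dvd g * r - h * s" by (simp add: mem_fr)
next
  assume d: "of_nat p dvd g * r - h * s"
  then have "of_nat p dvd - (g * r - h * s)" by (simp only: dvd_minus_iff)
  then have "of_nat p dvd h * s - g * r" by simp
  then show "fr g s = fr h r" using fr_trans assms d by blast
qed

lemma carrier_Rp: "carrier R\<^sub>p = {fr g s | g s. off s}"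
  by (auto simp: local_plane_p_def localization_def fr_def carrier_Ap Sp_eq)

lemma fr_carrier: "off s \<Longrightarrow> fr g s \<in> carrier R\<^sub>p"
  unfolding carrier_Rp by blast

text \<open>Operations on fractions are unions over all pairs of representatives. When each pair
  yields the same class \<open>c\<close>, the union is \<open>c\<close>, the index set being
  nonempty because \<open>(g, s)\<close> and \<open>(h, r)\<close> represent their own
  classes.\<close>

lemma UN_fr_const:
  assumes "off s" "off r"
    and "\<And>g' s' h' r'. off s' \<Longrightarrow> off r' \<Longrightarrow> of_nat p dvd g * s' - g' * s \<Longrightarrow> of_nat p dvd h * r' - h' * r \<Longrightarrow>
      f (bc g') (bc s') (bc h') (bc r') = c"
  shows "(\<Union>(a, b)\<in>fr g s. \<Union>(a', b')\<in>fr h r. f a b a' b') = c"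
proof -
  have m: "(bc g, bc s) \<in> fr g s" "(bc h, bc r) \<in> fr h r" using assms by (simp_all add: mem_fr)
  have "f a b a' b' = c" if ab: "(a, b) \<in> fr g s" "(a', b') \<in> fr h r" for a b a' b'
  proof -
    obtain g' s' where 1: "a = bc g'" "b = bc s'" using ab(1) fr_subset[of g s] by blast
    obtain h' r' where 2: "a' = bc h'" "b' = bc r'" using ab(2) fr_subset[of h r] by blast
    show ?thesis unfolding 1 2 by (rule assms(3)) (use ab in \<open>simp_all add: 1 2 mem_fr\<close>)
  qed
  then show ?thesis using m by blast
qed

lemma fr_mult:
  assumes "off s" "off r"
  shows "fr g s \<otimes>\<^bsub>R\<^sub>p\<^esub> fr h r = fr (g * h) (s * r)"
proof -
  have "fr g s \<otimes>\<^bsub>R\<^sub>p\<^esub> fr h r =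
     (\<Union>(a, b)\<in>fr g s. \<Union>(a', b')\<in>fr h r. loc_frac A\<^sub>p S\<^sub>p (a \<otimes>\<^bsub>A\<^sub>p\<^esub> a') (b \<otimes>\<^bsub>A\<^sub>p\<^esub> b'))"
    by (simp add: local_plane_p_def localization_def)
  also have "\<dots> = fr (g * h) (s * r)"
  proof (rule UN_fr_const[OF assms])
    fix g' s' h' r'
    assume *: "off s'" "off r'" "of_nat p dvd g * s' - g' * s" "of_nat p dvd h * r' - h' * r"
    have "of_nat p dvd (h * r') * (g * s' - g' * s) + (g' * s) * (h * r' - h' * r)"
      by (rule dvd_add[OF dvd_mult[OF *(3)] dvd_mult[OF *(4)]])
    then have "of_nat p dvd (g * h) * (s' * r') - (g' * h') * (s * r)" by (simp add: algebra_simps)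
    then have "fr (g * h) (s * r) = fr (g' * h') (s' * r')" using * assms by (simp add: fr_eq)
    then show "loc_frac A\<^sub>p S\<^sub>p (bc g' \<otimes>\<^bsub>A\<^sub>p\<^esub> bc h') (bc s' \<otimes>\<^bsub>A\<^sub>p\<^esub> bc r') = fr (g * h) (s * r)"
      unfolding bc_simps fr_def[symmetric] by (rule sym)
  qed
  finally show ?thesis .
qed

lemma fr_add:
  assumes "off s" "off r"
  shows "fr g s \<oplus>\<^bsub>R\<^sub>p\<^esub> fr h r = fr (g * r + h * s) (s * r)"
proof -
  have "fr g s \<oplus>\<^bsub>R\<^sub>p\<^esub> fr h r =
     (\<Union>(a, b)\<in>fr g s. \<Union>(a', b')\<in>fr h r.
        loc_frac A\<^sub>p S\<^sub>p ((a \<otimes>\<^bsub>A\<^sub>p\<^esub> b') \<oplus>\<^bsub>A\<^sub>p\<^esub> (a' \<otimes>\<^bsub>A\<^sub>p\<^esub> b)) (b \<otimes>\<^bsub>A\<^sub>p\<^esub> b'))"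
    by (simp add: local_plane_p_def localization_def)
  also have "\<dots> = fr (g * r + h * s) (s * r)"
  proof (rule UN_fr_const[OF assms])
    fix g' s' h' r'
    assume *: "off s'" "off r'" "of_nat p dvd g * s' - g' * s" "of_nat p dvd h * r' - h' * r"
    have "of_nat p dvd (r * r') * (g * s' - g' * s) + (s * s') * (h * r' - h' * r)"
      by (rule dvd_add[OF dvd_mult[OF *(3)] dvd_mult[OF *(4)]])
    then have "of_nat p dvd (g * r + h * s) * (s' * r') - (g' * r' + h' * s') * (s * r)"
      by (simp add: algebra_simps)
    then have "fr (g * r + h * s) (s * r) = fr (g' * r' + h' * s') (s' * r')"
      using * assms by (simp add: fr_eq)
    then show "loc_frac A\<^sub>p S\<^sub>p (bc g' \<otimes>\<^bsub>A\<^sub>p\<^esub> bc r' \<oplus>\<^bsub>A\<^sub>p\<^esub> bc h' \<otimes>\<^bsub>A\<^sub>p\<^esub> bc s') (bc s' \<otimes>\<^bsub>A\<^sub>p\<^esub> bc r') =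
       fr (g * r + h * s) (s * r)"
      unfolding bc_simps fr_def[symmetric] by (rule sym)
  qed
  finally show ?thesis .
qed

lemma one_Rp: "\<one>\<^bsub>R\<^sub>p\<^esub> = fr 1 1" and zero_Rp: "\<zero>\<^bsub>R\<^sub>p\<^esub> = fr 0 1"
  by (simp_all add: local_plane_p_def localization_def fr_def bc_simps bc_zero)

lemma Rp_cases:
  assumes "z \<in> carrier R\<^sub>p"
  obtains g s where "z = fr g s" "off s"
  using assms unfolding carrier_Rp by blast

lemma cring_Rp: "cring R\<^sub>p"
proof (rule cringI)
  show "abelian_group R\<^sub>p"
  proof (rule abelian_groupI)
    fix a b assume "a \<in> carrier R\<^sub>p" "b \<in> carrier R\<^sub>p"
    then show "a \<oplus>\<^bsub>R\<^sub>p\<^esub> b \<in> carrier R\<^sub>p"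
      by (elim Rp_cases) (simp add: fr_add fr_carrier)
  next
    fix a b c assume "a \<in> carrier R\<^sub>p" "b \<in> carrier R\<^sub>p" "c \<in> carrier R\<^sub>p"
    then show "a \<oplus>\<^bsub>R\<^sub>p\<^esub> b \<oplus>\<^bsub>R\<^sub>p\<^esub> c = a \<oplus>\<^bsub>R\<^sub>p\<^esub> (b \<oplus>\<^bsub>R\<^sub>p\<^esub> c)"
      by (elim Rp_cases) (simp add: fr_add fr_eq algebra_simps)
  next
    fix a b assume "a \<in> carrier R\<^sub>p" "b \<in> carrier R\<^sub>p"
    then show "a \<oplus>\<^bsub>R\<^sub>p\<^esub> b = b \<oplus>\<^bsub>R\<^sub>p\<^esub> a"
      by (elim Rp_cases) (simp add: fr_add fr_eq algebra_simps)
  next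
    fix a assume "a \<in> carrier R\<^sub>p"
    then show "\<zero>\<^bsub>R\<^sub>p\<^esub> \<oplus>\<^bsub>R\<^sub>p\<^esub> a = a"
      by (elim Rp_cases) (simp add: zero_Rp fr_add fr_eq)
  next
    fix a assume "a \<in> carrier R\<^sub>p"
    then obtain g s where gs: "a = fr g s" "off s" by (rule Rp_cases)
    have "fr (- g) s \<oplus>\<^bsub>R\<^sub>p\<^esub> a = \<zero>\<^bsub>R\<^sub>p\<^esub>" using gs by (simp add: zero_Rp fr_add fr_eq)
    then show "\<exists>b\<in>carrier R\<^sub>p. b \<oplus>\<^bsub>R\<^sub>p\<^esub> a = \<zero>\<^bsub>R\<^sub>p\<^esub>" using fr_carrier gs by blast
  qed (simp add: zero_Rp fr_carrier)
  show "comm_monoid R\<^sub>p"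
  proof (rule comm_monoidI)
    fix a b assume "a \<in> carrier R\<^sub>p" "b \<in> carrier R\<^sub>p"
    then show "a \<otimes>\<^bsub>R\<^sub>p\<^esub> b \<in> carrier R\<^sub>p"
      by (elim Rp_cases) (simp add: fr_mult fr_carrier)
  next
    fix a b c assume "a \<in> carrier R\<^sub>p" "b \<in> carrier R\<^sub>p" "c \<in> carrier R\<^sub>p"
    then show "a \<otimes>\<^bsub>R\<^sub>p\<^esub> b \<otimes>\<^bsub>R\<^sub>p\<^esub> c = a \<otimes>\<^bsub>R\<^sub>p\<^esub> (b \<otimes>\<^bsub>R\<^sub>p\<^esub> c)"
      by (elim Rp_cases) (simp add: fr_mult fr_eq algebra_simps)
  next
    fix a b assume "a \<in> carrier R\<^sub>p" "b \<in> carrier R\<^sub>p"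
    then show "a \<otimes>\<^bsub>R\<^sub>p\<^esub> b = b \<otimes>\<^bsub>R\<^sub>p\<^esub> a"
      by (elim Rp_cases) (simp add: fr_mult fr_eq algebra_simps)
  next
    fix a assume "a \<in> carrier R\<^sub>p"
    then show "\<one>\<^bsub>R\<^sub>p\<^esub> \<otimes>\<^bsub>R\<^sub>p\<^esub> a = a"
      by (elim Rp_cases) (simp add: one_Rp fr_mult fr_eq)
  qed (simp add: one_Rp fr_carrier)
  fix a b c assume "a \<in> carrier R\<^sub>p" "b \<in> carrier R\<^sub>p" "c \<in> carrier R\<^sub>p"
  then show "(a \<oplus>\<^bsub>R\<^sub>p\<^esub> b) \<otimes>\<^bsub>R\<^sub>p\<^esub> c = a \<otimes>\<^bsub>R\<^sub>p\<^esub> c \<oplus>\<^bsub>R\<^sub>p\<^esub> b \<otimes>\<^bsub>R\<^sub>p\<^esub> c"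
    by (elim Rp_cases) (simp add: fr_mult fr_add fr_eq algebra_simps)
qed

lemma fr_uminus: "off s \<Longrightarrow> \<ominus>\<^bsub>R\<^sub>p\<^esub> fr g s = fr (- g) s"
proof -
  interpret cring R\<^sub>p by (rule cring_Rp)
  assume "off s"
  then show ?thesis by (intro minus_equality) (simp_all add: fr_add fr_eq zero_Rp fr_carrier)
qed

definition extension :: "int poly poly set \<Rightarrow> (int poly poly set \<times> int poly poly set) set set" where
  "extension K = {fr g s | g s. g \<in> K \<and> off s}"

lemma ideal_extension:
  assumes K: "sub_ideal UNIV K"
  shows "ideal (extension K) R\<^sub>p"
proof -
  interpret cring R\<^sub>p by (rule cring_Rp)
  have m: "fr h r \<otimes>\<^bsub>R\<^sub>p\<^esub> fr g s \<in> extension K" if "g \<in> K" "off s" "off r" for g s h r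
  proof -
    have "h * g \<in> K" using sub_idealD(4)[OF K] that by simp
    moreover have "fr h r \<otimes>\<^bsub>R\<^sub>p\<^esub> fr g s = fr (h * g) (r * s)" "off (r * s)"
      using that by (simp_all add: fr_mult)
    ultimately show ?thesis unfolding extension_def by blast
  qed
  show ?thesis
  proof (rule idealI[OF ring_axioms])
    show "subgroup (extension K) (add_monoid R\<^sub>p)"
    proof (rule add.subgroupI)
      show "extension K \<subseteq> carrier R\<^sub>p" by (auto simp: extension_def fr_carrier)
      show "extension K \<noteq> {}" using sub_idealD(2)[OF K] off_1 unfolding extension_def by blast
      show "\<ominus>\<^bsub>R\<^sub>p\<^esub> a \<in> extension K" if "a \<in> extension K" for a
        using that UNIV.sub_ideal_uminus[OF K] by (force simp: extension_def fr_uminus)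
      show "a \<oplus>\<^bsub>R\<^sub>p\<^esub> b \<in> extension K" if ab: "a \<in> extension K" "b \<in> extension K" for a b
      proof -
        obtain g s h r where 1: "a = fr g s" "b = fr h r" "g \<in> K" "h \<in> K" "off s" "off r"
          using ab by (auto simp: extension_def)
        have "r * g + s * h \<in> K" using sub_idealD(3,4)[OF K] 1 by simp
        then have "g * r + h * s \<in> K" by (simp add: mult.commute)
        moreover have "a \<oplus>\<^bsub>R\<^sub>p\<^esub> b = fr (g * r + h * s) (s * r)" "off (s * r)"
          using 1 by (simp_all add: fr_add)
        ultimately show ?thesis unfolding extension_def by blast
      qed
    qed
    show "x \<otimes>\<^bsub>R\<^sub>p\<^esub> a \<in> extension K" if "a \<in> extension K" "x \<in> carrier R\<^sub>p" for a x
      using that m by (auto simp: extension_def carrier_Rp)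
    show "a \<otimes>\<^bsub>R\<^sub>p\<^esub> x \<in> extension K" if "a \<in> extension K" "x \<in> carrier R\<^sub>p" for a x
    proof -
      have "a \<in> carrier R\<^sub>p" using that by (auto simp: extension_def fr_carrier)
      then have "a \<otimes>\<^bsub>R\<^sub>p\<^esub> x = x \<otimes>\<^bsub>R\<^sub>p\<^esub> a" using that by (simp add: m_comm)
      then show ?thesis using that m by (auto simp: extension_def carrier_Rp)
    qed
  qed
qed

text \<open>Contraction after extension gives back the colon ideal: a denominator is a unit modulo
  the box ideal and can be cancelled there.\<close>

lemma fr_in_extension_colon:
  assumes "off s"
  shows "fr g s \<in> extension (colon_box p q F) \<longleftrightarrow> g * F \<in> box_ideal p q"
proof
  assume "fr g s \<in> extension (colon_box p q F)"
  then obtain h r where h: "fr g s = fr h r" "h * F \<in> box_ideal p q" "off r"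
    by (auto simp: extension_def colon_box_def)
  then obtain k where "g * r - h * s = of_nat p * k" using assms by (auto simp: fr_eq dvd_def)
  then have "g * r = h * s + of_nat p * k" by (simp add: algebra_simps)
  then have "r * (g * F) = (h * F) * s + of_nat p * (k * F)"
    by (metis (no_types, lifting) distrib_right mult.assoc mult.commute)
  then have "r * (g * F) \<in> box_ideal p q"
    using box_ideal_add[OF box_ideal_mult_right[OF h(2)] box_ideal_gens(1)] by (simp only:)
  then show "g * F \<in> box_ideal p q" using unit_mult_box[OF prime] h(3) by (auto simp: off_def)
qed (use assms in \<open>auto simp: extension_def colon_box_def\<close>)

lemma fr_in_extension_box: "off s \<Longrightarrow> fr g s \<in> extension (box_ideal p q) \<longleftrightarrow> g \<in> box_ideal p q"
  using fr_in_extension_colon[of s g q 1] by (simp add: colon_box_def)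

lemma local_p_eq: "local_p p g = fr g 1"
  by (simp add: local_p_def fr_def bc_simps)

lemma frobenius_power_ideal:
  "Idl\<^bsub>R\<^sub>p\<^esub> {local_p p (var_x ^ q), local_p p (var_y ^ q)} = extension (box_ideal p q)"
proof
  interpret cring R\<^sub>p by (rule cring_Rp)
  let ?G = "{local_p p (var_x ^ q), local_p p (var_y ^ q)}"
  have G: "?G \<subseteq> carrier R\<^sub>p" by (auto simp: local_p_eq fr_carrier)
  have "?G \<subseteq> extension (box_ideal p q)"
    using box_ideal_gens(2,3)[of q 1 p] by (auto simp: local_p_eq fr_in_extension_box)
  then show "Idl\<^bsub>R\<^sub>p\<^esub> ?G \<subseteq> extension (box_ideal p q)"
    by (rule genideal_minimal[OF ideal_extension[OF sub_ideal_box]])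
  interpret I: ideal "Idl\<^bsub>R\<^sub>p\<^esub> ?G" R\<^sub>p by (rule genideal_ideal[OF G])
  show "extension (box_ideal p q) \<subseteq> Idl\<^bsub>R\<^sub>p\<^esub> ?G"
  proof
    fix z assume "z \<in> extension (box_ideal p q)"
    then obtain g s where z: "z = fr g s" "g \<in> box_ideal p q" "off s" by (auto simp: extension_def)
    obtain a b c where g: "g = of_nat p * a + var_x ^ q * b + var_y ^ q * c" using box_ideal_decomp[OF z(2)] .
    have "z = fr b s \<otimes>\<^bsub>R\<^sub>p\<^esub> fr (var_x ^ q) 1 \<oplus>\<^bsub>R\<^sub>p\<^esub> fr c s \<otimes>\<^bsub>R\<^sub>p\<^esub> fr (var_y ^ q) 1"
      using z(1,3) by (simp add: fr_mult fr_add fr_eq g algebra_simps)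
    moreover have "fr (var_x ^ q) 1 \<in> Idl\<^bsub>R\<^sub>p\<^esub> ?G" "fr (var_y ^ q) 1 \<in> Idl\<^bsub>R\<^sub>p\<^esub> ?G"
      using genideal_self[OF G] by (auto simp: local_p_eq)
    ultimately show "z \<in> Idl\<^bsub>R\<^sub>p\<^esub> ?G" using z(3) by (simp add: I.I_l_closed fr_carrier)
  qed
qed

lemma colon_ideal_eq:
  "colon_ideal R\<^sub>p (Idl\<^bsub>R\<^sub>p\<^esub> {local_p p (var_x ^ q), local_p p (var_y ^ q)}) (local_p p F) =
    extension (colon_box p q F)" (is "?L = ?R")
proof -
  have "z \<in> ?L \<longleftrightarrow> z \<in> ?R" if "z \<in> carrier R\<^sub>p" for z
    using that unfolding frobenius_power_ideal
    by (elim Rp_cases) (simp add: colon_ideal_def fr_carrier local_p_eq fr_mult fr_in_extension_box fr_in_extension_colon)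
  moreover have "?L \<subseteq> carrier R\<^sub>p" "?R \<subseteq> carrier R\<^sub>p"
    by (auto simp: colon_ideal_def extension_def fr_carrier)
  ultimately show ?thesis by blast
qed

text \<open>Elements outside the maximal ideal are invertible modulo the box ideal, so localizing
  changes nothing in the quotient and the length found over the integral polynomials is the required
  one.\<close>

theorem colength_colon:
  "colength R\<^sub>p (colon_ideal R\<^sub>p (Idl\<^bsub>R\<^sub>p\<^esub> {local_p p (var_x ^ q), local_p p (var_y ^ q)}) (local_p p F)) =
    real (box_length p q F)"
proof -
  interpret cring R\<^sub>p by (rule cring_Rp)
  have tow: "ideal_tower UNIV {g. int p dvd at_origin g} (colon_box p q F) UNIV (box_length p q F)"
    by (rule box_length[OF prime])
  have pre: "{r \<in> UNIV. local_p p r \<in> extension (colon_box p q F)} = colon_box p q F"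
    by (simp add: local_p_eq fr_in_extension_colon) (simp add: colon_box_def)
  show ?thesis
    unfolding colon_ideal_eq
  proof (rule UNIV.colength_eq[where \<phi> = "local_p p" and M = "{g. int p dvd at_origin g}",
        OF ideal_extension[OF sub_ideal_colon]], unfold pre)
    show "ideal_tower UNIV {g. int p dvd at_origin g} (colon_box p q F) UNIV (box_length p q F)" by (rule tow)
    show "sub_ideal UNIV (colon_box p q F)" by (rule sub_ideal_colon)
    fix z assume "z \<in> carrier R\<^sub>p"
    then obtain g s where z: "z = fr g s" "off s" by (rule Rp_cases)
    \<comment> \<open>With \<open>w\<close> inverse to \<open>s\<close> modulo the box ideal, the
      fraction \<open>g / s\<close> is congruent to \<open>g * w\<close>.\<close>
    obtain w where w: "w * s - 1 \<in> box_ideal p q"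
      using unit_mod_box[OF prime] z(2) unfolding off_def by metis
    have "z \<ominus>\<^bsub>R\<^sub>p\<^esub> local_p p (g * w) = fr (g - (g * w) * s) s"
      using z by (simp add: local_p_eq a_minus_def fr_uminus fr_add fr_eq)
    moreover have "g - (g * w) * s = - g * (w * s - 1)" by (simp add: algebra_simps)
    moreover have "- g * (w * s - 1) \<in> colon_box p q F"
      using box_ideal_mult[OF w] box_subset_colon by blast
    ultimately have "z \<ominus>\<^bsub>R\<^sub>p\<^esub> local_p p (g * w) \<in> extension (colon_box p q F)"
      using z(2) unfolding extension_def by auto
    then show "\<exists>r\<in>UNIV. z \<ominus>\<^bsub>R\<^sub>p\<^esub> local_p p r \<in> extension (colon_box p q F)" by blast
  next
    show "\<forall>r\<in>UNIV - {g. int p dvd at_origin g}. \<exists>s\<in>UNIV. local_p p (s * r - 1) \<in> extension (colon_box p q F)"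
    proof
      fix r assume "r \<in> UNIV - {g. int p dvd at_origin g}"
      then obtain w where "w * r - 1 \<in> box_ideal p q" using unit_mod_box[OF prime] by (metis DiffE mem_Collect_eq)
      then have "w * r - 1 \<in> colon_box p q F" using box_subset_colon by blast
      then have "local_p p (w * r - 1) \<in> extension (colon_box p q F)"
        unfolding local_p_eq extension_def using off_1 by blast
      then show "\<exists>s\<in>UNIV. local_p p (s * r - 1) \<in> extension (colon_box p q F)" by blast
    qed
  qed (simp_all add: local_p_eq fr_carrier fr_add fr_mult)
qed

end

section \<open>The limit of the F-signatures\<close>

definition limit_signature :: "real \<Rightarrow> real \<Rightarrow> real \<Rightarrow> real" where
  "limit_signature \<alpha> \<beta> \<gamma> =
    (if \<alpha> < 1 \<and> \<beta> < 1 \<and> \<gamma> < 1 \<and> \<alpha> + \<beta> + \<gamma> < 2 then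
       if \<beta> + \<gamma> \<le> \<alpha> then (1 - \<alpha>) * (1 - \<beta> - \<gamma>)
       else if \<alpha> + \<gamma> \<le> \<beta> then (1 - \<beta>) * (1 - \<alpha> - \<gamma>)
       else if \<alpha> + \<beta> \<le> \<gamma> then (1 - \<gamma>) * (1 - \<alpha> - \<beta>)
       else (1 - (\<alpha> + \<beta> + \<gamma>) / 2)\<^sup>2
     else 0)"

lemma limit_signature_swap: "limit_signature \<beta> \<alpha> \<gamma> = limit_signature \<alpha> \<beta> \<gamma>" if "0 \<le> \<alpha>" "0 \<le> \<beta>" "0 \<le> \<gamma>"
  using that unfolding limit_signature_def by (auto simp: algebra_simps)

lemma limit_signature_shear: "limit_signature \<gamma> \<beta> \<alpha> = limit_signature \<alpha> \<beta> \<gamma>" if "0 \<le> \<alpha>" "0 \<le> \<beta>" "0 \<le> \<gamma>"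
  using that unfolding limit_signature_def by (auto simp: algebra_simps)

section \<open>Staircase sums\<close>

lemma card_under_graph: "card {(i, j). i < d \<and> j < h i} = (\<Sum>i<d. h i)" for d :: nat and h :: "nat \<Rightarrow> nat"
proof -
  have "{(i, j). i < d \<and> j < h i} = Sigma {..<d} (\<lambda>i. {..<h i})" by auto
  then show ?thesis by (simp add: card_SigmaI)
qed

lemma sum_diff_le: "2 * (\<Sum>i<d. m - i) \<le> m * (m + 1)" for m d :: nat
proof (induction m)
  case (Suc m)
  have "(\<Sum>i<d. Suc m - i) \<le> (\<Sum>i<d. (m - i) + (if i \<le> m then 1 else 0))"
    by (intro sum_mono) auto
  also have "\<dots> = (\<Sum>i<d. m - i) + card ({..<d} \<inter> {i. i \<le> m})"
    by (simp add: sum.distrib sum.If_cases)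
  also have "card ({..<d} \<inter> {i. i \<le> m}) \<le> card {..m}" by (intro card_mono) auto
  finally show ?case using Suc by simp
qed simp

text \<open>The reflection \<open>(i, j)\<close> to \<open>(q - 1 - i, q - 1 - j)\<close> turns the
  upper triangle into a lower one. Only the truncation in the direction of \<open>x\<close> is kept,
  so both counts become sums of truncated columns.\<close>

lemma box_length_upper_sum:
  assumes p: "Factorial_Ring.prime p"
  shows "box_length p q (lines A B C) \<le>
    (\<Sum>i<q - A. m - i) + (\<Sum>i<q - A. (2 * q - 1 - (m + A + B + C)) - i)"
proof -
  let ?M = "2 * q - 1 - (m + A + B + C)"
  have "card {(i, j). i < q - A \<and> j < q - B \<and> i + j < m} \<le> card {(i, j). i < q - A \<and> j < m - i}"
    by (rule card_mono) (auto intro: finite_subset[of _ "{..<q} \<times> {..<m}"])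
  moreover have "card {(i, j). A \<le> i \<and> i < q \<and> B \<le> j \<and> j < q \<and> m + A + B + C \<le> i + j} \<le>
      card {(i, j). i < q - A \<and> j < ?M - i}"
  proof (rule card_inj_on_le[where f = "\<lambda>(i, j). (q - 1 - i, q - 1 - j)"])
    show "finite {(i, j). i < q - A \<and> j < ?M - i}"
      by (rule finite_subset[of _ "{..<q} \<times> {..<?M}"]) auto
    show "inj_on (\<lambda>(i, j). (q - 1 - i, q - 1 - j)) {(i, j). A \<le> i \<and> i < q \<and> B \<le> j \<and> j < q \<and> m + A + B + C \<le> i + j}"
      by (auto simp: inj_on_def)
  qed auto
  ultimately show ?thesis
    using box_length_upper[OF p, of q A B C m] unfolding card_under_graph by linarith
qed

lemma box_length_upper_total:
  assumes p: "Factorial_Ring.prime p"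
  shows "real (box_length p q (lines A B C)) \<le> (max 0 (2 * real q - A - B - C))\<^sup>2 / 4 + real q"
proof -
  define S where "S = 2 * q - (A + B + C)"
  \<comment> \<open>Halving the available degree makes the two triangles equal up to rounding, which
    minimizes the sum of their areas.\<close>
  define m where "m = S div 2"
  have "box_length p q (lines A B C) \<le> (\<Sum>i<q - A. m - i) + (\<Sum>i<q - A. (2 * q - 1 - (m + A + B + C)) - i)"
    by (rule box_length_upper_sum[OF p])
  also have "\<dots> \<le> (\<Sum>i<q - A. m - i) + (\<Sum>i<q - A. m - i)"
  proof (intro add_left_mono sum_mono diff_le_mono)
    have "S \<le> 2 * m + 1" by (simp add: m_def)
    then show "2 * q - 1 - (m + A + B + C) \<le> m" unfolding S_def by linarith
  qed
  finally have "box_length p q (lines A B C) \<le> m * (m + 1)" using sum_diff_le[of m "q - A"] by linarith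
  then have "real (box_length p q (lines A B C)) \<le> real (m * (m + 1))"
    by (rule of_nat_mono)
  also have "\<dots> = real m * (real m + 1)" by (simp add: algebra_simps)
  also have m: "2 * real m \<le> real S" by (simp add: m_def)
  have "real m * (real m + 1) = (2 * real m)\<^sup>2 / 4 + real m" by (simp add: power2_eq_square algebra_simps)
  also have "\<dots> \<le> (real S)\<^sup>2 / 4 + real S / 2"
    using m by (intro add_mono divide_right_mono power_mono) simp_all
  also have "real S = max 0 (2 * real q - A - B - C)" by (auto simp: S_def of_nat_diff)
  also have "max 0 (2 * real q - A - B - C) / 2 \<le> q" by simp
  finally show ?thesis by simp
qed

lemma sum_linear: "(\<Sum>i<d. (real u - real i) + (real v - real i)) = real d * (real u + real v - real d + 1)"
  by (induction d) (simp_all add: algebra_simps)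

text \<open>The cut-off is \<open>q - A\<close>, the width of the strip. The two staircases then
  start at heights about \<open>q - A\<close> and \<open>q - (B + C)\<close>, and their falling
  columns add up to the area of a rectangle.\<close>

lemma box_length_upper_flat:
  assumes p: "Factorial_Ring.prime p" and AB: "B + C \<le> A"
  shows "real (box_length p q (lines A B C)) \<le> real (q - A) * (real (q - (B + C)) + 1)"
proof -
  let ?d = "q - A" and ?D = "q - (B + C)"
  have "box_length p q (lines A B C) \<le> (\<Sum>i<?d. ?d - i) + (\<Sum>i<?d. (2 * q - 1 - (?d + A + B + C)) - i)"
    by (rule box_length_upper_sum[OF p])
  also have "\<dots> \<le> (\<Sum>i<?d. ?d - i) + (\<Sum>i<?d. ?D - i)"
    by (intro add_left_mono sum_mono diff_le_mono) auto
  finally have "real (box_length p q (lines A B C)) \<le> real ((\<Sum>i<?d. ?d - i) + (\<Sum>i<?d. ?D - i))"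
    by (rule of_nat_mono)
  also have "\<dots> = (\<Sum>i<?d. (real ?d - real i) + (real ?D - real i))"
    unfolding of_nat_add of_nat_sum sum.distrib[symmetric]
    by (rule sum.cong[OF refl], subst of_nat_diff, simp, subst of_nat_diff) (use AB in auto)
  also have "\<dots> = real ?d * (real ?D + 1)" unfolding sum_linear by simp
  finally show ?thesis .
qed

text \<open>The induction starts at \<open>d = \<bar>E\<bar>\<close>, where the left side is
  \<open>E^2\<close> or 0 and the constant part of the maximum suffices; every later column pays for
  its increment with the linear part.\<close>

lemma sum_max_lower:
  fixes E :: int
  assumes "\<bar>E\<bar> \<le> int d"
  shows "(real d + of_int E)\<^sup>2 / 4 \<le> (\<Sum>r<d. max (max 0 (of_int E)) ((real (Suc r) + of_int E) / 2))"
proof -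
  have "nat \<bar>E\<bar> \<le> d" using assms by simp
  then show ?thesis
  proof (induction d rule: dec_induct)
    case base
    show ?case
    proof (cases "E \<ge> 0")
      case True
      have "(real (nat \<bar>E\<bar>) + of_int E)\<^sup>2 / 4 = (\<Sum>r<nat \<bar>E\<bar>. of_int E :: real)"
        using True by (simp add: power2_eq_square)
      also have "\<dots> \<le> (\<Sum>r<nat \<bar>E\<bar>. max (max 0 (of_int E)) ((real (Suc r) + of_int E) / 2))"
        by (intro sum_mono) auto
      finally show ?thesis .
    next
      case False
      then show ?thesis by (auto intro!: sum_nonneg)
    qed
  next
    case (step d)
    have "real d + of_int E \<ge> 0" using step.hyps by linarith
    then have "(real (Suc d) + of_int E)\<^sup>2 / 4 \<le> (real d + of_int E)\<^sup>2 / 4 + (real (Suc d) + of_int E) / 2"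
      by (simp add: power2_eq_square field_simps)
    moreover have "(real (Suc d) + of_int E) / 2 \<le> max (max 0 (of_int E)) ((real (Suc d) + of_int E) / 2)"
      by (rule max.cobounded2)
    ultimately show ?case using step.IH unfolding sum.lessThan_Suc by linarith
  qed
qed

lemma box_length_lower_flat:
  assumes p: "Factorial_Ring.prime p"
  shows "real (p - A) * real (p - (B + C)) \<le> real (box_length p p (lines A B C))"
proof -
  let ?\<Omega> = "{(i, k). i < p - A \<and>
      (k + B + C < p \<or> C + k < p \<and> B + k < p \<and> A + i + B + C + 2 * k \<le> 2 * (p - 1))}"
  have "(p - A) * (p - (B + C)) = card {(i, k). i < p - A \<and> k < p - (B + C)}"
    unfolding card_under_graph[of "p - A" "\<lambda>_. p - (B + C)"] by simp
  also have "\<dots> \<le> card ?\<Omega>"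
    by (rule card_mono) (auto intro: finite_subset[of _ "{..<p} \<times> {..<p}"])
  also have "\<dots> \<le> box_length p p (lines A B C)" by (rule box_length_lower[OF p])
  finally show ?thesis by (metis of_nat_le_iff of_nat_mult)
qed

lemma box_length_lower_total:
  assumes p: "Factorial_Ring.prime p" and AB: "B \<le> A" "C \<le> A" "A \<le> B + C" "A \<le> p" "A + B + C \<le> 2 * p"
  shows "(2 * real p - A - B - C)\<^sup>2 / 4 - p \<le> real (box_length p p (lines A B C))"
proof -
  let ?\<Omega> = "{(i, k). i < p - A \<and>
      (k + B + C < p \<or> C + k < p \<and> B + k < p \<and> A + i + B + C + 2 * k \<le> 2 * (p - 1))}"
  define E where "E = int p - int B - int C"
  define d where "d = p - A"
  \<comment> \<open>Height of column \<open>i\<close>: the better of the two criteria for leading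
    terms. Rounding in the second loses at most one per column, which becomes the error
    \<open>p\<close>.\<close>
  define h where "h i = max (p - (B + C)) ((2 * p - (A + B + C + i)) div 2)" for i
  have "(\<Sum>i<d. h i) = card {(i, k). i < d \<and> k < h i}" by (simp add: card_under_graph)
  also have "\<dots> \<le> card ?\<Omega>"
  proof (rule card_mono)
    show "{(i, k). i < d \<and> k < h i} \<subseteq> ?\<Omega>"
      using AB by (auto simp: d_def h_def less_max_iff_disj)
  qed (auto intro: finite_subset[of _ "{..<p} \<times> {..<p}"])
  also have "\<dots> \<le> box_length p p (lines A B C)" by (rule box_length_lower[OF p])
  finally have le: "(\<Sum>i<d. real (h i)) \<le> real (box_length p p (lines A B C))"
    by (metis (mono_tags, lifting) of_nat_le_iff of_nat_sum)
  have dE: "real d + of_int E = 2 * real p - A - B - C" using AB by (simp add: d_def E_def of_nat_diff)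
  have "\<bar>E\<bar> \<le> int d" using AB by (auto simp: E_def d_def of_nat_diff)
  then have "(real d + of_int E)\<^sup>2 / 4 \<le> (\<Sum>r<d. max (max 0 (of_int E)) ((real (Suc r) + of_int E) / 2))"
    by (rule sum_max_lower)
  \<comment> \<open>The columns are tallest at \<open>i = 0\<close>, whereas the induction adds the
    taller ones last; hence the reversal.\<close>
  also have "\<dots> = (\<Sum>i<d. max (max 0 (of_int E)) ((real (Suc (d - Suc i)) + of_int E) / 2))"
    by (rule sum.nat_diff_reindex[symmetric])
  also have "\<dots> \<le> (\<Sum>i<d. real (h i) + 1)"
  proof (rule sum_mono)
    fix i assume "i \<in> {..<d}"
    then have i: "Suc (d - Suc i) = d - i" "i < d" by auto
    have "real (d - i) + of_int E \<le> real (2 * p - (A + B + C + i))"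
      using i AB unfolding E_def d_def by (simp add: of_nat_diff)
    also have "\<dots> \<le> 2 * real (h i) + 1"
      unfolding h_def by linarith
    finally have "(real (d - i) + of_int E) / 2 \<le> real (h i) + 1" by simp
    moreover have "of_int E \<le> real (h i)" by (auto simp: E_def h_def)
    ultimately show "max (max 0 (of_int E)) ((real (Suc (d - Suc i)) + of_int E) / 2) \<le> real (h i) + 1"
      unfolding i(1) by simp
  qed
  also have "\<dots> = (\<Sum>i<d. real (h i)) + d" by (simp add: sum.distrib)
  finally have "(2 * real p - A - B - C)\<^sup>2 / 4 \<le> (\<Sum>i<d. real (h i)) + d" unfolding dE .
  moreover have "real d \<le> p" by (simp add: d_def)
  ultimately show ?thesis using le by linarith
qed


section \<open>Comparison of the lengths with the limit function\<close>

lemma limit_signature_max: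
  assumes "\<beta> \<le> \<alpha>" "\<gamma> \<le> \<alpha>" "0 \<le> \<beta>" "0 \<le> \<gamma>"
  shows "limit_signature \<alpha> \<beta> \<gamma> =
    (if \<alpha> < 1 \<and> \<alpha> + \<beta> + \<gamma> < 2 then
       if \<beta> + \<gamma> \<le> \<alpha> then (1 - \<alpha>) * (1 - \<beta> - \<gamma>) else (1 - (\<alpha> + \<beta> + \<gamma>) / 2)\<^sup>2
     else 0)"
  using assms unfolding limit_signature_def by auto

lemma box_length_upper_limit:
  fixes T :: real and a b c N q :: nat
  assumes p: "Factorial_Ring.prime p" and T: "0 \<le> T" "T * q \<le> N" and abc: "b \<le> a" "c \<le> a"
  shows "real (box_length p q (lines (a * N) (b * N) (c * N))) \<le> limit_signature (T * a) (T * b) (T * c) * q\<^sup>2 + q"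
proof -
  define \<alpha> \<beta> \<gamma> where "\<alpha> = T * a" and "\<beta> = T * b" and "\<gamma> = T * c"
  let ?G = "limit_signature \<alpha> \<beta> \<gamma>"
  let ?l = "real (box_length p q (lines (a * N) (b * N) (c * N)))"
  have ord: "\<beta> \<le> \<alpha>" "\<gamma> \<le> \<alpha>" "0 \<le> \<beta>" "0 \<le> \<gamma>" "0 \<le> \<alpha>"
    using T abc by (auto simp: \<alpha>_def \<beta>_def \<gamma>_def intro!: mult_left_mono)
  note G = limit_signature_max[OF ord(1-4)]
  have low: "\<alpha> * q \<le> a * N" "\<beta> * q \<le> b * N" "\<gamma> * q \<le> c * N"
    using mult_left_mono[OF T(2), of "real a"] mult_left_mono[OF T(2), of "real b"]
      mult_left_mono[OF T(2), of "real c"]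
    by (simp_all add: \<alpha>_def \<beta>_def \<gamma>_def mult_ac)
  have tot: "?l \<le> (max 0 (2 * real q - real (a * N) - real (b * N) - real (c * N)))\<^sup>2 / 4 + q"
    by (rule box_length_upper_total[OF p])
  have y: "2 * real q - real (a * N) - real (b * N) - real (c * N) \<le> (2 - (\<alpha> + \<beta> + \<gamma>)) * q"
    using low by (simp add: algebra_simps)
  have "?l \<le> ?G * q\<^sup>2 + q"
  proof (cases "\<alpha> < 1 \<and> \<alpha> + \<beta> + \<gamma> < 2")
    case False
    then have G0: "?G = 0" unfolding G by auto
    consider "1 \<le> \<alpha>" | "2 \<le> \<alpha> + \<beta> + \<gamma>" using False by linarith
    then show ?thesis
    proof cases
      case 1
      then have "real q \<le> \<alpha> * q" using mult_right_mono[of 1 \<alpha> "real q"] by simp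
      then have "real q \<le> real (a * N)" using low(1) by linarith
      then have "q - a * N = 0" by (simp only: of_nat_le_iff)
      then have "?l = 0" using box_length_upper_sum[OF p, of q "a * N" "b * N" "c * N" 0] by simp
      then show ?thesis by (simp add: G0)
    next
      case 2
      then have "(2 - (\<alpha> + \<beta> + \<gamma>)) * q \<le> 0" by (simp add: mult_nonpos_nonneg)
      then have "max 0 (2 * real q - real (a * N) - real (b * N) - real (c * N)) = 0" using y by linarith
      then show ?thesis using tot by (simp add: G0)
    qed
  next
    case klt: True
    then have ynn: "0 \<le> (2 - (\<alpha> + \<beta> + \<gamma>)) * q" by simp
    then have "max 0 (2 * real q - real (a * N) - real (b * N) - real (c * N)) \<le> (2 - (\<alpha> + \<beta> + \<gamma>)) * q"
      using y by linarith
    then have "(max 0 (2 * real q - real (a * N) - real (b * N) - real (c * N)))\<^sup>2 / 4 \<le>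
        ((2 - (\<alpha> + \<beta> + \<gamma>)) * q)\<^sup>2 / 4"
      by (intro divide_right_mono power_mono) simp_all
    also have "\<dots> = (1 - (\<alpha> + \<beta> + \<gamma>) / 2)\<^sup>2 * q\<^sup>2" by (simp add: power2_eq_square field_simps)
    finally have tri: "?l \<le> (1 - (\<alpha> + \<beta> + \<gamma>) / 2)\<^sup>2 * q\<^sup>2 + q" using tot by linarith
    show ?thesis
    proof (cases "\<beta> + \<gamma> \<le> \<alpha>")
      case False then show ?thesis using tri klt by (simp add: G)
    next
      case True
      show ?thesis
      \<comment> \<open>For \<open>T = 0\<close> the hypothesis says nothing about \<open>a\<close>,
        \<open>b\<close>, \<open>c\<close>, but the general bound already has the right leading
        coefficient; for \<open>T > 0\<close> it descends to \<open>b + c \<le> a\<close>.\<close>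
      proof (cases "T = 0")
        case True then show ?thesis using tri by (simp add: limit_signature_def \<alpha>_def \<beta>_def \<gamma>_def)
      next
        case False
        then have "T > 0" using T by simp
        have "T * (real b + real c) \<le> T * real a" using True by (simp add: \<alpha>_def \<beta>_def \<gamma>_def algebra_simps)
        then have "real b + real c \<le> real a" using \<open>T > 0\<close> by simp
        then have "b + c \<le> a" by linarith
        then have "b * N + c * N \<le> a * N" by (metis distrib_right mult_le_mono1)
        then have "?l \<le> real (q - a * N) * (real (q - (b * N + c * N)) + 1)" by (rule box_length_upper_flat[OF p])
        also have "\<dots> \<le> ((1 - \<alpha>) * q) * ((1 - \<beta> - \<gamma>) * q + 1)"
        proof (rule mult_mono)
          have "0 \<le> (1 - \<alpha>) * q" using klt by simp
          then show "real (q - a * N) \<le> (1 - \<alpha>) * q"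
            using low by (cases "a * N \<le> q") (simp_all add: of_nat_diff algebra_simps)
          have "0 \<le> (1 - \<beta> - \<gamma>) * q" using klt True by simp
          then show "real (q - (b * N + c * N)) + 1 \<le> (1 - \<beta> - \<gamma>) * q + 1"
            using low by (cases "b * N + c * N \<le> q") (simp_all add: of_nat_diff algebra_simps)
        qed (use klt in auto)
        also have "\<dots> = (1 - \<alpha>) * (1 - \<beta> - \<gamma>) * q\<^sup>2 + (1 - \<alpha>) * q" by (simp add: power2_eq_square algebra_simps)
        also have "(1 - \<alpha>) * q \<le> 1 * real q" using ord by (intro mult_right_mono) auto
        finally show ?thesis using klt True by (simp add: G)
      qed
    qed
  qed
  then show ?thesis by (simp add: \<alpha>_def \<beta>_def \<gamma>_def)
qed

text \<open>Rounding \<open>N\<close> up raises the exponents by at most \<open>a\<close>,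
  \<open>b\<close> and \<open>c\<close>, each unit costing at most \<open>p\<close>; one more
  \<open>p\<close> is lost in the staircase.\<close>

lemma box_length_lower_limit:
  fixes T :: real and a b c N p :: nat
  assumes p: "Factorial_Ring.prime p" and T: "0 \<le> T" "T * p \<le> N" "N \<le> T * p + 1" and abc: "b \<le> a" "c \<le> a"
  shows "limit_signature (T * a) (T * b) (T * c) * p\<^sup>2 - (real a + real b + real c + 1) * p
    \<le> real (box_length p p (lines (a * N) (b * N) (c * N)))"
proof -
  define \<alpha> \<beta> \<gamma> where "\<alpha> = T * a" and "\<beta> = T * b" and "\<gamma> = T * c"
  let ?G = "limit_signature \<alpha> \<beta> \<gamma>"
  let ?l = "real (box_length p p (lines (a * N) (b * N) (c * N)))"
  define s where "s = real a + b + c"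
  have ord: "\<beta> \<le> \<alpha>" "\<gamma> \<le> \<alpha>" "0 \<le> \<beta>" "0 \<le> \<gamma>" "0 \<le> \<alpha>"
    using T abc by (auto simp: \<alpha>_def \<beta>_def \<gamma>_def intro!: mult_left_mono)
  note G = limit_signature_max[OF ord(1-4)]
  have up: "a * N \<le> \<alpha> * p + a" "b * N \<le> \<beta> * p + b" "c * N \<le> \<gamma> * p + c"
    using mult_left_mono[OF T(3), of "real a"] mult_left_mono[OF T(3), of "real b"]
      mult_left_mono[OF T(3), of "real c"]
    by (simp_all add: \<alpha>_def \<beta>_def \<gamma>_def algebra_simps)
  have s0: "0 \<le> s" by (simp add: s_def)
  have "?G * p\<^sup>2 - (s + 1) * p \<le> ?l"
  proof (cases "\<alpha> < 1 \<and> \<alpha> + \<beta> + \<gamma> < 2")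
    case False
    then have "?G = 0" unfolding G by auto
    moreover have "0 \<le> (s + 1) * p" using s0 by simp
    ultimately show ?thesis by simp
  next
    case klt: True
    show ?thesis
    proof (cases "\<beta> + \<gamma> \<le> \<alpha>")
      case True
      define u v where "u = (1 - \<alpha>) * p" and "v = (1 - \<beta> - \<gamma>) * p"
      have uv: "0 \<le> u" "0 \<le> v" "u \<le> p" "v \<le> p"
        using klt True ord by (auto simp: u_def v_def intro!: mult_left_le_one_le)
      have sub: "real m - real n \<le> real (m - n)" for m n by linarith
      have P: "u - a \<le> real (p - a * N)" "v - (real b + c) \<le> real (p - (b * N + c * N))"
        using up sub[of p "a * N"] sub[of p "b * N + c * N"]
        by (simp_all add: u_def v_def left_diff_distrib)
      have "u * v - (real a * v + (real b + c) * u) \<le> real (p - a * N) * real (p - (b * N + c * N))"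
      \<comment> \<open>If one side of the rectangle is no longer than its rounding error, the
        claimed lower bound is at most zero.\<close>
      proof (cases "u \<le> a \<or> v \<le> real b + c")
        case True
        have "u * v \<le> real a * v + (real b + c) * u"
        proof (cases "u \<le> a")
          case True
          then have "u * v \<le> real a * v" using uv by (intro mult_right_mono) auto
          moreover have "0 \<le> (real b + c) * u" using uv by simp
          ultimately show ?thesis by linarith
        next
          case False
          then have "v * u \<le> (real b + c) * u" using \<open>u \<le> a \<or> v \<le> real b + c\<close> uv by (intro mult_right_mono) auto
          moreover have "0 \<le> real a * v" using uv by simp
          ultimately show ?thesis by (simp add: mult.commute)
        qed
        moreover have "0 \<le> real (p - a * N) * real (p - (b * N + c * N))" by simp
        ultimately show ?thesis by linarith
      next
        case False
        then have "(u - a) * (v - (real b + c)) \<le> real (p - a * N) * real (p - (b * N + c * N))"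
          using P by (intro mult_mono) auto
        moreover have "(u - a) * (v - (real b + c)) =
            u * v - (real a * v + (real b + c) * u) + real a * (real b + c)" by (simp add: algebra_simps)
        moreover have "0 \<le> real a * (real b + c)" by simp
        ultimately show ?thesis by linarith
      qed
      also have "\<dots> \<le> ?l" by (rule box_length_lower_flat[OF p])
      finally have "u * v - (real a * v + (real b + c) * u) \<le> ?l" .
      moreover have "real a * v + (real b + c) * u \<le> real a * p + (real b + c) * p"
        using uv by (intro add_mono mult_left_mono) auto
      moreover have "real a * p + (real b + c) * p \<le> (s + 1) * p" by (simp add: s_def algebra_simps)
      moreover have "u * v = ?G * p\<^sup>2" using klt True by (simp add: G u_def v_def power2_eq_square)
      ultimately show ?thesis by linarith
    next
      case False
      have "T * real a < T * (real b + real c)" using False by (simp add: \<alpha>_def \<beta>_def \<gamma>_def algebra_simps)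
      then have "real a < real b + real c" using T(1) by (metis linorder_not_le mult_left_mono)
      then have "a \<le> b + c" by linarith
      then have le: "a * N \<le> b * N + c * N" by (metis distrib_right mult_le_mono1)
      define y where "y = (2 - (\<alpha> + \<beta> + \<gamma>)) * p"
      have y: "0 \<le> y" "y \<le> 2 * p" using klt ord by (auto simp: y_def intro!: mult_right_mono)
      have Gy: "?G * p\<^sup>2 = y\<^sup>2 / 4" using klt False by (simp add: G y_def power2_eq_square field_simps)
      \<comment> \<open>Near the klt boundary rounding may violate the hypotheses of the count; then
        \<open>y\<close> is so small that the left side of the claim is not positive.\<close>
      consider "real p < a * N" | "2 * real p < a * N + b * N + c * N"
        | "a * N \<le> p" "a * N + b * N + c * N \<le> 2 * p" by linarith
      then show ?thesis
      proof cases
        case 1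
        then have "(1 - \<alpha>) * p \<le> a" using up by (simp add: algebra_simps)
        moreover have "y / 2 \<le> (1 - \<alpha>) * p"
        proof -
          have "y \<le> (2 - 2 * \<alpha>) * p" unfolding y_def using False by (intro mult_right_mono) auto
          then show ?thesis by (simp add: algebra_simps)
        qed
        ultimately have "y / 2 \<le> a" by linarith
        then have "(y / 2) * (y / 2) \<le> a * (real p)" using y by (intro mult_mono) auto
        also have "\<dots> \<le> (s + 1) * p" by (intro mult_right_mono) (simp_all add: s_def)
        finally show ?thesis unfolding Gy by (simp add: power2_eq_square)
      next
        case 2
        then have "y < s" using up by (simp add: y_def s_def algebra_simps)
        then have "y * y \<le> s * (2 * p)" using y by (intro mult_mono) auto
        also have "\<dots> \<le> 4 * ((s + 1) * p)" using s0 by (simp add: algebra_simps)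
        finally show ?thesis unfolding Gy by (simp add: power2_eq_square)
      next
        case 3
        define x where "x = 2 * real p - real (a * N) - real (b * N) - real (c * N)"
        have x: "0 \<le> x" "y - s \<le> x"
        proof -
          show "0 \<le> x" using 3(2) unfolding x_def by linarith
          show "y - s \<le> x" using up by (simp add: x_def y_def s_def algebra_simps)
        qed
        have lx: "x\<^sup>2 / 4 - p \<le> ?l"
          unfolding x_def by (rule box_length_lower_total[OF p]) (use abc le 3 in auto)
        have "y\<^sup>2 - 2 * s * y \<le> x\<^sup>2"
        proof (cases "s \<le> y")
          case True
          then have "(y - s)\<^sup>2 \<le> x\<^sup>2" using x by (intro power_mono) auto
          moreover have "0 \<le> s\<^sup>2" by simp
          moreover have "(y - s)\<^sup>2 = y\<^sup>2 - 2 * s * y + s\<^sup>2" by (simp add: power2_eq_square algebra_simps)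
          ultimately show ?thesis by linarith
        next
          case False
          then have "y * y \<le> s * y" using y by (intro mult_right_mono) auto
          moreover have "0 \<le> x * x" "0 \<le> s * y" "2 * s * y = s * y + s * y" using s0 y by simp_all
          ultimately show ?thesis unfolding power2_eq_square by linarith
        qed
        moreover have "s * y \<le> s * (2 * p)" using s0 y by (intro mult_left_mono) auto
        ultimately show ?thesis using lx unfolding Gy by (simp add: algebra_simps)
      qed
    qed
  qed
  then show ?thesis by (simp add: \<alpha>_def \<beta>_def \<gamma>_def s_def algebra_simps)
qed

section \<open>Limits along the powers of a prime and along the primes\<close>

lemma lines_power: "lines a b c ^ N = (lines (a * N) (b * N) (c * N) :: 'a::comm_ring_1 poly poly)"
  by (simp add: power_mult_distrib power_mult)

lemma ceiling_bounds:
  fixes t :: rat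
  assumes "0 \<le> t"
  shows "of_rat t * real q \<le> real (nat \<lceil>t * of_nat q\<rceil>)" "real (nat \<lceil>t * of_nat q\<rceil>) \<le> of_rat t * real q + 1"
proof -
  have "0 \<le> t * of_nat q" using assms by simp
  then have "0 \<le> \<lceil>t * of_nat q\<rceil>" by linarith
  then have n: "real (nat \<lceil>t * of_nat q\<rceil>) = of_rat (of_int \<lceil>t * of_nat q\<rceil>)" by simp
  have e: "of_rat t * real q = of_rat (t * of_nat q)" by (simp add: of_rat_mult)
  show "of_rat t * real q \<le> real (nat \<lceil>t * of_nat q\<rceil>)"
    unfolding n e of_rat_less_eq by (rule le_of_int_ceiling)
  have "of_int \<lceil>t * of_nat q\<rceil> \<le> t * of_nat q + 1" by linarith
  then have "(of_rat (of_int \<lceil>t * of_nat q\<rceil>) :: real) \<le> of_rat (t * of_nat q + 1)" by (simp only: of_rat_less_eq)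
  then show "real (nat \<lceil>t * of_nat q\<rceil>) \<le> of_rat t * real q + 1" unfolding n e by (simp add: of_rat_add)
qed

lemma F_signature_eq:
  assumes "Factorial_Ring.prime p"
  shows "F_signature p (lines a b c) t =
    lim (\<lambda>e. real (box_length p (p ^ e) (lines a b c ^ nat \<lceil>t * of_nat (p ^ e)\<rceil>)) / real p ^ (2 * e))"
proof -
  interpret prime_plane p by unfold_locales fact
  show ?thesis unfolding F_signature_def colength_colon by simp
qed

lemma F_signature_bounds:
  fixes t :: rat
  assumes p: "Factorial_Ring.prime p" and t: "0 \<le> t" and abc: "b \<le> a" "c \<le> a"
  defines "G \<equiv> limit_signature (of_rat t * a) (of_rat t * b) (of_rat t * c)"
  shows "G - (real a + real b + real c + 1) / real p \<le> F_signature p (lines a b c) t" "F_signature p (lines a b c) t \<le> G"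
proof -
  define N where "N e = nat \<lceil>t * of_nat (p ^ e)\<rceil>" for e
  define s where "s e = real (box_length p (p ^ e) (lines a b c ^ N e)) / real p ^ (2 * e)" for e
  have T: "0 \<le> (of_rat t :: real)" using t by simp
  have p1: "real p > 1" using prime_gt_1_nat[OF p] by simp
  have quot: "(G * x\<^sup>2 + x) / x\<^sup>2 = G + 1 / x" if "x > 0" for x
    using that by (simp add: add_divide_distrib power2_eq_square)
  have up: "s e \<le> G + 1 / real p ^ e" for e
  proof -
    have "real (box_length p (p ^ e) (lines a b c ^ N e)) \<le> G * (real (p ^ e))\<^sup>2 + real (p ^ e)"
      unfolding lines_power G_def N_def
      using box_length_upper_limit[OF p T ceiling_bounds(1)[OF t] abc, of "p ^ e"] by simp
    then have "s e \<le> (G * (real p ^ e)\<^sup>2 + real p ^ e) / real p ^ (2 * e)"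
      unfolding s_def using p1 by (intro divide_right_mono) auto
    also have "real p ^ (2 * e) = (real p ^ e)\<^sup>2" by (simp only: mult.commute[of 2] power_mult)
    also have "(G * (real p ^ e)\<^sup>2 + real p ^ e) / (real p ^ e)\<^sup>2 = G + 1 / real p ^ e"
      using quot[of "real p ^ e"] p1 by simp
    finally show ?thesis .
  qed
  have inc: "incseq s"
  proof (rule incseq_SucI)
    fix e
    \<comment> \<open>The ceiling of \<open>p * r\<close> is at most \<open>p\<close> times the
      ceiling of \<open>r\<close>, which is the comparison of exponents required by
      Frobenius.\<close>
    have "t * of_nat (p ^ Suc e) = of_nat p * (t * of_nat (p ^ e))" by (simp add: algebra_simps)
    also have "\<dots> \<le> of_nat p * of_int \<lceil>t * of_nat (p ^ e)\<rceil>" by (intro mult_left_mono le_of_int_ceiling) simp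
    finally have "\<lceil>t * of_nat (p ^ Suc e)\<rceil> \<le> int p * \<lceil>t * of_nat (p ^ e)\<rceil>" by (simp add: ceiling_le_iff)
    then have "nat \<lceil>t * of_nat (p ^ Suc e)\<rceil> \<le> nat (int p * \<lceil>t * of_nat (p ^ e)\<rceil>)" by (rule nat_mono)
    then have "N (Suc e) \<le> p * N e" unfolding N_def by (simp only: nat_mult_distrib[OF of_nat_0_le_iff] nat_int)
    then have "p\<^sup>2 * box_length p (p ^ e) (lines a b c ^ N e) \<le> box_length p (p ^ Suc e) (lines a b c ^ N (Suc e))"
      using box_length_frobenius[OF p, of "N (Suc e)" "N e" "p ^ e" a b c] by simp
    then have "(real p)\<^sup>2 * real (box_length p (p ^ e) (lines a b c ^ N e)) \<le>
        real (box_length p (p ^ Suc e) (lines a b c ^ N (Suc e)))"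
      by (metis of_nat_le_iff of_nat_mult of_nat_power)
    then have "(real p)\<^sup>2 * real (box_length p (p ^ e) (lines a b c ^ N e)) / real p ^ (2 * Suc e) \<le> s (Suc e)"
      unfolding s_def by (rule divide_right_mono) simp
    moreover have "(real p)\<^sup>2 * real (box_length p (p ^ e) (lines a b c ^ N e)) / real p ^ (2 * Suc e) = s e"
      using p1 by (simp add: s_def power2_eq_square)
    ultimately show "s e \<le> s (Suc e)" by simp
  qed
  have "s e \<le> G + 1" for e
  proof -
    have "1 / real p ^ e \<le> 1" using p1 by simp
    then show ?thesis using up[of e] by linarith
  qed
  \<comment> \<open>A bounded increasing sequence converges, so \<open>lim\<close> denotes its
    limit, and every term is a lower bound for it.\<close>
  then obtain L where L: "s \<longlonglongrightarrow> L" "\<And>e. s e \<le> L" using incseq_convergent[OF inc] by blast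
  have F: "F_signature p (lines a b c) t = L"
    unfolding F_signature_eq[OF p] using limI[OF L(1)] unfolding s_def N_def .
  have "(\<lambda>e. G + 1 / real p ^ e) \<longlonglongrightarrow> G + 0"
    using p1 by (intro tendsto_intros LIMSEQ_divide_realpow_zero)
  then have "L \<le> G + 0" using L(1) up by (intro LIMSEQ_le) auto
  then show "F_signature p (lines a b c) t \<le> G" by (simp add: F)
  \<comment> \<open>The level \<open>e = 1\<close> is where the lower count applies; by monotonicity
    it bounds the limit.\<close>
  have "G * (real p)\<^sup>2 - (real a + real b + real c + 1) * real p \<le> real (box_length p (p ^ 1) (lines a b c ^ N 1))"
    unfolding lines_power G_def N_def
    using box_length_lower_limit[OF p T ceiling_bounds[OF t] abc] by simp
  then have "(G * (real p)\<^sup>2 - (real a + real b + real c + 1) * real p) / real p ^ (2 * 1) \<le> s 1"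
    unfolding s_def by (rule divide_right_mono) simp
  moreover have "(G * (real p)\<^sup>2 - (real a + real b + real c + 1) * real p) / real p ^ (2 * 1) = G - (real a + real b + real c + 1) / real p"
    using p1 by (simp add: power2_eq_square field_simps)
  ultimately show "G - (real a + real b + real c + 1) / real p \<le> F_signature p (lines a b c) t"
    using L(2)[of 1] unfolding F by linarith
qed

lemma F_signature_swap:
  assumes "Factorial_Ring.prime p"
  shows "F_signature p (lines b a c) t = F_signature p (lines a b c) t"
  unfolding F_signature_eq[OF assms] lines_power box_length_swap[OF assms, where A = "b * _"] ..

lemma F_signature_shear:
  assumes "Factorial_Ring.prime p"
  shows "F_signature p (lines c b a) t = F_signature p (lines a b c) t"
  unfolding F_signature_eq[OF assms] lines_power box_length_shear[OF assms, where A = "c * _"] ..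

theorem F_signature_tendsto:
  fixes t :: rat
  assumes t: "0 \<le> t"
  shows "((\<lambda>p. F_signature p (lines a b c) t) \<longlongrightarrow>
      limit_signature (of_rat t * a) (of_rat t * b) (of_rat t * c))
    (inf at_top (principal {p :: nat. Factorial_Ring.prime p}))"
proof (rule tendsto_sandwich)
  define G where "G a b c = limit_signature (of_rat t * real a) (of_rat t * real b) (of_rat t * real c)" for a b c
  have sym: "G b a c = G a b c" "G c b a = G a b c" for a b c
    using t by (auto simp: G_def intro!: limit_signature_swap limit_signature_shear)
  have *: "G a b c - (real a + real b + real c + 1) / real p \<le> F_signature p (lines a b c) t \<and> F_signature p (lines a b c) t \<le> G a b c"
    if p: "Factorial_Ring.prime p" for p
  proof -
    \<comment> \<open>The swap and the shear permute the lines, so the largest exponent may be moved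
      to \<open>x\<close>.\<close>
    consider "b \<le> a" "c \<le> a" | "a \<le> b" "c \<le> b" | "a \<le> c" "b \<le> c" by linarith
    then show ?thesis
    proof cases
      case 1
      then show ?thesis using F_signature_bounds[OF p t 1] by (simp add: G_def add_ac)
    next
      case 2
      then show ?thesis using F_signature_bounds[OF p t 2]
        by (simp add: F_signature_swap[OF p, of a b] G_def[symmetric] sym(1)[of a b] add_ac)
    next
      case 3
      then show ?thesis using F_signature_bounds[OF p t 3(2,1)]
        by (simp add: F_signature_shear[OF p, of a b c] G_def[symmetric] sym(2)[of a b c] add_ac)
    qed
  qed
  show "\<forall>\<^sub>F p in inf at_top (principal {p. Factorial_Ring.prime p}).
      G a b c - (real a + real b + real c + 1) / real p \<le> F_signature p (lines a b c) t"
    unfolding eventually_inf_principal using * by (auto intro!: always_eventually)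
  show "\<forall>\<^sub>F p in inf at_top (principal {p. Factorial_Ring.prime p}).
      F_signature p (lines a b c) t \<le> limit_signature (of_rat t * a) (of_rat t * b) (of_rat t * c)"
    unfolding eventually_inf_principal using * by (auto intro!: always_eventually simp: G_def)
  have "(\<lambda>p. G a b c - (real a + real b + real c + 1) / real p) \<longlonglongrightarrow> G a b c - 0"
    by (intro tendsto_diff tendsto_const lim_const_over_n)
  then show "((\<lambda>p. G a b c - (real a + real b + real c + 1) / real p) \<longlongrightarrow>
      limit_signature (of_rat t * a) (of_rat t * b) (of_rat t * c)) (inf at_top (principal {p. Factorial_Ring.prime p}))"
    by (intro tendsto_mono[OF inf_le1]) (simp add: G_def)
qed simp

section \<open>Derivations and Jacobians on the function field\<close>

lemma fract_cases:
  fixes z :: "'a :: {factorial_ring_gcd,semiring_gcd_mult_normalize} fract"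
  obtains g h where "z = to_fract g / to_fract h" "h \<noteq> 0"
  using that[of "fst (quot_of_fract z)" "snd (quot_of_fract z)"]
  by (simp flip: Fract_conv_to_fract)

locale poly_derivation =
  fixes D :: "complex poly poly \<Rightarrow> complex poly poly"
  assumes D_add: "D (g + h) = D g + D h" and D_mult: "D (g * h) = D g * h + g * D h"
begin

text \<open>The derivative is defined through the reduced fraction. Differentiating
  \<open>g * h' = g' * h\<close> shows that the quotient rule gives the same value on any
  representation.\<close>

lemma fract_deriv_divide:
  assumes "h \<noteq> 0"
  shows "fract_deriv D (to_fract g / to_fract h) = to_fract (D g * h - g * D h) / to_fract (h\<^sup>2)"
proof -
  define u where "u = to_fract g / to_fract h"
  define g' h' where "g' = fst (quot_of_fract u)" and "h' = snd (quot_of_fract u)"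
  have h': "h' \<noteq> 0" by (simp add: h'_def)
  have "u = to_fract g' / to_fract h'" by (simp add: g'_def h'_def flip: Fract_conv_to_fract)
  then have "to_fract (g * h') = to_fract (g' * h)"
    using assms h' by (simp add: u_def field_simps)
  then have e: "g * h' = g' * h" by (simp only: to_fract_eq_iff)
  then have e': "D g * h' + g * D h' = D g' * h + g' * D h" using D_mult[of g h'] D_mult[of g' h] by simp
  have "(D g * h - g * D h) * h'\<^sup>2 = (D g * h' + g * D h') * (h * h') - (g * h') * (D h' * h) - (g * h') * (D h * h')"
    by (simp add: algebra_simps power2_eq_square)
  also have "\<dots> = (D g' * h' - g' * D h') * h\<^sup>2"
    unfolding e e' by (simp add: algebra_simps power2_eq_square)
  finally have "to_fract ((D g * h - g * D h) * h'\<^sup>2) = to_fract ((D g' * h' - g' * D h') * h\<^sup>2)" by simp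
  then have "to_fract (D g' * h' - g' * D h') / to_fract (h'\<^sup>2) = to_fract (D g * h - g * D h) / to_fract (h\<^sup>2)"
    using assms h' by (simp add: frac_eq_eq del: to_fract_diff) 
  moreover have "fract_deriv D u = to_fract (D g' * h' - g' * D h') / to_fract (h'\<^sup>2)"
    by (simp add: fract_deriv_def g'_def h'_def case_prod_unfold)
  ultimately show ?thesis by (simp add: u_def)
qed

lemma D_1: "D 1 = 0" using D_mult[of 1 1] by simp

lemma fract_deriv_to_fract: "fract_deriv D (to_fract g) = to_fract (D g)"
  using fract_deriv_divide[of 1 g] by (simp add: D_1)

lemma fract_deriv_add: "fract_deriv D (u + w) = fract_deriv D u + fract_deriv D w"
proof -
  obtain g h where u: "u = to_fract g / to_fract h" "h \<noteq> 0" by (rule fract_cases)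
  obtain g' h' where w: "w = to_fract g' / to_fract h'" "h' \<noteq> 0" by (rule fract_cases)
  have s: "u + w = to_fract (g * h' + g' * h) / to_fract (h * h')"
    using u w by (simp add: field_simps)
  have "fract_deriv D (u + w) =
     to_fract (D (g * h' + g' * h) * (h * h') - (g * h' + g' * h) * D (h * h')) / to_fract ((h * h')\<^sup>2)"
    unfolding s by (rule fract_deriv_divide) (use u w in simp)
  also have "\<dots> = to_fract (D g * h - g * D h) / to_fract (h\<^sup>2) + to_fract (D g' * h' - g' * D h') / to_fract (h'\<^sup>2)"
    using u(2) w(2) by (simp add: D_add D_mult) (simp add: field_simps power2_eq_square)
  finally show ?thesis by (simp only: u(1) w(1) fract_deriv_divide[OF u(2)] fract_deriv_divide[OF w(2)])
qed

lemma fract_deriv_mult: "fract_deriv D (u * w) = fract_deriv D u * w + u * fract_deriv D w"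
proof -
  obtain g h where u: "u = to_fract g / to_fract h" "h \<noteq> 0" by (rule fract_cases)
  obtain g' h' where w: "w = to_fract g' / to_fract h'" "h' \<noteq> 0" by (rule fract_cases)
  have s: "u * w = to_fract (g * g') / to_fract (h * h')"
    using u w by simp
  have "fract_deriv D (u * w) =
     to_fract (D (g * g') * (h * h') - (g * g') * D (h * h')) / to_fract ((h * h')\<^sup>2)"
    unfolding s by (rule fract_deriv_divide) (use u w in simp)
  also have "\<dots> = to_fract (D g * h - g * D h) / to_fract (h\<^sup>2) * (to_fract g' / to_fract h') +
      to_fract g / to_fract h * (to_fract (D g' * h' - g' * D h') / to_fract (h'\<^sup>2))"
    using u(2) w(2) by (simp add: D_mult) (simp add: field_simps power2_eq_square)
  finally show ?thesis by (simp only: u(1) w(1) fract_deriv_divide[OF u(2)] fract_deriv_divide[OF w(2)])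
qed

end

lemma coeff_map_pderiv: "Polynomial.coeff (map_poly pderiv g) n = pderiv (Polynomial.coeff g n)"
  by (simp add: coeff_map_poly)

lemma pderiv_sum: "pderiv (sum f A) = (\<Sum>a\<in>A. pderiv (f a))"
  for f :: "'b \<Rightarrow> 'a :: {comm_semiring_1,semiring_no_zero_divisors} poly"
  by (induction A rule: infinite_finite_induct) (simp_all add: pderiv_add)

interpretation dx: poly_derivation "map_poly pderiv"
proof
  fix g h :: "complex poly poly"
  show "map_poly pderiv (g + h) = map_poly pderiv g + map_poly pderiv h"
    by (simp add: poly_eq_iff coeff_map_pderiv pderiv_add)
  show "map_poly pderiv (g * h) = map_poly pderiv g * h + g * map_poly pderiv h"
    by (rule poly_eqI) (simp only: coeff_map_pderiv coeff_mult Polynomial.coeff_add pderiv_sum pderiv_mult sum.distrib,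
        simp only: add.commute mult.commute[of "pderiv _"])
qed

interpretation dy: poly_derivation pderiv
  by unfold_locales (simp_all add: pderiv_add pderiv_mult algebra_simps)

abbreviation cconst :: "complex \<Rightarrow> cfun" where
  "cconst c \<equiv> to_fract [:[:c:]:]"

lemma jac_add: "jacobian (g + g') h = jacobian g h + jacobian g' h"
  by (simp add: jacobian_def deriv_x_def deriv_y_def dx.fract_deriv_add dy.fract_deriv_add algebra_simps)

lemma jac_mult: "jacobian (g * g') h = g * jacobian g' h + g' * jacobian g h"
  by (simp add: jacobian_def deriv_x_def deriv_y_def dx.fract_deriv_mult dy.fract_deriv_mult algebra_simps)

lemma jac_sym: "jacobian h g = - jacobian g h"
  by (simp add: jacobian_def)

lemma jac_self: "jacobian g g = 0"
  by (simp add: jacobian_def)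

lemma jac_const: "jacobian (cconst c) h = 0"
  by (simp add: jacobian_def deriv_x_def deriv_y_def dx.fract_deriv_to_fract dy.fract_deriv_to_fract map_poly_pCons)

lemma jac_1: "jacobian 1 h = 0"
  using jac_const[of 1 h] by (simp flip: one_pCons)

lemma jac_0: "jacobian 0 h = 0"
  using jac_const[of 0 h] by simp

lemma jac_uminus: "jacobian (- g) h = - jacobian g h"
  using jac_add[of g "- g" h] by (simp add: jac_0 eq_neg_iff_add_eq_0 add.commute)

lemma jac_inverse:
  assumes "g \<noteq> 0"
  shows "jacobian (inverse g) h = - jacobian g h * (inverse g)\<^sup>2"
proof -
  have "g * jacobian (inverse g) h + inverse g * jacobian g h = 0"
    using jac_mult[of g "inverse g" h] assms by (simp add: jac_1)
  then show ?thesis using assms by (simp add: field_simps power2_eq_square eq_neg_iff_add_eq_0)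
qed

definition poly_jac :: "complex poly poly \<Rightarrow> complex poly poly \<Rightarrow> complex poly poly" where
  "poly_jac g h = map_poly pderiv g * pderiv h - pderiv g * map_poly pderiv h"

lemma jac_to_fract: "jacobian (to_fract g) (to_fract h) = to_fract (poly_jac g h)"
  by (simp add: jacobian_def deriv_x_def deriv_y_def dx.fract_deriv_to_fract dy.fract_deriv_to_fract poly_jac_def)

lemma jac_xy: "jacobian (to_fract var_x) (to_fract var_y) = 1"
  by (simp add: jac_to_fract poly_jac_def var_x_def var_y_def map_poly_pCons pderiv_pCons flip: one_pCons)

section \<open>Discrete valuations\<close>

text \<open>The lower bound on the value is extended to 0, whose own value under \<open>v\<close> is
  arbitrary; this makes the bounded elements closed under addition without exceptions.\<close>

definition vge :: "(cfun \<Rightarrow> int) \<Rightarrow> int \<Rightarrow> cfun \<Rightarrow> bool" where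
  "vge v n z \<longleftrightarrow> z = 0 \<or> n \<le> v z"

locale valuation =
  fixes v :: "cfun \<Rightarrow> int"
  assumes valuation: "discrete_valuation v"
begin

lemma v_mult: "g \<noteq> 0 \<Longrightarrow> h \<noteq> 0 \<Longrightarrow> v (g * h) = v g + v h"
  using valuation by (simp add: discrete_valuation_def)

lemma v_add: "g \<noteq> 0 \<Longrightarrow> h \<noteq> 0 \<Longrightarrow> g + h \<noteq> 0 \<Longrightarrow> min (v g) (v h) \<le> v (g + h)"
  using valuation by (simp add: discrete_valuation_def)

lemma v_1: "v 1 = 0"
  using v_mult[of 1 1] by simp

lemma v_uminus: "g \<noteq> 0 \<Longrightarrow> v (- g) = v g"
  using v_mult[of "- 1" "- 1"] v_mult[of "- 1" g] v_1 by simp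

lemma v_inverse: "g \<noteq> 0 \<Longrightarrow> v (inverse g) = - v g"
  using v_mult[of g "inverse g"] v_1 by simp

lemma v_divide: "g \<noteq> 0 \<Longrightarrow> h \<noteq> 0 \<Longrightarrow> v (g / h) = v g - v h"
  using v_mult[of g "inverse h"] v_inverse[of h] by (simp add: divide_inverse)

lemma v_power: "g \<noteq> 0 \<Longrightarrow> v (g ^ n) = int n * v g"
  by (induction n) (simp_all add: v_1 v_mult algebra_simps)

lemma v_powi: "g \<noteq> 0 \<Longrightarrow> v (g powi n) = n * v g"
  by (cases "n \<ge> 0") (simp_all add: power_int_def v_power v_inverse power_inverse)

lemma uniformizer: obtains \<pi> where "\<pi> \<noteq> 0" "v \<pi> = 1"
proof -
  have "1 \<in> v ` (- {0})" using valuation by (simp add: discrete_valuation_def)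
  then obtain \<pi> where "\<pi> \<in> - {0}" "v \<pi> = 1" by (metis imageE)
  then show ?thesis using that[of \<pi>] by simp
qed

lemma vge_0 [simp]: "vge v n 0"
  by (simp add: vge_def)

lemma vge_add: "vge v n g \<Longrightarrow> vge v n h \<Longrightarrow> vge v n (g + h)"
  using v_add[of g h] by (cases "g = 0"; cases "h = 0"; cases "g + h = 0") (simp_all add: vge_def)

lemma vge_mult: "vge v m g \<Longrightarrow> vge v n h \<Longrightarrow> vge v (m + n) (g * h)"
  using v_mult[of g h] by (cases "g = 0"; cases "h = 0") (simp_all add: vge_def)

lemma vge_uminus: "vge v n g \<Longrightarrow> vge v n (- g)"
  using v_uminus[of g] by (cases "g = 0") (simp_all add: vge_def)

lemma vge_mono: "vge v n g \<Longrightarrow> m \<le> n \<Longrightarrow> vge v m g"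
  by (auto simp: vge_def)

lemma valuation_ring_vge: "z \<in> valuation_ring v \<longleftrightarrow> vge v 0 z"
  by (auto simp: valuation_ring_def vge_def)

text \<open>
  \<open>log_bounded c g h\<close> says that \<open>dg/g \<and> dh/h\<close>, written as a multiple of \<open>dx \<and> dy\<close>, has order at
  least \<open>-c\<close>; since \<open>dg/g\<close> is additive in \<open>g\<close>, this only has to be tested on generators of the
  multiplicative group.
\<close>

definition log_bounded :: "int \<Rightarrow> cfun \<Rightarrow> cfun \<Rightarrow> bool" where
  "log_bounded c g h \<longleftrightarrow> vge v (v g + v h - c) (jacobian g h)"

lemma log_bounded_sym: "log_bounded c g h \<Longrightarrow> log_bounded c h g"
  unfolding log_bounded_def by (subst jac_sym) (simp add: vge_uminus add.commute)

lemma log_bounded_mult: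
  assumes "g \<noteq> 0" "g' \<noteq> 0" "log_bounded c g h" "log_bounded c g' h"
  shows "log_bounded c (g * g') h"
proof -
  have "vge v (v g + (v g' + v h - c)) (g * jacobian g' h)"
    using assms by (intro vge_mult) (auto simp: log_bounded_def vge_def)
  moreover have "vge v (v g' + (v g + v h - c)) (g' * jacobian g h)"
    using assms by (intro vge_mult) (auto simp: log_bounded_def vge_def)
  ultimately show ?thesis
    using assms by (auto simp: log_bounded_def jac_mult v_mult algebra_simps intro!: vge_add)
qed

lemma log_bounded_inverse:
  assumes "g \<noteq> 0" "log_bounded c g h"
  shows "log_bounded c (inverse g) h"
proof -
  have "vge v ((v g + v h - c) + - 2 * v g) (- jacobian g h * (inverse g)\<^sup>2)"
    using assms by (intro vge_mult vge_uminus) (auto simp: log_bounded_def vge_def v_power v_inverse)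
  then show ?thesis using assms by (simp add: log_bounded_def jac_inverse v_inverse algebra_simps)
qed

lemma log_bounded_1: "log_bounded c 1 h"
  by (simp add: log_bounded_def jac_1)

lemma log_bounded_power: "g \<noteq> 0 \<Longrightarrow> log_bounded c g h \<Longrightarrow> log_bounded c (g ^ n) h"
  by (induction n) (simp_all add: log_bounded_1 log_bounded_mult)

lemma log_bounded_powi: "g \<noteq> 0 \<Longrightarrow> log_bounded c g h \<Longrightarrow> log_bounded c (g powi n) h"
  by (auto simp: power_int_def log_bounded_power log_bounded_inverse power_inverse)

end

section \<open>Jacobians on the valuation ring and log discrepancies\<close>

lemma cfun_field_simps [simp]:
  "carrier cfun_field = UNIV" "g \<otimes>\<^bsub>cfun_field\<^esub> h = g * h" "g \<oplus>\<^bsub>cfun_field\<^esub> h = g + h"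
  "\<one>\<^bsub>cfun_field\<^esub> = 1" "\<zero>\<^bsub>cfun_field\<^esub> = 0"
  by (simp_all add: ring_of_type_algebra_def)

lemma cfun_uminus [simp]: "\<ominus>\<^bsub>cfun_field\<^esub> h = - h"
proof -
  interpret cring cfun_field by (rule cring_from_type_algebra)
  show ?thesis by (rule minus_equality) simp_all
qed

lemma generate_ring_induct [consumes 1, case_names one incl uminus add mult]:
  assumes "z \<in> generate_ring cfun_field H" "Q 1" "\<And>h. h \<in> H \<Longrightarrow> Q h"
    "\<And>g. Q g \<Longrightarrow> Q (- g)" "\<And>g h. Q g \<Longrightarrow> Q h \<Longrightarrow> Q (g + h)" "\<And>g h. Q g \<Longrightarrow> Q h \<Longrightarrow> Q (g * h)"
  shows "Q z"
  using assms(1) by (induction rule: generate_ring.induct) (simp_all add: assms)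

lemma generate_ring_closed:
  "1 \<in> generate_ring cfun_field H" "h \<in> H \<Longrightarrow> h \<in> generate_ring cfun_field H"
  "g \<in> generate_ring cfun_field H \<Longrightarrow> - g \<in> generate_ring cfun_field H"
  "g \<in> generate_ring cfun_field H \<Longrightarrow> h \<in> generate_ring cfun_field H \<Longrightarrow> g + h \<in> generate_ring cfun_field H"
  "g \<in> generate_ring cfun_field H \<Longrightarrow> h \<in> generate_ring cfun_field H \<Longrightarrow> g * h \<in> generate_ring cfun_field H"
  using generate_ring.one[of cfun_field H] generate_ring.incl[of h H cfun_field]
    generate_ring.a_inv[of g cfun_field H] generate_ring.eng_add[of g cfun_field H h]
    generate_ring.eng_mult[of g cfun_field H h] by simp_all

context valuation
begin


text \<open>By the Leibniz rule the elements of nonnegative value whose Jacobian with a fixed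
  \<open>h\<close> is bounded form a ring.\<close>

lemma jacobian_bound_generators:
  assumes k: "\<And>g. g \<in> H \<Longrightarrow> vge v 0 g" "\<And>g. g \<in> H \<Longrightarrow> vge v (- k) (jacobian g h)"
    and z: "z \<in> generate_ring cfun_field H"
  shows "vge v 0 z \<and> vge v (- k) (jacobian z h)"
  using z
proof (induction rule: generate_ring_induct)
  case one then show ?case by (simp add: jac_1 vge_def v_1)
next
  case (incl g) then show ?case using k by simp
next
  case (uminus g) then show ?case by (simp add: jac_uminus vge_uminus)
next
  case (add g g') then show ?case by (simp add: jac_add vge_add)
next
  case (mult g g')
  have "vge v (0 + 0) (g * g')" "vge v (0 + - k) (g * jacobian g' h)" "vge v (0 + - k) (g' * jacobian g h)"
    using mult by (blast intro: vge_mult)+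
  then show ?case by (simp add: jac_mult vge_add)
qed

lemma jacobian_bound_quotient:
  assumes "vge v 0 g" "vge v 0 (inverse h)" "vge v (- k) (jacobian g w)" "vge v (- k) (jacobian h w)" "h \<noteq> 0"
  shows "vge v (- k) (jacobian (g / h) w)"
proof -
  have "vge v (0 + 0) (inverse h * inverse h)" by (intro vge_mult assms)
  then have "vge v (- k + 0) (- jacobian h w * (inverse h)\<^sup>2)"
    using assms by (intro vge_mult vge_uminus) (simp_all add: power2_eq_square)
  then have "vge v (0 + - k) (g * jacobian (inverse h) w)"
    using assms by (intro vge_mult) (simp_all add: jac_inverse)
  moreover have "vge v (0 + - k) (inverse h * jacobian g w)" by (intro vge_mult assms)
  ultimately show ?thesis by (simp add: divide_inverse jac_mult vge_add)
qed

text \<open>A bound on the generators of the chart passes to the chart and then to its localization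
  at \<open>P\<close>, one argument of the Jacobian at a time; the denominators are units of the
  valuation ring.\<close>

lemma jacobian_bound:
  assumes B: "B = generate_ring cfun_field H"
    and ord: "valuation_ring v = {g / h | g h. g \<in> B \<and> h \<in> B - P}" and P: "0 \<in> P" "1 \<notin> P"
    and k: "\<And>g h. g \<in> H \<Longrightarrow> h \<in> H \<Longrightarrow> vge v (- k) (jacobian g h)"
    and gh: "vge v 0 g" "vge v 0 h"
  shows "vge v (- k) (jacobian g h)"
proof -
  have O: "vge v 0 z \<longleftrightarrow> (\<exists>g h. z = g / h \<and> g \<in> B \<and> h \<in> B - P)" for z
    using ord unfolding valuation_ring_vge[symmetric] by auto
  have 1: "1 \<in> B" by (simp add: B generate_ring_closed)
  have gen: "vge v 0 z" if "z \<in> B" for z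
    unfolding O using that 1 P by (intro exI[of _ z] exI[of _ 1]) simp
  have H: "vge v 0 z" if "z \<in> H" for z
    using gen that by (simp add: B generate_ring_closed)
  have unit: "vge v 0 (inverse z)" if "z \<in> B - P" for z
    unfolding O using that 1 by (intro exI[of _ 1] exI[of _ z]) (simp add: divide_inverse)
  have 2: "vge v (- k) (jacobian z w)" if "z \<in> B" "w \<in> H" for z w
    using jacobian_bound_generators[of H k w z] k H that by (simp add: B)
  have 3: "vge v (- k) (jacobian w z)" if "z \<in> B" "w \<in> H" for z w
    using 2[OF that] vge_uminus by (subst jac_sym) simp
  have 4: "vge v (- k) (jacobian z w)" if "z \<in> B" "w \<in> B" for z w
    using jacobian_bound_generators[of H k w z] 3 H that by (simp add: B)
  have 5: "vge v (- k) (jacobian z w)" if z: "vge v 0 z" "w \<in> B" for z w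
  proof -
    obtain a b where ab: "z = a / b" "a \<in> B" "b \<in> B - P" using z O by blast
    then have "b \<noteq> 0" using P by auto
    then show ?thesis unfolding ab(1)
      by (intro jacobian_bound_quotient gen unit 4) (use ab z in auto)
  qed
  have 6: "vge v (- k) (jacobian w z)" if "vge v 0 z" "w \<in> B" for z w
    using 5[OF that] vge_uminus by (subst jac_sym) simp
  obtain a b where ab: "g = a / b" "a \<in> B" "b \<in> B - P" using gh(1) O by blast
  then have "b \<noteq> 0" using P by auto
  then show ?thesis unfolding ab(1)
    using jacobian_bound_quotient[OF gen[OF ab(2)] unit[OF ab(3)] 6[OF gh(2) ab(2)] 6[OF gh(2)]] ab(3) by blast
qed

end

locale divisorial = valuation +
  assumes divisorial: "divisorial_valuation v"
begin

text \<open>The log discrepancy of \<open>v\<close> over the plane without boundary.\<close>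

definition A :: int where
  "A = 1 + relative_canonical_order v"

lemma model:
  obtains B P H where "B = generate_ring cfun_field (range cconst \<union> H)" "finite H"
    "to_fract var_x \<in> B" "to_fract var_y \<in> B"
    "valuation_ring v = {g / h | g h. g \<in> B \<and> h \<in> B - P}" "0 \<in> P" "1 \<notin> P"
proof -
  obtain B P where BP: "normal_affine_model B" "height_one_prime B P" "order_of_vanishing B P v"
    using divisorial by (auto simp: divisorial_valuation_def)
  obtain H where H: "finite H" "B = generate_ring cfun_field (range cconst \<union> H)"
    using BP(1) by (auto simp: normal_affine_model_def)
  interpret P: primeideal P "cfun_field\<lparr>carrier := B\<rparr>" using BP(2) by (simp add: height_one_prime_def)
  have "0 \<in> P" using additive_subgroup.zero_closed[OF P.additive_subgroup_axioms] by simp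
  moreover have "1 \<notin> P" using P.one_imp_carrier P.I_notcarr by auto
  ultimately show ?thesis
    using that[OF H(2,1)] BP(1,3) by (auto simp: normal_affine_model_def order_of_vanishing_def)
qed

lemma v_poly: "vge v 0 (to_fract g)"
proof -
  obtain B P H where B: "B = generate_ring cfun_field (range cconst \<union> H)" "finite H"
    "to_fract var_x \<in> B" "to_fract var_y \<in> B"
    "valuation_ring v = {g / h | g h. g \<in> B \<and> h \<in> B - P}" "0 \<in> P" "1 \<notin> P" by (rule model)
  have 1: "1 \<in> B" by (simp add: B(1) generate_ring_closed)
  have 2: "cconst c \<in> B" for c by (simp add: B(1) generate_ring_closed)
  have 3: "g + h \<in> B" "g * h \<in> B" if "g \<in> B" "h \<in> B" for g h
    using that generate_ring_closed(4,5) unfolding B(1) by auto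
  have "to_fract g \<in> B"
    by (induction g rule: poly2_induct) (simp_all only: B(3,4) 2 3 to_fract_add to_fract_mult)
  then show ?thesis
    unfolding valuation_ring_vge[symmetric] B(5) using 1 B(7)
    by (intro CollectI exI[of _ "to_fract g"] exI[of _ 1]) simp
qed

lemma v_poly_nonneg: "g \<noteq> 0 \<Longrightarrow> 0 \<le> v (to_fract g)"
  using v_poly[of g] by (simp add: vge_def)

text \<open>The supremum of a set of integers is meaningful only when the set is bounded. The
  finitely many generators other than constants supply a bound, since a constant has zero Jacobian
  with everything.\<close>

lemma canonical_bound:
  assumes "vge v 0 g" "vge v 0 h"
  shows "vge v (- relative_canonical_order v) (jacobian g h)"
proof -
  let ?J = "{- v (jacobian g h) | g h.
     g \<in> valuation_ring v \<and> h \<in> valuation_ring v \<and> jacobian g h \<noteq> 0}"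
  obtain B P H where B: "B = generate_ring cfun_field (range cconst \<union> H)" "finite H"
    "to_fract var_x \<in> B" "to_fract var_y \<in> B"
    "valuation_ring v = {g / h | g h. g \<in> B \<and> h \<in> B - P}" "0 \<in> P" "1 \<notin> P" by (rule model)
  define k where "k = Max (insert 0 ((\<lambda>(g, h). - v (jacobian g h)) ` (H \<times> H)))"
  have fin: "finite (insert 0 ((\<lambda>(g, h). - v (jacobian g h)) ` (H \<times> H)))" using B(2) by simp
  have gen: "vge v (- k) (jacobian g h)" if gh: "g \<in> range cconst \<union> H" "h \<in> range cconst \<union> H" for g h
  proof (cases "g \<in> range cconst \<or> h \<in> range cconst")
    case True
    then have "jacobian g h = 0" using jac_const jac_sym[of h g] by auto
    then show ?thesis by simp
  next
    case False
    then have "- v (jacobian g h) \<le> k"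
      unfolding k_def by (intro Max_ge[OF fin]) (use gh in auto)
    then show ?thesis by (auto simp: vge_def)
  qed
  have "- v (jacobian g h) \<le> k" if "vge v 0 g" "vge v 0 h" "jacobian g h \<noteq> 0" for g h
    using jacobian_bound[OF B(1,5,6,7) gen that(1,2)] that(3) by (auto simp: vge_def)
  then have "bdd_above ?J" by (intro bdd_aboveI[of _ k]) (auto simp: valuation_ring_vge)
  then have "- v (jacobian g h) \<le> relative_canonical_order v" if "jacobian g h \<noteq> 0"
    unfolding relative_canonical_order_def
    by (rule cSup_upper[rotated]) (use that assms in \<open>auto simp: valuation_ring_vge\<close>)
  then show ?thesis by (cases "jacobian g h = 0") (simp_all add: vge_def)
qed

text \<open>Every nonzero function is a unit times a power of a uniformizer, and logarithmic
  differentials turn products into sums. For two units, or a unit and \<open>\<pi>\<close>, the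
  canonical bound applies, the value 1 of \<open>\<pi>\<close> matching the 1 in \<open>A\<close>;
  the pair of \<open>\<pi>\<close> with itself has Jacobian 0.\<close>

lemma A_log_bounded:
  assumes "g \<noteq> 0" "h \<noteq> 0"
  shows "log_bounded A g h"
proof -
  obtain \<pi> where \<pi>: "\<pi> \<noteq> 0" "v \<pi> = 1" by (rule uniformizer)
  have split: "z = (z * \<pi> powi (- v z)) * \<pi> powi (v z)" for z
    using \<pi> by (simp add: power_int_minus)
  have u: "v (z * \<pi> powi (- v z)) = 0" "z * \<pi> powi (- v z) \<noteq> 0" if "z \<noteq> 0" for z
    using that \<pi> by (simp_all add: v_mult v_powi)
  have uu: "log_bounded A z w" if "v z = 0" "v w = 0" for z w
    using canonical_bound[of z w] that vge_mono by (auto simp: log_bounded_def vge_def A_def)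
  have up: "log_bounded A z \<pi>" if "v z = 0" for z
    using canonical_bound[of z \<pi>] that \<pi> by (auto simp: log_bounded_def vge_def A_def)
  have pp: "log_bounded A \<pi> \<pi>" by (simp add: log_bounded_def jac_self)
  have gen: "log_bounded A z w"
    if "z \<noteq> 0" "log_bounded A \<pi> w" "\<And>u. v u = 0 \<Longrightarrow> log_bounded A u w" for z w
  proof -
    have "log_bounded A ((z * \<pi> powi (- v z)) * \<pi> powi (v z)) w"
      by (rule log_bounded_mult[OF u(2)[OF that(1)] _ that(3)[OF u(1)[OF that(1)]] log_bounded_powi[OF \<pi>(1) that(2)]])
        (use \<pi> in simp)
    then show ?thesis by (simp only: split[symmetric])
  qed
  have "log_bounded A z \<pi>" if "z \<noteq> 0" for z using gen[OF that pp up] .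
  moreover have "log_bounded A z w" if "z \<noteq> 0" "v w = 0" for z w
    using gen[OF that(1) log_bounded_sym[OF up[OF that(2)]] uu[OF _ that(2)]] .
  ultimately show ?thesis using gen[of g h] log_bounded_sym assms by blast
qed

lemma A_pos: "1 \<le> A"
proof -
  have "vge v 0 (to_fract var_x)" "vge v 0 (to_fract var_y)" by (rule v_poly)+
  from canonical_bound[OF this] show ?thesis by (simp add: jac_xy vge_def v_1 A_def)
qed

end

section \<open>Subadditive sequences\<close>

text \<open>Fekete's lemma, with \<open>\<epsilon>\<close> the infimum of the quotients
  \<open>e n / n\<close>. The third conclusion lets a linear lower bound for \<open>e\<close> pass
  to the slope.\<close>

lemma subadditive_slope:
  fixes e :: "nat \<Rightarrow> nat"
  assumes sub: "\<And>m n. e (m + n) \<le> e m + e n" and e0: "e 0 = 0"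
  obtains \<epsilon> :: real where "\<And>n. \<epsilon> * n \<le> e n" "\<And>\<delta>. \<delta> > 0 \<Longrightarrow> \<exists>K. \<forall>n. e n \<le> (\<epsilon> + \<delta>) * n + K"
    "\<And>c :: real. (\<And>n. c * n \<le> e n) \<Longrightarrow> c \<le> \<epsilon>"
proof -
  define E where "E = (\<lambda>n. real (e n) / real n) ` {1..}"
  have bdd: "bdd_below E" by (intro bdd_belowI[of _ 0]) (auto simp: E_def)
  have ne: "E \<noteq> {}" by (auto simp: E_def)
  have mult: "e (q * n) \<le> q * e n" for q n
  proof (induction q)
    case (Suc q)
    then show ?case using sub[of n "q * n"] by simp
  qed (simp add: e0)
  have low: "Inf E * n \<le> e n" for n
  proof (cases "n = 0")
    case False
    then have "Inf E \<le> e n / n" by (intro cInf_lower bdd) (auto simp: E_def)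
    then show ?thesis using False by (simp add: field_simps)
  qed (simp add: e0)
  have up: "\<exists>K. \<forall>n. e n \<le> (Inf E + \<delta>) * n + K" if \<delta>: "\<delta> > 0" for \<delta>
  proof -
    have "Inf E < Inf E + \<delta>" using \<delta> by simp
    then obtain z where z: "z \<in> E" "z < Inf E + \<delta>" using cInf_less_iff[OF ne bdd] by blast
    obtain N where N: "N \<ge> 1" "z = e N / N" using z(1) by (auto simp: E_def)
    have z0: "0 \<le> z" by (simp add: N)
    define K where "K = (\<Sum>r<N. real (e r))"
    have "e n \<le> (Inf E + \<delta>) * n + K" for n
    proof -
      \<comment> \<open>Division by a near-optimal \<open>N\<close>: the blocks of length
        \<open>N\<close> have slope below \<open>Inf E + \<delta>\<close>, and the remainders
        contribute a bounded amount.\<close>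
      have "e n \<le> (n div N) * e N + e (n mod N)"
        using sub[of "n div N * N" "n mod N"] mult[of "n div N" N] by simp
      then have "real (e n) \<le> real (n div N) * real (e N) + real (e (n mod N))"
        by (metis of_nat_add of_nat_le_iff of_nat_mult)
      also have "real (e N) = z * N" using N by simp
      also have "real (n div N) * (z * N) = z * real (n div N * N)" by simp
      also have "\<dots> \<le> z * n" by (intro mult_left_mono of_nat_mono z0) simp
      also have "z * n \<le> (Inf E + \<delta>) * n" using z by (intro mult_right_mono) simp_all
      also have "real (e (n mod N)) \<le> K"
        unfolding K_def using N by (intro member_le_sum) simp_all
      finally show ?thesis by simp
    qed
    then show ?thesis by blast
  qed
  show ?thesis
  proof (rule that)
    show "Inf E * n \<le> e n" for n by (rule low)
    show "\<exists>K. \<forall>n. e n \<le> (Inf E + \<delta>) * n + K" if "\<delta> > 0" for \<delta> by (rule up[OF that])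
    fix c :: real assume c: "\<And>n. c * n \<le> e n"
    show "c \<le> Inf E"
    proof (rule cInf_greatest[OF ne])
      fix z assume "z \<in> E"
      then obtain n where "n \<ge> 1" "z = e n / n" by (auto simp: E_def)
      then show "c \<le> z" using c[of n] by (simp add: pos_le_divide_eq)
    qed
  qed
qed

text \<open>Unfolding the recursion, \<open>l m\<close> adds \<open>e\<close> at \<open>m\<close>,
  \<open>m - w\<close>, \<open>m - 2 * w\<close> and so on: a Riemann sum of step \<open>w\<close>
  for a linear function of slope \<open>\<epsilon>\<close>, hence about
  \<open>\<epsilon> * m^2 / (2 * w)\<close>.\<close>

lemma quadratic_growth:
  fixes e l :: "nat \<Rightarrow> nat" and \<epsilon> :: real
  assumes w: "w \<ge> 1" and rec: "\<And>m. m > 0 \<Longrightarrow> l m = e m + l (m - w)" and l0: "l 0 = 0" and \<epsilon>: "0 \<le> \<epsilon>"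
    and low: "\<And>n. \<epsilon> * n \<le> e n" and up: "\<And>\<delta>. \<delta> > 0 \<Longrightarrow> \<exists>K. \<forall>n. e n \<le> (\<epsilon> + \<delta>) * n + K"
  shows "(\<lambda>m. l m / ((real m)\<^sup>2 / 2)) \<longlonglongrightarrow> \<epsilon> / w"
proof (rule order_tendstoI)
  have lower: "\<epsilon> * (real m)\<^sup>2 / (2 * w) \<le> l m" for m
  proof (induction m rule: less_induct)
    case (less m)
    show ?case
    proof (cases "m = 0")
      case False
      have "real w * (\<epsilon> * (real m)\<^sup>2) \<le> real w * (2 * w * l m)"
      proof (cases "m < w")
        case True
        then have "l m = e m" using rec[of m] l0 False by simp
        have "real m * m \<le> w * (2 * real m)" using True by (intro mult_mono) auto
        then have "\<epsilon> * (real m)\<^sup>2 \<le> \<epsilon> * (w * (2 * real m))" using \<epsilon> by (simp add: mult_left_mono power2_eq_square)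
        also have "\<dots> = 2 * w * (\<epsilon> * m)" by simp
        also have "\<dots> \<le> 2 * w * real (l m)" unfolding \<open>l m = e m\<close> using low[of m] by (intro mult_left_mono) auto
        finally show ?thesis by (intro mult_left_mono) auto
      next
        case F: False
        then have IH: "\<epsilon> * (real (m - w))\<^sup>2 / (2 * w) \<le> l (m - w)"
          by (intro less) (use False w in linarith)
        have "\<epsilon> * m + \<epsilon> * (real m - w)\<^sup>2 / (2 * w) \<le> l m"
          using rec[of m] False low[of m] IH F by (simp add: of_nat_diff)
        moreover have "\<epsilon> * m + \<epsilon> * (real m - w)\<^sup>2 / (2 * w) = (\<epsilon> * (real m)\<^sup>2 + \<epsilon> * (real w)\<^sup>2) / (2 * w)"
          using w by (simp add: field_simps power2_eq_square)
        ultimately have "(\<epsilon> * (real m)\<^sup>2 + \<epsilon> * (real w)\<^sup>2) / (2 * w) \<le> l m" by simp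
        then have "\<epsilon> * (real m)\<^sup>2 + \<epsilon> * (real w)\<^sup>2 \<le> 2 * w * real (l m)" using w by (simp add: field_simps)
        moreover have "0 \<le> \<epsilon> * (real w)\<^sup>2" using \<epsilon> by simp
        ultimately have "\<epsilon> * (real m)\<^sup>2 \<le> 2 * w * real (l m)" by linarith
        then show ?thesis by (intro mult_left_mono) auto
      qed
      then have "\<epsilon> * (real m)\<^sup>2 \<le> 2 * w * real (l m)" using w by simp
      then show ?thesis using w by (simp add: field_simps)
    qed (simp add: l0)
  qed
  fix c assume c: "c < \<epsilon> / w"
  have "c < l m / ((real m)\<^sup>2 / 2)" if "m \<ge> 1" for m
  proof -
    have "\<epsilon> / w = \<epsilon> * (real m)\<^sup>2 / (2 * w) / ((real m)\<^sup>2 / 2)" using that w by simp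
    also have "\<dots> \<le> l m / ((real m)\<^sup>2 / 2)" using lower[of m] by (intro divide_right_mono) auto
    finally show ?thesis using c by linarith
  qed
  then show "\<forall>\<^sub>F m in sequentially. c < l m / ((real m)\<^sup>2 / 2)"
    unfolding eventually_sequentially by blast
next
  fix c assume c: "\<epsilon> / w < c"
  define \<delta> where "\<delta> = (c * w - \<epsilon>) / 2"
  have \<delta>: "\<delta> > 0" using c w by (simp add: \<delta>_def field_simps)
  obtain K where K: "\<And>n. e n \<le> (\<epsilon> + \<delta>) * n + K" using up[OF \<delta>] by blast
  define s where "s = \<epsilon> + \<delta>"
  have s: "s > 0" using \<epsilon> \<delta> by (simp add: s_def)
  have K0: "0 \<le> K" using K[of 0] by (metis add_0 mult_zero_right of_nat_0 of_nat_0_le_iff order_trans)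
  \<comment> \<open>The shift by \<open>w\<close> absorbs the last, incomplete step of the
    recursion.\<close>
  have upper: "l m \<le> s * (real m + w)\<^sup>2 / (2 * w) + K * (real m + w) / w" for m
  proof (induction m rule: less_induct)
    case (less m)
    show ?case
    proof (cases "m = 0")
      case True then show ?thesis using s K0 w by (simp add: l0)
    next
      case False
      have "real (l (m - w)) \<le> s * (real m)\<^sup>2 / (2 * w) + K * m / w"
      proof (cases "m < w")
        case True
        then show ?thesis using l0 s K0 by simp
      next
        case F: False
        then show ?thesis using less[of "m - w"] False w by (simp add: of_nat_diff)
      qed
      then have "real (l m) \<le> s * m + K + (s * (real m)\<^sup>2 / (2 * w) + K * m / w)"
        using rec[of m] K[of m] False by (simp add: s_def)
      also have "\<dots> = (s * (2 * m * w + (real m)\<^sup>2)) / (2 * w) + K * (real m + w) / w"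
      proof -
        have "s * m = s * (2 * m * w) / (2 * w)" "K = K * w / w" using w by simp_all
        then show ?thesis by (simp add: distrib_left add_divide_distrib)
      qed
      also have "\<dots> \<le> (s * (real m + w)\<^sup>2) / (2 * w) + K * (real m + w) / w"
        using s by (intro add_right_mono divide_right_mono mult_left_mono) (simp_all add: power2_eq_square algebra_simps)
      finally show ?thesis by simp
    qed
  qed
  have lim: "(\<lambda>m. s / w * (1 + w * (1 / real m))\<^sup>2 + 2 * K / w * ((1 / real m) + w * (1 / real m)\<^sup>2)) \<longlonglongrightarrow>
      s / w * (1 + real w * 0)\<^sup>2 + 2 * K / w * (0 + real w * 0\<^sup>2)"
    by (intro tendsto_intros lim_1_over_n)
  have "s / w < c" using c w by (simp add: s_def \<delta>_def field_simps)
  then have "\<forall>\<^sub>F m in sequentially. s / w * (1 + w * (1 / real m))\<^sup>2 + 2 * K / w * ((1 / real m) + w * (1 / real m)\<^sup>2) < c"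
    by (intro order_tendstoD(2)[OF lim]) simp
  moreover have "\<forall>\<^sub>F m in sequentially. (1::nat) \<le> m" by (rule eventually_ge_at_top)
  ultimately show "\<forall>\<^sub>F m in sequentially. l m / ((real m)\<^sup>2 / 2) < c"
  proof eventually_elim
    case (elim m)
    have "l m / ((real m)\<^sup>2 / 2) \<le> (s * (real m + w)\<^sup>2 / (2 * w) + K * (real m + w) / w) / ((real m)\<^sup>2 / 2)"
      using upper[of m] by (intro divide_right_mono) auto
    also have "\<dots> = s / w * (1 + w * (1 / real m))\<^sup>2 + 2 * K / w * ((1 / real m) + w * (1 / real m)\<^sup>2)"
    proof -
      have "(s * (a + b)\<^sup>2 / (2 * b) + K * (a + b) / b) / (a\<^sup>2 / 2) =
          s / b * (1 + b * (1 / a))\<^sup>2 + 2 * K / b * ((1 / a) + b * (1 / a)\<^sup>2)" if "a > 0" "b > 0" for a b :: real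
      proof -
        have 1: "1 + b * (1 / a) = (a + b) / a" "(1 / a) + b * (1 / a)\<^sup>2 = (a + b) / a\<^sup>2"
          using that by (simp_all add: power2_eq_square add_divide_distrib)
        show ?thesis
          unfolding 1 add_divide_distrib[of "s * (a + b)\<^sup>2 / (2 * b)"]
          using that by (simp add: power_divide)
      qed
      then show ?thesis using elim(2) w by simp
    qed
    finally show ?case using elim(1) by linarith
  qed
qed

section \<open>Restriction to a line through the origin\<close>

text \<open>\<open>\<T>\<close> restricts to the line \<open>\<l> = 0\<close>, parametrized by
  \<open>\<l>'\<close>. The lifting conditions say that a polynomial agrees modulo
  \<open>\<l>\<close> with a polynomial in \<open>\<l>'\<close>; the derivative conditions say that
  the Jacobian with \<open>\<l>\<close>, a derivation tangent to the line, restricts to a nonzero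
  multiple of the derivative in the parameter.\<close>

locale coordinate_line =
  fixes \<l> \<l>' :: "complex poly poly" and \<T> :: "complex poly poly \<Rightarrow> complex poly" and \<kappa> :: complex
  assumes hom: "unital_hom \<T>" and T_const: "\<And>c. \<T> [:[:c:]:] = [:c:]"
    and T_line: "\<T> \<l> = 0" and T_param: "\<T> \<l>' = [:0, 1:]"
    and x_lift: "\<l> dvd var_x - poly (map_poly (\<lambda>c. [:[:c:]:]) (\<T> var_x)) \<l>'"
    and y_lift: "\<l> dvd var_y - poly (map_poly (\<lambda>c. [:[:c:]:]) (\<T> var_y)) \<l>'"
    and x_deriv: "pderiv (\<T> var_x) = Polynomial.smult \<kappa> (\<T> (poly_jac var_x \<l>))"
    and y_deriv: "pderiv (\<T> var_y) = Polynomial.smult \<kappa> (\<T> (poly_jac var_y \<l>))"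
    and x_origin: "poly (\<T> var_x) 0 = 0" and y_origin: "poly (\<T> var_y) 0 = 0"
    and line_nz: "\<l> \<noteq> 0" and \<kappa>_nz: "\<kappa> \<noteq> 0"
begin

definition lift :: "complex poly \<Rightarrow> complex poly poly" where
  "lift q = poly (map_poly (\<lambda>c. [:[:c:]:]) q) \<l>'"

lemma lift_hom: "unital_hom lift"
  unfolding lift_def
  by (rule unital_hom_comp[OF unital_hom_map_poly[OF unital_hom_const2] unital_hom_poly])

lemmas T_simps = unital_homD[OF hom] T_const T_line T_param
lemmas lift_simps = unital_homD[OF lift_hom]

lemma lift_const: "lift [:c:] = [:[:c:]:]"
  by (simp add: lift_def map_poly_pCons)

lemma lift_var: "lift [:0, 1:] = \<l>'"
  by (simp add: lift_def map_poly_pCons flip: one_pCons)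

lemma lift_T: "\<l> dvd g - lift (\<T> g)"
proof (induction g rule: poly2_induct)
  case (const c) then show ?case by (simp add: T_const lift_const)
next
  case x then show ?case using x_lift by (simp add: lift_def)
next
  case y then show ?case using y_lift by (simp add: lift_def)
next
  case (add g h)
  then show ?case using dvd_add[OF add] by (simp add: T_simps lift_simps algebra_simps)
next
  case (mult g h)
  then show ?case unfolding T_simps(4) lift_simps(4) by (rule cong_mult_ring)
qed

lemma T_origin: "poly (\<T> g) 0 = at_origin g"
  by (induction g rule: poly2_induct) (simp_all add: T_simps x_origin y_origin)

lemma at_origin_lift: "at_origin (lift q) = poly q 0"
proof -
  have "\<T> (lift q) = q"
  proof (induction q)
    case 0 then show ?case by (simp add: lift_simps T_simps)
  next
    case (pCons a q)
    have "pCons a q = [:a:] + [:0, 1:] * q" by simp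
    then have "lift (pCons a q) = [:[:a:]:] + \<l>' * lift q" by (simp only: lift_simps lift_const lift_var)
    then have "\<T> (lift (pCons a q)) = [:a:] + [:0, 1:] * \<T> (lift q)" by (simp only: T_simps)
    then show ?case by (simp add: pCons.IH)
  qed
  then show ?thesis using T_origin[of "lift q"] by simp
qed

text \<open>Both sides are derivations along \<open>\<T>\<close>, so agreement on constants and on
  the two variables suffices.\<close>

lemma T_deriv: "pderiv (\<T> g) = Polynomial.smult \<kappa> (\<T> (poly_jac g \<l>))"
proof (induction g rule: poly2_induct)
  case (const c) then show ?case by (simp add: T_simps poly_jac_def pderiv_pCons map_poly_pCons)
next
  case x show ?case by (rule x_deriv)
next
  case y show ?case by (rule y_deriv)
next
  case (add g h)
  have "poly_jac (g + h) \<l> = poly_jac g \<l> + poly_jac h \<l>"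
    by (simp add: poly_jac_def dx.D_add dy.D_add algebra_simps)
  then show ?case using add by (simp add: T_simps pderiv_add smult_add_right)
next
  case (mult g h)
  have "poly_jac (g * h) \<l> = poly_jac g \<l> * h + g * poly_jac h \<l>"
    unfolding poly_jac_def dx.D_mult dy.D_mult by (simp add: algebra_simps)
  then show ?case using mult by (simp add: T_simps pderiv_mult smult_add_right mult.commute add.commute)
qed

lemma at_origin_line: "at_origin \<l> = 0" "at_origin \<l>' = 0"
  using T_origin[of \<l>] T_origin[of \<l>'] by (simp_all add: T_simps)

lemma param_nz: "\<l>' \<noteq> 0"
  using T_param T_simps(1) by auto

lemma maximal_ideal:
  assumes "at_origin g = 0"
  obtains a b where "g = \<l> * a + \<l>' * b"
proof -
  obtain k where k: "g - lift (\<T> g) = \<l> * k" using lift_T by (auto simp: dvd_def)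
  have "poly (\<T> g) 0 = 0" using T_origin assms by simp
  then obtain q where "\<T> g = [:0, 1:] * q" using poly_eq_0_iff_dvd[of "\<T> g" 0] by (auto simp: dvd_def)
  then have "lift (\<T> g) = \<l>' * lift q" by (simp only: lift_simps lift_var)
  then show ?thesis using k that[of k "lift q"] by (simp add: algebra_simps)
qed

end

section \<open>The local ring at the origin\<close>

definition local_ring :: "cfun set" where
  "local_ring = {to_fract g / to_fract h | g h. at_origin h \<noteq> 0}"

lemma to_fract_power: "to_fract (g ^ n) = to_fract g ^ n"
  by (induction n) simp_all

lemma at_origin_nz: "at_origin h \<noteq> 0 \<Longrightarrow> h \<noteq> 0"
  by auto

lemma local_ringI: "at_origin h \<noteq> 0 \<Longrightarrow> to_fract g / to_fract h \<in> local_ring"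
  unfolding local_ring_def by blast

lemma local_ring_poly: "to_fract g \<in> local_ring"
  using local_ringI[of 1 g] by simp

interpretation local_ring: type_subring local_ring
proof
  show "1 \<in> local_ring" using local_ring_poly[of 1] by simp
  fix a b :: cfun
  show "- a \<in> local_ring" if "a \<in> local_ring"
  proof -
    obtain g h where "a = to_fract g / to_fract h" "at_origin h \<noteq> 0" using \<open>a \<in> local_ring\<close> by (auto simp: local_ring_def)
    then show ?thesis using local_ringI[of h "- g"] by simp
  qed
  assume "a \<in> local_ring" "b \<in> local_ring"
  then obtain g h g' h' where *: "a = to_fract g / to_fract h" "at_origin h \<noteq> 0"
    "b = to_fract g' / to_fract h'" "at_origin h' \<noteq> 0"
    by (auto simp: local_ring_def)
  have "h \<noteq> 0" "h' \<noteq> 0" using * by auto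
  then have "a + b = to_fract (g * h' + g' * h) / to_fract (h * h')" using * by (simp add: field_simps)
  then show "a + b \<in> local_ring" using local_ringI[of "h * h'" "g * h' + g' * h"] * by simp
  have "a * b = to_fract (g * g') / to_fract (h * h')" using * by simp
  then show "a * b \<in> local_ring" using local_ringI[of "h * h'" "g * g'"] * by simp
qed

lemma local_plane_simps:
  "carrier local_plane_C = local_ring" "g \<otimes>\<^bsub>local_plane_C\<^esub> h = g * h" "g \<oplus>\<^bsub>local_plane_C\<^esub> h = g + h"
  "\<one>\<^bsub>local_plane_C\<^esub> = 1" "\<zero>\<^bsub>local_plane_C\<^esub> = 0"
  by (simp_all add: local_plane_C_def local_ring_def)

lemma cring_local_plane: "cring local_plane_C"
proof (rule cringI)
  show "abelian_group local_plane_C"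
  proof (rule abelian_groupI)
    fix x assume "x \<in> carrier local_plane_C"
    then show "\<exists>y\<in>carrier local_plane_C. y \<oplus>\<^bsub>local_plane_C\<^esub> x = \<zero>\<^bsub>local_plane_C\<^esub>"
      by (intro bexI[of _ "- x"]) (simp_all add: local_plane_simps local_ring.uminus_closed)
  qed (simp_all add: local_plane_simps local_ring.add_closed local_ring.zero_closed)
  show "comm_monoid local_plane_C"
    by (rule comm_monoidI) (simp_all add: local_plane_simps local_ring.mult_closed local_ring.one_closed)
qed (simp add: local_plane_simps distrib_right)

lemma local_plane_minus: "b \<in> local_ring \<Longrightarrow> a \<ominus>\<^bsub>local_plane_C\<^esub> b = a - b"
proof -
  interpret cring local_plane_C by (rule cring_local_plane)
  assume b: "b \<in> local_ring"
  then have "\<ominus>\<^bsub>local_plane_C\<^esub> b = - b"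
    by (intro minus_equality) (simp_all add: local_plane_simps local_ring.uminus_closed)
  then show ?thesis by (simp add: a_minus_def local_plane_simps)
qed

definition origin_maximal :: "cfun set" where
  "origin_maximal = {to_fract g / to_fract h | g h. at_origin g = 0 \<and> at_origin h \<noteq> 0}"

lemma local_unit:
  assumes "z \<in> local_ring" "z \<notin> origin_maximal"
  shows "\<exists>s\<in>local_ring. s * z = 1"
proof -
  obtain g h where gh: "z = to_fract g / to_fract h" "at_origin h \<noteq> 0" using assms by (auto simp: local_ring_def)
  then have g: "at_origin g \<noteq> 0" using assms unfolding origin_maximal_def by blast
  show ?thesis
    by (rule bexI[OF _ local_ringI[OF g, of h]]) (use gh g in auto)
qed

locale centered = divisorial +
  assumes centered: "centered_at_origin v"
begin

lemma v_unit: "at_origin h \<noteq> 0 \<Longrightarrow> v (to_fract h) = 0"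
  using centered v_poly_nonneg[of h] unfolding centered_at_origin_def by (metis at_origin_nz less_le)

lemma v_pos: "h \<noteq> 0 \<Longrightarrow> at_origin h = 0 \<Longrightarrow> 0 < v (to_fract h)"
  using centered unfolding centered_at_origin_def by blast

lemma vge_local: "z \<in> local_ring \<Longrightarrow> vge v 0 z"
proof -
  assume "z \<in> local_ring"
  then obtain g h where gh: "z = to_fract g / to_fract h" "at_origin h \<noteq> 0" by (auto simp: local_ring_def)
  then have "h \<noteq> 0" by auto
  then show ?thesis
    using v_poly_nonneg[of g] v_unit[OF gh(2)] by (cases "g = 0") (simp_all add: gh(1) vge_def v_divide)
qed

lemma valuation_ideal_eq: "valuation_ideal v m = {z \<in> local_ring. vge v (int m) z}"
  by (auto simp: valuation_ideal_def local_plane_simps vge_def)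

lemma sub_ideal_valuation: "sub_ideal local_ring (valuation_ideal v m)"
  unfolding sub_ideal_def valuation_ideal_eq
proof (intro conjI ballI)
  fix a b assume "a \<in> {z \<in> local_ring. vge v (int m) z}" "b \<in> {z \<in> local_ring. vge v (int m) z}"
  then show "a + b \<in> {z \<in> local_ring. vge v (int m) z}"
    by (simp add: local_ring.add_closed vge_add)
next
  fix r a assume "r \<in> local_ring" "a \<in> {z \<in> local_ring. vge v (int m) z}"
  then show "r * a \<in> {z \<in> local_ring. vge v (int m) z}"
    using vge_mult[of 0 r "int m" a] vge_local by (simp add: local_ring.mult_closed)
qed (auto simp: local_ring.zero_closed)

lemma valuation_ideal_0: "valuation_ideal v 0 = local_ring"
  using vge_local by (auto simp: valuation_ideal_eq)

lemma ideal_valuation: "ideal (valuation_ideal v m) local_plane_C"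
proof -
  interpret cring local_plane_C by (rule cring_local_plane)
  note sI = sub_ideal_valuation[of m]
  show ?thesis
  proof (rule idealI[OF ring_axioms])
    show "subgroup (valuation_ideal v m) (add_monoid local_plane_C)"
    proof (rule add.subgroupI)
      show "valuation_ideal v m \<subseteq> carrier local_plane_C" using sI by (auto simp: sub_ideal_def local_plane_simps)
      show "valuation_ideal v m \<noteq> {}" using sub_idealD(2)[OF sI] by blast
      show "\<ominus>\<^bsub>local_plane_C\<^esub> a \<in> valuation_ideal v m" if "a \<in> valuation_ideal v m" for a
      proof -
        have "\<ominus>\<^bsub>local_plane_C\<^esub> a = 0 \<ominus>\<^bsub>local_plane_C\<^esub> a"
          using minus_eq[of 0 a] l_zero[of "\<ominus>\<^bsub>local_plane_C\<^esub> a"] a_inv_closed[of a] sub_idealD(1)[OF sI that]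
          by (simp add: local_plane_simps)
        also have "\<dots> = - a" using local_plane_minus sub_idealD(1)[OF sI that] by simp
        finally show ?thesis using local_ring.sub_ideal_uminus[OF sI that] by simp
      qed
      show "a \<oplus>\<^bsub>local_plane_C\<^esub> b \<in> valuation_ideal v m" if "a \<in> valuation_ideal v m" "b \<in> valuation_ideal v m" for a b
        using sub_idealD(3)[OF sI that] by (simp add: local_plane_simps)
    qed
    show "x \<otimes>\<^bsub>local_plane_C\<^esub> a \<in> valuation_ideal v m" "a \<otimes>\<^bsub>local_plane_C\<^esub> x \<in> valuation_ideal v m"
      if "a \<in> valuation_ideal v m" "x \<in> carrier local_plane_C" for a x
      using sub_idealD(4)[OF sI _ that(1), of x] that(2) by (simp_all add: local_plane_simps mult.commute)
  qed
qed

lemma colength_valuation: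
  assumes "ideal_tower local_ring origin_maximal (valuation_ideal v m) local_ring n"
  shows "colength local_plane_C (valuation_ideal v m) = real n"
proof (rule local_ring.colength_eq[where \<phi> = "\<lambda>z. z" and M = origin_maximal, OF ideal_valuation])
  have e: "{r \<in> local_ring. r \<in> valuation_ideal v m} = valuation_ideal v m"
    using sub_idealD(1)[OF sub_ideal_valuation] by blast
  show "ideal_tower local_ring origin_maximal {r \<in> local_ring. r \<in> valuation_ideal v m} local_ring n"
    unfolding e by (rule assms)
  show "sub_ideal local_ring {r \<in> local_ring. r \<in> valuation_ideal v m}"
    unfolding e by (rule sub_ideal_valuation)
  show "\<forall>r\<in>local_ring - origin_maximal. \<exists>s\<in>local_ring. s * r - 1 \<in> valuation_ideal v m"
  proof
    fix r assume "r \<in> local_ring - origin_maximal"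
    then obtain s where "s \<in> local_ring" "s * r = 1" using local_unit[of r] by blast
    then show "\<exists>s\<in>local_ring. s * r - 1 \<in> valuation_ideal v m"
      using sub_idealD(2)[OF sub_ideal_valuation] by (intro bexI[of _ s]) simp_all
  qed
  show "\<exists>r\<in>local_ring. z \<ominus>\<^bsub>local_plane_C\<^esub> r \<in> valuation_ideal v m" if "z \<in> carrier local_plane_C" for z
    using that sub_idealD(2)[OF sub_ideal_valuation]
    by (intro bexI[of _ z]) (simp_all add: local_plane_simps local_plane_minus)
qed (simp_all add: local_plane_simps)

end

locale centered_line = centered + coordinate_line
begin

abbreviation "x \<equiv> to_fract \<l>"
abbreviation "y \<equiv> to_fract \<l>'"

lemma v_x: "1 \<le> v x" and v_y: "1 \<le> v y"
  using v_pos[OF line_nz at_origin_line(1)] v_pos[OF param_nz at_origin_line(2)] by simp_all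

text \<open>
  Differentiating along the line lowers the value by at most \<open>A - v x\<close>, and after as many steps as
  the order of vanishing of the restriction one arrives at a unit.
\<close>

lemma v_le_order:
  assumes "\<T> g \<noteq> 0"
  shows "v (to_fract g) \<le> int (Polynomial.order 0 (\<T> g)) * (A - v x)"
  using assms
proof (induction "Polynomial.order 0 (\<T> g)" arbitrary: g)
  case 0
  then have "poly (\<T> g) 0 \<noteq> 0" by (simp add: order_root)
  then have "v (to_fract g) = 0" using v_unit by (simp add: T_origin)
  then show ?case using 0 by simp
next
  case (Suc n)
  let ?D = "poly_jac g \<l>"
  have root: "poly (\<T> g) 0 = 0" using Suc(2,3) by (metis order_root Zero_not_Suc)
  have "pderiv (\<T> g) \<noteq> 0"
  proof
    assume "pderiv (\<T> g) = 0"
    then obtain c where "\<T> g = [:c:]" using pderiv_iszero by blast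
    then show False using root Suc(3) by simp
  qed
  \<comment> \<open>In characteristic 0 differentiation lowers the order of a root by exactly
    one.\<close>
  then have "Suc n = Suc (Polynomial.order 0 (pderiv (\<T> g)))"
    using order_pderiv[of "\<T> g" 0] Suc(2,3) root by simp
  then have o: "n = Polynomial.order 0 (\<T> ?D)" "\<T> ?D \<noteq> 0"
    using \<open>pderiv (\<T> g) \<noteq> 0\<close> \<kappa>_nz by (auto simp: T_deriv order_smult)
  have "?D \<noteq> 0" "g \<noteq> 0" using o(2) Suc(3) T_simps(1) by auto
  then have "v (to_fract g) + v x - A \<le> v (to_fract ?D)"
    using A_log_bounded[of "to_fract g" x] line_nz by (simp add: log_bounded_def jac_to_fract vge_def)
  also have "\<dots> \<le> int n * (A - v x)" using Suc(1)[OF o] o(1) by simp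
  finally have "v (to_fract g) \<le> int n * (A - v x) + (A - v x)" by simp
  then show ?case unfolding Suc(2)[symmetric] by (simp add: algebra_simps)
qed

lemma v_xy: "v x + v y \<le> A"
proof -
  have "Polynomial.order 0 (\<T> \<l>') = 1"
    unfolding T_param using order_power_n_n[of "0::complex" 1] by simp
  then show ?thesis using v_le_order[of \<l>'] by (simp add: T_param)
qed

text \<open>The image of the \<open>n\<close>-th valuation ideal in the local ring of the line is
  generated by a power of the parameter, and \<open>ord n\<close> is its exponent.\<close>

definition ord :: "nat \<Rightarrow> nat" where
  "ord n = (LEAST k. \<exists>g. \<T> g \<noteq> 0 \<and> Polynomial.order 0 (\<T> g) = k \<and> int n \<le> v (to_fract g))"

lemma ord_le:
  assumes "\<T> g \<noteq> 0" "int n \<le> v (to_fract g)"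
  shows "ord n \<le> Polynomial.order 0 (\<T> g)"
  unfolding ord_def by (rule Least_le) (use assms in blast)

lemma T_param_power: "\<T> (\<l>' ^ k) = [:0, 1:] ^ k" "\<T> (\<l>' ^ k) \<noteq> 0" "Polynomial.order 0 (\<T> (\<l>' ^ k)) = k"
  using order_power_n_n[of "0::complex" k] by (simp_all add: T_simps)

lemma ord_le_param: "int n \<le> int k * v y \<Longrightarrow> ord n \<le> k"
  using ord_le[of "\<l>' ^ k" n] T_param_power[of k] param_nz by (simp add: to_fract_power v_power)

lemma ord_attained:
  obtains g where "\<T> g \<noteq> 0" "Polynomial.order 0 (\<T> g) = ord n" "int n \<le> v (to_fract g)"
proof -
  have "int n * 1 \<le> int n * v y" using v_y by (intro mult_left_mono) auto
  then have "int n \<le> v (to_fract (\<l>' ^ n))" using param_nz by (simp add: to_fract_power v_power)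
  then have "\<exists>k. \<exists>g. \<T> g \<noteq> 0 \<and> Polynomial.order 0 (\<T> g) = k \<and> int n \<le> v (to_fract g)"
    using T_param_power(2) by blast
  from LeastI_ex[OF this] show ?thesis using that unfolding ord_def by blast
qed

lemma ord_0: "ord 0 = 0"
  using ord_le_param[of 0 0] by simp

lemma ord_add: "ord (m + n) \<le> ord m + ord n"
proof -
  obtain g where g: "\<T> g \<noteq> 0" "Polynomial.order 0 (\<T> g) = ord m" "int m \<le> v (to_fract g)" by (rule ord_attained)
  obtain h where h: "\<T> h \<noteq> 0" "Polynomial.order 0 (\<T> h) = ord n" "int n \<le> v (to_fract h)" by (rule ord_attained)
  have nz: "g \<noteq> 0" "h \<noteq> 0" using g(1) h(1) T_simps(1) by auto
  have "int (m + n) \<le> v (to_fract (g * h))" using g h nz by (simp add: v_mult)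
  moreover have "\<T> (g * h) \<noteq> 0" using g h by (simp add: T_simps)
  moreover have "Polynomial.order 0 (\<T> (g * h)) = ord m + ord n" using g h by (simp add: T_simps order_mult)
  ultimately show ?thesis using ord_le[of "g * h" "m + n"] by simp
qed

lemma ord_ge: "int n \<le> int (ord n) * (A - v x)"
proof -
  obtain g where g: "\<T> g \<noteq> 0" "Polynomial.order 0 (\<T> g) = ord n" "int n \<le> v (to_fract g)" by (rule ord_attained)
  then show ?thesis using v_le_order[OF g(1)] by simp
qed

lemma x_local: "x \<in> local_ring" and y_local: "y \<in> local_ring"
  by (rule local_ring_poly)+

text \<open>Modulo \<open>x\<close> the local ring becomes the discrete valuation ring of the line,
  and the image of the valuation ideal is generated by \<open>y ^ ord m\<close>. The powers of
  \<open>y\<close> below that exponent are the steps.\<close>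

lemma tower_line:
  fixes m :: nat
  defines "J \<equiv> {i + x * k | i k. i \<in> valuation_ideal v m \<and> k \<in> local_ring}"
  shows "ideal_tower local_ring origin_maximal J local_ring (ord m)"
proof -
  note sI = sub_ideal_valuation[of m]
  have sJ: "sub_ideal local_ring J"
    unfolding J_def by (rule local_ring.sub_ideal_scaled[OF sI local_ring.sub_ideal_self x_local])
  have IJ: "i \<in> J" if "i \<in> valuation_ideal v m" for i
  proof -
    have "i = i + x * 0" by simp
    then show ?thesis unfolding J_def using that local_ring.zero_closed by blast
  qed
  have xJ: "x * k \<in> J" if "k \<in> local_ring" for k
  proof -
    have "x * k = 0 + x * k" by simp
    then show ?thesis unfolding J_def using that sub_idealD(2)[OF sI] by blast
  qed
  let ?K = "\<lambda>k. adjoin local_ring J (y ^ k)"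
  have sK: "sub_ideal local_ring (?K k)" for k
    by (rule local_ring.sub_ideal_adjoin[OF sJ local_ring.power_closed[OF y_local]])
  have yK: "y ^ k \<in> ?K k" for k by (rule local_ring.adjoin_mem[OF sJ])
  have JK: "J \<subseteq> ?K k" for k by (rule local_ring.adjoin_superset[OF sJ])
  have notin: "y ^ k \<notin> ?K (Suc k)" if k: "k < ord m" for k
  proof
    assume "y ^ k \<in> ?K (Suc k)"
    then obtain i r s where e: "y ^ k = (i + x * r) + s * y ^ Suc k"
      "i \<in> valuation_ideal v m" "r \<in> local_ring" "s \<in> local_ring"
      by (auto simp: adjoin_def J_def)
    obtain r1 q1 where r: "r = to_fract r1 / to_fract q1" "at_origin q1 \<noteq> 0" using e(3) by (auto simp: local_ring_def)
    obtain s1 q2 where s: "s = to_fract s1 / to_fract q2" "at_origin q2 \<noteq> 0" using e(4) by (auto simp: local_ring_def)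
    \<comment> \<open>Clearing denominators gives a relation between polynomials. On the line
      \<open>i1\<close> becomes the \<open>k\<close>-th power of the parameter times a unit, so its
      order \<open>k\<close> is below \<open>ord m\<close> although its value is at least
      \<open>m\<close>.\<close>
    define q where "q = q1 * q2"
    have q: "at_origin q \<noteq> 0" "q1 \<noteq> 0" "q2 \<noteq> 0" using r s by (auto simp: q_def)
    define i1 where "i1 = q * \<l>' ^ k - \<l> * (r1 * q2) - (s1 * q1) * \<l>' ^ Suc k"
    have i1: "to_fract i1 = to_fract q * i"
    proof -
      have "i = y ^ k - x * r - s * y ^ Suc k" using e(1) by (simp add: algebra_simps)
      then show ?thesis
        using q unfolding i1_def r s q_def by (simp add: field_simps to_fract_power)
    qed
    have T: "\<T> i1 = [:0, 1:] ^ k * (\<T> q - [:0, 1:] * \<T> (s1 * q1))"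
      unfolding i1_def by (simp add: T_simps algebra_simps)
    have nz: "poly (\<T> q - [:0, 1:] * \<T> (s1 * q1)) 0 \<noteq> 0" using q(1) by (simp add: T_origin)
    then have nz': "\<T> q - [:0, 1:] * \<T> (s1 * q1) \<noteq> 0" by auto
    have "\<T> i1 \<noteq> 0" unfolding T using nz' by simp
    moreover have "Polynomial.order 0 (\<T> i1) = k"
      unfolding T using nz nz' order_power_n_n[of "0::complex" k]
      by (subst order_mult) (simp_all add: order_0I del: poly_diff poly_mult)
    moreover have "int m \<le> v (to_fract i1)"
    proof -
      have i: "i \<noteq> 0" using i1 \<open>\<T> i1 \<noteq> 0\<close> T_simps(1) by auto
      then have "int m \<le> v i" using e(2) by (simp add: valuation_ideal_eq vge_def)
      then show ?thesis unfolding i1 using v_mult[of "to_fract q" i] i q(1) v_unit[OF q(1)] at_origin_nz[OF q(1)] by simp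
    qed
    ultimately show False using ord_le[of i1 m] k by simp
  qed
  have mult: "z * y ^ k \<in> ?K (Suc k)" if zm: "z \<in> origin_maximal" for z k
  proof -
    obtain g h where z: "z = to_fract g / to_fract h" "at_origin g = 0" "at_origin h \<noteq> 0"
      using zm by (auto simp: origin_maximal_def)
    obtain a b where ab: "g = \<l> * a + \<l>' * b" using maximal_ideal[OF z(2)] .
    have hn: "h \<noteq> 0" using z(3) by auto
    have "z * y ^ k = x * (to_fract a / to_fract h * y ^ k) + to_fract b / to_fract h * y ^ Suc k"
      using hn by (simp add: z(1) ab field_simps)
    moreover have "x * (to_fract a / to_fract h * y ^ k) \<in> J"
      by (intro xJ local_ring.mult_closed local_ringI z(3) local_ring.power_closed y_local)
    moreover have "to_fract b / to_fract h \<in> local_ring" by (intro local_ringI z(3))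
    ultimately show ?thesis unfolding adjoin_def by blast
  qed
  have tow: "ideal_tower local_ring origin_maximal (?K k) local_ring k" if "k \<le> ord m" for k
    using that
  proof (induction k)
    case 0
    have "?K 0 = local_ring"
      using local_ring.sub_ideal_self sub_idealD(4)[OF sK _ yK[of 0]] sub_idealD(1)[OF sK[of 0]] by auto
    then show ?case by (simp add: tower_refl)
  next
    case (Suc k)
    have sub: "?K (Suc k) \<subseteq> ?K k"
    proof (rule local_ring.adjoin_least[OF sK JK])
      show "y ^ Suc k \<in> ?K k" using sub_idealD(4)[OF sK y_local yK] by simp
    qed
    have "adjoin local_ring (?K (Suc k)) (y ^ k) = ?K k"
    proof
      show "adjoin local_ring (?K (Suc k)) (y ^ k) \<subseteq> ?K k"
        by (rule local_ring.adjoin_least[OF sK sub yK])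
      show "?K k \<subseteq> adjoin local_ring (?K (Suc k)) (y ^ k)"
        by (rule local_ring.adjoin_mono[OF JK])
    qed
    then show ?case
      using Suc notin[of k] mult local_ring.power_closed[OF y_local]
      by (intro tower_step[of "y ^ k"]) auto
  qed
  have "y ^ ord m \<in> J"
  proof -
    obtain g where g: "\<T> g \<noteq> 0" "Polynomial.order 0 (\<T> g) = ord m" "int m \<le> v (to_fract g)" by (rule ord_attained)
    \<comment> \<open>The restriction of an optimal \<open>g\<close> is the parameter to the power
      \<open>ord m\<close> times a unit \<open>u\<close>; lifting \<open>u\<close> expresses
      \<open>y ^ ord m\<close> through \<open>g\<close> modulo \<open>x\<close>.\<close>
    obtain u where u: "\<T> g = [:- 0, 1:] ^ ord m * u" "\<not> [:- 0, 1:] dvd u"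
      using order_decomp[OF g(1), of 0] g(2) by auto
    have u0: "at_origin (lift u) \<noteq> 0" using u(2) by (simp add: at_origin_lift poly_eq_0_iff_dvd)
    obtain k where k: "g - lift (\<T> g) = \<l> * k" using lift_T by (auto simp: dvd_def)
    have "lift (\<T> g) = \<l>' ^ ord m * lift u" using u(1) by (simp add: lift_simps lift_var)
    then have "\<l>' ^ ord m * lift u = g - \<l> * k" using k by (simp add: algebra_simps)
    then have "y ^ ord m * to_fract (lift u) = to_fract g - x * to_fract k"
      by (simp flip: to_fract_power to_fract_mult to_fract_diff)
    then have "y ^ ord m = (1 / to_fract (lift u)) * to_fract g + x * (- (to_fract k / to_fract (lift u)))"
      using at_origin_nz[OF u0] by (simp add: field_simps)
    moreover have "1 / to_fract (lift u) \<in> local_ring" using local_ringI[OF u0, of 1] by simp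
    then have "(1 / to_fract (lift u)) * to_fract g \<in> valuation_ideal v m"
      by (rule sub_idealD(4)[OF sI]) (use g(3) in \<open>simp add: valuation_ideal_eq vge_def local_ring_poly\<close>)
    moreover have "- (to_fract k / to_fract (lift u)) \<in> local_ring"
      by (intro local_ring.uminus_closed local_ringI u0)
    ultimately show ?thesis unfolding J_def by blast
  qed
  then have "?K (ord m) = J"
    using local_ring.adjoin_least[OF sJ order_refl] JK by blast
  then show ?thesis using tow[of "ord m"] by simp
qed

definition wx :: nat where "wx = nat (v x)"

lemma wx: "int wx = v x" "1 \<le> wx"
  using v_x by (simp_all add: wx_def)

text \<open>Slicing by powers of \<open>x\<close>: the colon of the \<open>m\<close>-th valuation
  ideal and \<open>x^i\<close> is the ideal of index \<open>m - i * wx\<close>. Truncated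
  subtraction and \<open>ord 0 = 0\<close> make the terms with \<open>m \<le> i * wx\<close>
  vanish.\<close>

definition len :: "nat \<Rightarrow> nat" where
  "len m = (\<Sum>i<m. ord (m - i * wx))"

lemma len_rec:
  assumes "m > 0"
  shows "len m = ord m + len (m - wx)"
proof -
  obtain k where k: "m = Suc k" using assms by (cases m) auto
  have "len m = ord m + (\<Sum>i<k. ord (m - wx - i * wx))"
    unfolding len_def k by (subst sum.lessThan_Suc_shift) (simp add: diff_diff_left del: diff_Suc_Suc)
  also have "(\<Sum>i<k. ord (m - wx - i * wx)) = (\<Sum>i<m - wx. ord (m - wx - i * wx))"
  proof (rule sum.mono_neutral_right)
    show "\<forall>i\<in>{..<k} - {..<m - wx}. ord (m - wx - i * wx) = 0"
    proof
      fix i assume "i \<in> {..<k} - {..<m - wx}"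
      then have "m - wx \<le> i" by simp
      also have "i \<le> i * wx" using wx(2) by simp
      finally show "ord (m - wx - i * wx) = 0" by (simp add: ord_0)
    qed
  qed (use wx(2) k in auto)
  finally show ?thesis by (simp add: len_def)
qed

text \<open>Multiplication by \<open>x\<close> maps the quotient by the ideal of index
  \<open>m - wx\<close> injectively into the quotient by the one of index \<open>m\<close>, and the
  cokernel is the quotient on the line.\<close>

lemma tower_len: "ideal_tower local_ring origin_maximal (valuation_ideal v m) local_ring (len m)"
proof (induction m rule: less_induct)
  case (less m)
  show ?case
  proof (cases "m = 0")
    case True
    then show ?thesis by (simp add: len_def valuation_ideal_0 tower_refl)
  next
    case False
    let ?I = "valuation_ideal v m" and ?I' = "valuation_ideal v (m - wx)"
    have xnz: "x \<noteq> 0" using line_nz by simp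
    have col: "r \<in> ?I'" if "r \<in> local_ring" "x * r \<in> ?I" for r
    proof (cases "r = 0")
      case False
      then have "int m \<le> v x + v r" using that xnz by (simp add: valuation_ideal_eq vge_def v_mult)
      moreover have "0 \<le> v r" using vge_local[OF that(1)] False by (simp add: vge_def)
      ultimately have "int (m - wx) \<le> v r" using wx(1) by linarith
      then show ?thesis using that by (simp add: valuation_ideal_eq vge_def)
    qed (simp add: sub_idealD(2)[OF sub_ideal_valuation])
    have "ideal_tower local_ring origin_maximal {i + x * k | i k. i \<in> ?I \<and> k \<in> ?I'}
        {i + x * k | i k. i \<in> ?I \<and> k \<in> local_ring} (len (m - wx))"
    proof (rule local_ring.tower_scale[OF less])
      show "m - wx < m" using False wx(2) by simp
    qed (use sub_ideal_valuation x_local col in auto)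
    moreover have "{i + x * k | i k. i \<in> ?I \<and> k \<in> ?I'} = ?I"
    proof
      show "?I \<subseteq> {i + x * k | i k. i \<in> ?I \<and> k \<in> ?I'}"
      proof
        fix i assume "i \<in> ?I"
        moreover have "i = i + x * 0" by simp
        ultimately show "i \<in> {i + x * k | i k. i \<in> ?I \<and> k \<in> ?I'}"
          using sub_idealD(2)[OF sub_ideal_valuation] by blast
      qed
      have "x * k \<in> ?I" if "k \<in> ?I'" for k
      proof -
        have k: "k \<in> local_ring" "vge v (int (m - wx)) k" using that by (simp_all add: valuation_ideal_eq)
        have "vge v (v x + int (m - wx)) (x * k)" using k(2) by (intro vge_mult) (simp_all add: vge_def)
        then have "vge v (int m) (x * k)" by (rule vge_mono) (use wx(1) in linarith)
        then show ?thesis using k x_local by (simp add: valuation_ideal_eq local_ring.mult_closed)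
      qed
      then show "{i + x * k | i k. i \<in> ?I \<and> k \<in> ?I'} \<subseteq> ?I"
        using sub_idealD(3)[OF sub_ideal_valuation] by blast
    qed
    ultimately have "ideal_tower local_ring origin_maximal ?I {i + x * k | i k. i \<in> ?I \<and> k \<in> local_ring} (len (m - wx))"
      by simp
    from local_ring.tower_trans[OF this tower_line[of m]] show ?thesis
      using len_rec[of m] False by (simp add: add.commute)
  qed
qed

text \<open>The volume times \<open>v x\<close> is the slope of \<open>ord\<close>. The derivation
  along the line bounds this slope from below by \<open>1 / (A - v x)\<close>, and powers of the
  parameter bound it from above by \<open>1 / v y\<close>.\<close>

lemma volume_bounds:
  shows "1 \<le> valuation_volume v * v x * (A - v x)"
    and "valuation_volume v * v x * v y \<le> 1"
proof -
  obtain \<epsilon> :: real where \<epsilon>: "\<And>n. \<epsilon> * n \<le> ord n" "\<And>\<delta>. \<delta> > 0 \<Longrightarrow> \<exists>K. \<forall>n. ord n \<le> (\<epsilon> + \<delta>) * n + K"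
    "\<And>c :: real. (\<And>n. c * n \<le> ord n) \<Longrightarrow> c \<le> \<epsilon>"
    using subadditive_slope[of ord] ord_add ord_0 by blast
  have Ax: "1 \<le> A - v x" using v_xy v_y by simp
  have low: "1 / (A - v x) \<le> \<epsilon>"
  proof (rule \<epsilon>(3))
    fix n
    have "real n \<le> real (ord n) * of_int (A - v x)"
      using ord_ge[of n] by (metis of_int_le_iff of_int_mult of_int_of_nat_eq)
    then show "1 / (A - v x) * real n \<le> real (ord n)" using Ax by (simp add: field_simps)
  qed
  moreover have "(0::real) \<le> 1 / (A - v x)" using Ax by simp
  ultimately have "0 \<le> \<epsilon>" by linarith
  have "(\<lambda>m. len m / ((real m)\<^sup>2 / 2)) \<longlonglongrightarrow> \<epsilon> / wx"
    by (rule quadratic_growth[OF wx(2) len_rec _ \<open>0 \<le> \<epsilon>\<close> \<epsilon>(1,2)]) (simp_all add: len_def)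
  then have "valuation_volume v = \<epsilon> / wx"
    unfolding valuation_volume_def by (intro limI) (simp add: colength_valuation[OF tower_len])
  moreover have "real wx = v x" using wx(1) by linarith
  ultimately have vol: "valuation_volume v * v x = \<epsilon>" using v_x by simp
  show "1 \<le> valuation_volume v * v x * (A - v x)"
    unfolding vol using low Ax by (simp add: field_simps)
  have "\<epsilon> * real n \<le> 1 / v y * n + 1" for n
  proof -
    \<comment> \<open>The first power of the parameter with value at least \<open>n\<close>.\<close>
    define k where "k = nat \<lceil>real n / v y\<rceil>"
    have k: "real n / v y \<le> k" "k \<le> real n / v y + 1" using v_y by (simp_all add: k_def)
    then have "real n \<le> k * v y" using v_y by (simp add: field_simps)
    then have "int n \<le> int k * v y" by (metis of_int_le_iff of_int_mult of_int_of_nat_eq)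
    then have "ord n \<le> k" by (rule ord_le_param)
    then show ?thesis using \<epsilon>(1)[of n] k by simp
  qed
  then have *: "(\<epsilon> - 1 / v y) * real n \<le> 1" for n by (simp add: algebra_simps)
  have "\<epsilon> \<le> 1 / v y"
  proof (rule ccontr)
    assume "\<not> \<epsilon> \<le> 1 / v y"
    then obtain n where "1 < real n * (\<epsilon> - 1 / v y)" using reals_Archimedean3[of "\<epsilon> - 1 / v y"] by auto
    then show False using *[of n] by (simp add: mult.commute)
  qed
  then show "valuation_volume v * v x * v y \<le> 1"
    unfolding vol using v_y by (simp add: field_simps)
qed

end

section \<open>Monomial valuations\<close>

lemma finite_support: "finite {(a, b). cf h a b \<noteq> 0}"
proof -
  have "{(a, b). cf h a b \<noteq> 0} \<subseteq> (\<Union>b\<le>Polynomial.degree h. (\<lambda>a. (a, b)) ` {..Polynomial.degree (Polynomial.coeff h b)})"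
  proof clarify
    fix a b assume n: "cf h a b \<noteq> 0"
    then have "a \<le> Polynomial.degree (Polynomial.coeff h b)" by (auto simp: cf_def intro: le_degree)
    moreover have "b \<le> Polynomial.degree h" using n by (intro le_degree) (auto simp: cf_def)
    ultimately show "(a, b) \<in> (\<Union>b\<le>Polynomial.degree h. (\<lambda>a. (a, b)) ` {..Polynomial.degree (Polynomial.coeff h b)})"
      by blast
  qed
  then show ?thesis by (rule finite_subset) auto
qed

lemma poly2_sum:
  fixes h :: "'a::comm_ring_1 poly poly"
  shows "h = (\<Sum>(a, b)\<in>{(a, b). cf h a b \<noteq> 0}. [:[:cf h a b:]:] * (var_x ^ a * var_y ^ b))" (is "_ = ?S")
proof (rule poly2_eqI)
  fix i j
  have "cf ?S i j = (\<Sum>e\<in>{(a, b). cf h a b \<noteq> 0}. if e = (i, j) then cf h i j else 0)"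
    unfolding cf_sum
    by (rule sum.cong[OF refl]) (auto simp: cf_const_mult cf_monomial simp del: mult_pCons_left split: if_splits)
  then show "cf h i j = cf ?S i j" using finite_support[of h] by simp
qed

lemma cf_x_mult: "cf (var_x * g) i j = (if 1 \<le> i then cf g (i - 1) j else 0)"
  for g :: "'a::comm_ring_1 poly poly"
  using cf_x_power_mult[of 1 g i j] by simp

lemma cf_y_mult: "cf (var_y * g) i j = (if 1 \<le> j then cf g i (j - 1) else 0)"
  for g :: "'a::comm_ring_1 poly poly"
  using cf_y_power_mult[of 1 g i j] by simp

text \<open>\<open>\<sigma>\<close> rewrites a polynomial in the coordinates \<open>\<l>\<close>,
  \<open>\<l>'\<close> and \<open>\<rho>\<close> substitutes them back. A weight may be 0, which
  gives the order along a line; coprimality makes the valuation take the value 1.\<close>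

locale frame =
  fixes \<l> \<l>' :: "complex poly poly" and \<sigma> \<rho> :: "complex poly poly \<Rightarrow> complex poly poly" and w1 w2 :: nat
  assumes \<sigma>: "unital_hom \<sigma>" and \<rho>: "unital_hom \<rho>" and \<rho>_const: "\<And>c. \<rho> [:[:c:]:] = [:[:c:]:]"
    and \<rho>\<sigma>: "\<And>g. \<rho> (\<sigma> g) = g" and \<sigma>\<rho>: "\<And>g. \<sigma> (\<rho> g) = g"
    and \<rho>x: "\<rho> var_x = \<l>" and \<rho>y: "\<rho> var_y = \<l>'"
    and \<sigma>_origin: "\<And>g. at_origin (\<sigma> g) = at_origin g"
    and w: "coprime w1 w2"
begin

text \<open>The variables are scaled by powers of a new outer variable according to their weights.
  The least weight of a monomial becomes an order of vanishing in that variable, so its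
  multiplicativity is inherited from univariate polynomials over a domain.\<close>

definition \<Theta> :: "complex poly poly \<Rightarrow> complex poly poly poly" where
  "\<Theta> = bieval (\<lambda>c. [:[:[:c:]:]:]) (Polynomial.monom var_x w1) (Polynomial.monom var_y w2)"

lemma const3: "unital_hom (\<lambda>c::complex. [:[:[:c:]:]:])"
  by (simp add: unital_hom_def one_pCons)

lemma \<Theta>: "unital_hom \<Theta>"
  unfolding \<Theta>_def by (rule unital_hom_bieval[OF const3])

lemmas \<Theta>_simps = unital_homD[OF \<Theta>] bieval_simps[OF const3, of "Polynomial.monom var_x w1" "Polynomial.monom var_y w2", folded \<Theta>_def]
lemmas \<sigma>_simps = unital_homD[OF \<sigma>]
lemmas \<rho>_simps = unital_homD[OF \<rho>] \<rho>_const \<rho>x \<rho>y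

lemma coeff_\<Theta>: "cf (Polynomial.coeff (\<Theta> g) n) i j = (if n = w1 * i + w2 * j then cf g i j else 0)"
proof -
  have inner: "cf (Polynomial.coeff (\<Theta> [:c:]) n) i j =
      (if n = w1 * i \<and> j = 0 then Polynomial.coeff c i else 0)" for c n i j
  proof (induction c arbitrary: n i)
    case 0 then show ?case by (simp add: \<Theta>_simps)
  next
    case (pCons a c)
    have "[:pCons a c:] = [:[:a:]:] + var_x * [:c:]" by (simp add: var_x_def)
    then have "\<Theta> [:pCons a c:] = [:[:[:a:]:]:] + Polynomial.monom var_x w1 * \<Theta> [:c:]" by (simp only: \<Theta>_simps)
    then have e: "Polynomial.coeff (\<Theta> [:pCons a c:]) n =
       (if n = 0 then [:[:a:]:] else 0) + (if w1 \<le> n then var_x * Polynomial.coeff (\<Theta> [:c:]) (n - w1) else 0)"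
      by (cases n) (simp_all add: coeff_monom_mult)
    have "n = w1 * i \<longleftrightarrow> w1 \<le> n \<and> n - w1 = w1 * (i - 1)" if "1 \<le> i"
    proof -
      have "w1 * i = w1 + w1 * (i - 1)" using that by (cases i) simp_all
      then show ?thesis by auto
    qed
    then show ?case
      unfolding e cf_add
      by (cases "1 \<le> i"; cases "w1 \<le> n")
        (simp_all add: cf_const cf_x_mult pCons.IH coeff_pCons split: nat.split)
  qed
  show ?thesis
  proof (induction g arbitrary: n j)
    case 0 then show ?case by (simp add: \<Theta>_simps)
  next
    case (pCons c g)
    have "pCons c g = [:c:] + var_y * g" by (simp add: var_y_def)
    then have "\<Theta> (pCons c g) = \<Theta> [:c:] + Polynomial.monom var_y w2 * \<Theta> g" by (simp only: \<Theta>_simps)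
    then have e: "Polynomial.coeff (\<Theta> (pCons c g)) n =
       Polynomial.coeff (\<Theta> [:c:]) n + (if w2 \<le> n then var_y * Polynomial.coeff (\<Theta> g) (n - w2) else 0)"
      by (simp add: coeff_monom_mult)
    have "n = w1 * i + w2 * j \<longleftrightarrow> w2 \<le> n \<and> n - w2 = w1 * i + w2 * (j - 1)" if "1 \<le> j"
    proof -
      have "w2 * j = w2 + w2 * (j - 1)" using that by (cases j) simp_all
      then show ?thesis by auto
    qed
    moreover have "cf (pCons c g) i j = (if 1 \<le> j then cf g i (j - 1) else Polynomial.coeff c i)"
      by (cases j) (simp_all add: cf_def)
    ultimately show ?case
      unfolding e cf_add
      by (cases "1 \<le> j"; cases "w2 \<le> n") (simp_all add: inner cf_y_mult pCons.IH)
  qed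
qed

lemma \<Theta>_eq_0: "\<Theta> g = 0 \<Longrightarrow> g = 0"
proof (rule poly2_eqI)
  fix i j assume "\<Theta> g = 0"
  then show "cf g i j = cf 0 i j" using coeff_\<Theta>[of g "w1 * i + w2 * j" i j] by simp
qed

definition wt :: "complex poly poly \<Rightarrow> nat" where
  "wt g = Polynomial.order 0 (\<Theta> (\<sigma> g))"

lemma \<Theta>\<sigma>_nz: "g \<noteq> 0 \<Longrightarrow> \<Theta> (\<sigma> g) \<noteq> 0"
  using \<Theta>_eq_0[of "\<sigma> g"] \<rho>\<sigma>[of g] \<rho>_simps(1) by auto

lemma wt_ge_iff:
  assumes "g \<noteq> 0"
  shows "n \<le> wt g \<longleftrightarrow> (\<forall>i j. cf (\<sigma> g) i j \<noteq> 0 \<longrightarrow> n \<le> w1 * i + w2 * j)"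
proof -
  have "n \<le> wt g \<longleftrightarrow> (\<forall>k<n. Polynomial.coeff (\<Theta> (\<sigma> g)) k = 0)"
    unfolding wt_def using monom_1_dvd_iff[OF \<Theta>\<sigma>_nz[OF assms]] monom_1_dvd_iff'[of n "\<Theta> (\<sigma> g)"] by simp
  also have "\<dots> \<longleftrightarrow> (\<forall>i j. cf (\<sigma> g) i j \<noteq> 0 \<longrightarrow> n \<le> w1 * i + w2 * j)"
  proof
    assume *: "\<forall>k<n. Polynomial.coeff (\<Theta> (\<sigma> g)) k = 0"
    show "\<forall>i j. cf (\<sigma> g) i j \<noteq> 0 \<longrightarrow> n \<le> w1 * i + w2 * j"
    proof (intro allI impI, rule ccontr)
      fix i j assume "cf (\<sigma> g) i j \<noteq> 0" "\<not> n \<le> w1 * i + w2 * j"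
      then show False using * coeff_\<Theta>[of "\<sigma> g" "w1 * i + w2 * j" i j] by simp
    qed
  next
    assume *: "\<forall>i j. cf (\<sigma> g) i j \<noteq> 0 \<longrightarrow> n \<le> w1 * i + w2 * j"
    show "\<forall>k<n. Polynomial.coeff (\<Theta> (\<sigma> g)) k = 0"
    proof (intro allI impI poly2_eqI)
      fix k i j assume "k < n"
      then show "cf (Polynomial.coeff (\<Theta> (\<sigma> g)) k) i j = cf 0 i j"
        using *[rule_format, of i j] by (cases "cf (\<sigma> g) i j = 0") (simp_all add: coeff_\<Theta>)
    qed
  qed
  finally show ?thesis .
qed

lemma wt_mult: "g \<noteq> 0 \<Longrightarrow> h \<noteq> 0 \<Longrightarrow> wt (g * h) = wt g + wt h"
  unfolding wt_def using \<Theta>\<sigma>_nz[of g] \<Theta>\<sigma>_nz[of h] by (simp add: \<sigma>_simps \<Theta>_simps order_mult)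

lemma wt_add:
  assumes "g \<noteq> 0" "h \<noteq> 0" "g + h \<noteq> 0"
  shows "min (wt g) (wt h) \<le> wt (g + h)"
proof -
  let ?n = "min (wt g) (wt h)"
  have "?n \<le> wt g" "?n \<le> wt h" by auto
  then have "?n \<le> w1 * i + w2 * j" if "cf (\<sigma> (g + h)) i j \<noteq> 0" for i j
    using that unfolding wt_ge_iff[OF assms(1)] wt_ge_iff[OF assms(2)] \<sigma>_simps cf_add
    by (cases "cf (\<sigma> g) i j = 0") simp_all
  then show ?thesis using wt_ge_iff[OF assms(3)] by blast
qed

definition val :: "cfun \<Rightarrow> int" where
  "val z = int (wt (fst (quot_of_fract z))) - int (wt (snd (quot_of_fract z)))"

lemma val_divide:
  assumes "g \<noteq> 0" "h \<noteq> 0"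
  shows "val (to_fract g / to_fract h) = int (wt g) - int (wt h)"
proof -
  define z where "z = to_fract g / to_fract h"
  define g' h' where "g' = fst (quot_of_fract z)" and "h' = snd (quot_of_fract z)"
  have h': "h' \<noteq> 0" by (simp add: h'_def)
  have z: "z = to_fract g' / to_fract h'" by (simp add: g'_def h'_def flip: Fract_conv_to_fract)
  then have g': "g' \<noteq> 0" using assms by (auto simp: z_def)
  have "to_fract (g * h') = to_fract (g' * h)" using z assms h' by (simp add: z_def field_simps)
  then have "g * h' = g' * h" by (simp only: to_fract_eq_iff)
  then have "wt g + wt h' = wt g' + wt h" using wt_mult assms g' h' by metis
  then show ?thesis unfolding z_def[symmetric] val_def g'_def[symmetric] h'_def[symmetric] by linarith
qed

lemma wt_1: "wt 1 = 0"
  using wt_mult[of 1 1] by simp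

lemma val_poly: "g \<noteq> 0 \<Longrightarrow> val (to_fract g) = int (wt g)"
  using val_divide[of g 1] by (simp add: wt_1)

lemma wt_line: "wt \<l> = w1" "wt \<l>' = w2" "\<l> \<noteq> 0" "\<l>' \<noteq> 0"
proof -
  have s: "\<sigma> \<l> = var_x" "\<sigma> \<l>' = var_y" using \<sigma>\<rho>[of var_x] \<sigma>\<rho>[of var_y] by (simp_all add: \<rho>_simps)
  have c: "cf (var_x :: complex poly poly) i j = (if i = 1 \<and> j = 0 then 1 else 0)"
    "cf (var_y :: complex poly poly) i j = (if i = 0 \<and> j = 1 then 1 else 0)" for i j
    using cf_monomial[of 1 0 i j] cf_monomial[of 0 1 i j] by simp_all
  have "var_x \<noteq> (0::complex poly poly)" "var_y \<noteq> (0::complex poly poly)"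
    by (simp_all add: var_x_def var_y_def)
  then show nz: "\<l> \<noteq> 0" "\<l>' \<noteq> 0" using s \<sigma>_simps(1) by auto
  have "n \<le> wt \<l> \<longleftrightarrow> n \<le> w1" "n \<le> wt \<l>' \<longleftrightarrow> n \<le> w2" for n
    unfolding wt_ge_iff[OF nz(1)] wt_ge_iff[OF nz(2)] s c by auto
  then show "wt \<l> = w1" "wt \<l>' = w2" by (metis order_antisym order_refl)+
qed

lemma wt_origin: "at_origin g \<noteq> 0 \<Longrightarrow> wt g = 0"
proof -
  assume a: "at_origin g \<noteq> 0"
  then have "cf (\<sigma> g) 0 0 \<noteq> 0" using \<sigma>_origin[of g] by (simp add: at_origin_cf)
  moreover have "g \<noteq> 0" using a by auto
  ultimately have "\<not> 1 \<le> wt g" using wt_ge_iff[of g 1] by fastforce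
  then show ?thesis by simp
qed

lemma wt_pos:
  assumes "0 < w1" "0 < w2" "g \<noteq> 0" "at_origin g = 0"
  shows "0 < wt g"
proof -
  have c: "cf (\<sigma> g) 0 0 = 0" using \<sigma>_origin[of g] assms by (simp add: at_origin_cf)
  have "1 \<le> w1 * i + w2 * j" if "cf (\<sigma> g) i j \<noteq> 0" for i j
  proof -
    have "w1 * i + w2 * j \<noteq> 0"
    proof
      assume "w1 * i + w2 * j = 0"
      then have "i = 0" "j = 0" using assms by simp_all
      then show False using that c by simp
    qed
    then show ?thesis by linarith
  qed
  then have "1 \<le> wt g" using wt_ge_iff[OF assms(3), of 1] by blast
  then show ?thesis by simp
qed

abbreviation "x \<equiv> to_fract \<l>"
abbreviation "y \<equiv> to_fract \<l>'"

lemma bezout_weights: obtains r s :: int where "r * int w1 + s * int w2 = 1"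
  using w bezout_coefficients_fst_snd[of "int w1" "int w2"]
  by (metis coprime_imp_gcd_eq_1 coprime_int_iff)

lemma val_mult:
  assumes "a \<noteq> 0" "b \<noteq> 0"
  shows "val (a * b) = val a + val b"
proof -
  obtain g h where a: "a = to_fract g / to_fract h" "h \<noteq> 0" by (rule fract_cases)
  obtain g' h' where b: "b = to_fract g' / to_fract h'" "h' \<noteq> 0" by (rule fract_cases)
  have nz: "g \<noteq> 0" "g' \<noteq> 0" using a b assms by auto
  have "a * b = to_fract (g * g') / to_fract (h * h')" using a b by simp
  then show ?thesis using val_divide[of "g * g'" "h * h'"] a b nz by (simp add: val_divide wt_mult del: to_fract_mult)
qed

lemma val_add:
  assumes "a \<noteq> 0" "b \<noteq> 0" "a + b \<noteq> 0"
  shows "min (val a) (val b) \<le> val (a + b)"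
proof -
  obtain g h where a: "a = to_fract g / to_fract h" "h \<noteq> 0" by (rule fract_cases)
  obtain g' h' where b: "b = to_fract g' / to_fract h'" "h' \<noteq> 0" by (rule fract_cases)
  have nz: "g \<noteq> 0" "g' \<noteq> 0" using a b assms by auto
  have e: "a + b = to_fract (g * h' + g' * h) / to_fract (h * h')" using a b by (simp add: field_simps)
  then have n: "g * h' + g' * h \<noteq> 0" using assms(3) by (metis div_0 to_fract_0)
  have "val (a + b) = int (wt (g * h' + g' * h)) - int (wt h + wt h')"
    unfolding e using val_divide[OF n, of "h * h'"] a b by (simp add: wt_mult del: to_fract_mult to_fract_add)
  moreover have "min (wt (g * h')) (wt (g' * h)) \<le> wt (g * h' + g' * h)"
    using n nz a b by (intro wt_add) auto
  ultimately show ?thesis using nz a b by (simp add: val_divide wt_mult)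
qed

lemma val_line: "val x = int w1" "val y = int w2"
  using wt_line by (simp_all add: val_poly)

lemma discrete: "discrete_valuation val"
proof -
  have m: "\<forall>g h. g \<noteq> 0 \<longrightarrow> h \<noteq> 0 \<longrightarrow> val (g * h) = val g + val h" using val_mult by blast
  have one: "val 1 = 0" using val_poly[of 1] by (simp add: wt_1)
  have inv: "val (inverse g) = - val g" if "g \<noteq> 0" for g using val_mult[of g "inverse g"] that one by simp
  have pow: "val (g ^ n) = int n * val g" if "g \<noteq> 0" for g n
    using that by (induction n) (simp_all add: one val_mult algebra_simps)
  have powi: "val (g powi n) = n * val g" if "g \<noteq> 0" for g n
    using that by (cases "n \<ge> 0") (simp_all add: power_int_def pow inv power_inverse)
  obtain r s :: int where rs: "r * int w1 + s * int w2 = 1" by (rule bezout_weights)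
  have "n \<in> val ` (- {0})" for n
  proof -
    \<comment> \<open>The Bezout coefficients give a Laurent monomial of value 1; its
      \<open>n\<close>-th power has value \<open>n\<close>.\<close>
    have nz: "x powi (n * r) * y powi (n * s) \<noteq> 0" using wt_line by simp
    have "val (x powi (n * r) * y powi (n * s)) = n * (r * int w1 + s * int w2)"
      using wt_line by (simp add: val_mult powi val_line algebra_simps)
    then have "val (x powi (n * r) * y powi (n * s)) = n" using rs by simp
    then show ?thesis using nz by (metis ComplI image_eqI singletonD)
  qed
  then have "val ` (- {0}) = UNIV" by blast
  then show ?thesis unfolding discrete_valuation_def using m val_add by blast
qed

sublocale valuation val
  by unfold_locales (rule discrete)

definition laurent :: "cfun set" where
  "laurent = {to_fract g / (x ^ i * y ^ j) | g i j. True}"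

text \<open>The toric chart containing the generic point of the divisor: functions regular off the
  two lines and of nonnegative weight. As an intersection of two integrally closed rings it is
  normal.\<close>

definition model :: "cfun set" where
  "model = {z \<in> laurent. vge val 0 z}"

definition prime_div :: "cfun set" where
  "prime_div = {z \<in> model. vge val 1 z}"

section \<open>The chart of a monomial valuation: generators and normality\<close>

lemma xy_nz: "x \<noteq> 0" "y \<noteq> 0"
  using wt_line by simp_all

lemma laurent_add: "a \<in> laurent \<Longrightarrow> b \<in> laurent \<Longrightarrow> a + b \<in> laurent"
proof -
  assume "a \<in> laurent" "b \<in> laurent"
  then obtain g i j h k l where a: "a = to_fract g / (x ^ i * y ^ j)" "b = to_fract h / (x ^ k * y ^ l)"
    by (auto simp: laurent_def)
  have "a + b = to_fract (g * (\<l> ^ k * \<l>' ^ l) + h * (\<l> ^ i * \<l>' ^ j)) / (x ^ (i + k) * y ^ (j + l))"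
    using xy_nz by (simp add: a to_fract_power power_add field_simps)
  then show ?thesis unfolding laurent_def by blast
qed

lemma laurent_mult: "a \<in> laurent \<Longrightarrow> b \<in> laurent \<Longrightarrow> a * b \<in> laurent"
proof -
  assume "a \<in> laurent" "b \<in> laurent"
  then obtain g i j h k l where a: "a = to_fract g / (x ^ i * y ^ j)" "b = to_fract h / (x ^ k * y ^ l)"
    by (auto simp: laurent_def)
  have "a * b = to_fract (g * h) / (x ^ (i + k) * y ^ (j + l))" by (simp add: a power_add field_simps)
  then show ?thesis unfolding laurent_def by blast
qed

lemma laurent_poly: "to_fract g \<in> laurent"
proof -
  have "to_fract g = to_fract g / (x ^ 0 * y ^ 0)" by simp
  then show ?thesis unfolding laurent_def by blast
qed

lemma laurent_monomial: "x powi i * y powi j \<in> laurent"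
proof -
  have "x powi i \<in> laurent" for i
  proof (cases "i \<ge> 0")
    case True
    then show ?thesis using laurent_poly[of "\<l> ^ nat i"] by (simp add: power_int_def to_fract_power)
  next
    case False
    then have "x powi i = to_fract 1 / (x ^ nat (- i) * y ^ 0)" by (simp add: power_int_def inverse_eq_divide power_divide)
    then show ?thesis unfolding laurent_def by blast
  qed
  moreover have "y powi j \<in> laurent" for j
  proof (cases "j \<ge> 0")
    case True
    then show ?thesis using laurent_poly[of "\<l>' ^ nat j"] by (simp add: power_int_def to_fract_power)
  next
    case False
    then have "y powi j = to_fract 1 / (x ^ 0 * y ^ nat (- j))" by (simp add: power_int_def inverse_eq_divide power_divide)
    then show ?thesis unfolding laurent_def by blast
  qed
  ultimately show ?thesis by (intro laurent_mult)
qed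

lemma model_closed:
  "a \<in> model \<Longrightarrow> b \<in> model \<Longrightarrow> a + b \<in> model" "a \<in> model \<Longrightarrow> b \<in> model \<Longrightarrow> a * b \<in> model"
  "to_fract g \<in> model" "a \<in> model \<Longrightarrow> - a \<in> model"
proof -
  show p: "to_fract g \<in> model" for g
    using val_poly[of g] laurent_poly[of g] by (cases "g = 0") (simp_all add: model_def vge_def)
  show "a \<in> model \<Longrightarrow> b \<in> model \<Longrightarrow> a + b \<in> model" by (simp add: model_def laurent_add vge_add)
  show m: "a \<in> model \<Longrightarrow> b \<in> model \<Longrightarrow> a * b \<in> model" for a b
    using vge_mult[of 0 a 0 b] by (simp add: model_def laurent_mult)
  show "a \<in> model \<Longrightarrow> - a \<in> model" using m[OF p[of "- 1"], of a] by simp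
qed

lemma one_model: "1 \<in> model" and zero_model: "0 \<in> model"
  using model_closed(3)[of 1] model_closed(3)[of 0] by simp_all

lemma val_monomial: "val (x powi i * y powi j) = i * int w1 + j * int w2"
  using xy_nz by (simp add: v_mult v_powi val_line)

text \<open>With \<open>\<pi> = x\<^sup>r y\<^sup>s\<close> and \<open>u = x\<^bsup>w2\<^esup> y\<^bsup>-w1\<^esup>\<close> the chart is \<open>C[\<pi>, u, 1/u]\<close>, and the divisor is \<open>\<pi> = 0\<close>.\<close>

lemma monomial_decomp:
  fixes r s i j :: int
  assumes "r * int w1 + s * int w2 = 1"
  defines "\<pi> \<equiv> x powi r * y powi s" and "u \<equiv> x powi (int w2) * y powi (- int w1)"
  shows "x powi i * y powi j = \<pi> powi (i * int w1 + j * int w2) * u powi (s * i - r * j)"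
proof -
  let ?N = "i * int w1 + j * int w2" and ?M = "s * i - r * j"
  have "\<pi> powi ?N * u powi ?M = x powi (r * ?N + int w2 * ?M) * y powi (s * ?N - int w1 * ?M)"
    unfolding \<pi>_def u_def power_int_mult_distrib power_int_mult[symmetric]
    using xy_nz by (simp add: power_int_add power_int_diff power_int_minus field_simps)
  also have "r * ?N + int w2 * ?M = i * (r * int w1 + s * int w2)" by (simp add: algebra_simps)
  also have "s * ?N - int w1 * ?M = j * (r * int w1 + s * int w2)" by (simp add: algebra_simps)
  finally show ?thesis using assms(1) by simp
qed

text \<open>A Laurent monomial of nonnegative weight is a nonnegative power of \<open>\<pi>\<close>
  times a power of the weight 0 unit \<open>u\<close>, so these generate the chart. The logarithmic
  bound for the pair is recorded because it controls the poles of all Jacobians on the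
  chart.\<close>

lemma model_generated:
  obtains H \<pi> u where "model = generate_ring cfun_field (range cconst \<union> H)" "H = {\<pi>, u, inverse u}"
    "val \<pi> = 1" "val u = 0" "\<pi> \<noteq> 0" "u \<noteq> 0" "\<forall>n. \<pi> powi n \<in> laurent"
    "log_bounded (int w1 + int w2) \<pi> u"
proof -
  obtain r s :: int where rs: "r * int w1 + s * int w2 = 1" by (rule bezout_weights)
  define \<pi> u where "\<pi> = x powi r * y powi s" and "u = x powi (int w2) * y powi (- int w1)"
  have nz: "\<pi> \<noteq> 0" "u \<noteq> 0" using xy_nz by (simp_all add: \<pi>_def u_def)
  have v: "val \<pi> = 1" "val u = 0" unfolding \<pi>_def u_def val_monomial using rs by simp_all
  define B where "B = generate_ring cfun_field (range cconst \<union> {\<pi>, u, inverse u})"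
  have iu: "inverse u = x powi (- int w2) * y powi (int w1)"
    using xy_nz by (simp add: u_def power_int_minus field_simps)
  have "z \<in> model" if "z \<in> B" for z
    using that unfolding B_def
  proof (induction rule: generate_ring_induct)
    case (incl h)
    moreover have "\<pi> \<in> laurent" "u \<in> laurent" "inverse u \<in> laurent"
      unfolding iu unfolding \<pi>_def u_def by (rule laurent_monomial)+
    then have "\<pi> \<in> model" "u \<in> model" "inverse u \<in> model"
      using v nz by (simp_all add: model_def vge_def v_inverse)
    ultimately show ?case using model_closed(3) by auto
  qed (simp_all add: one_model model_closed)
  moreover have "z \<in> B" if "z \<in> model" for z
  proof -
    have Bcl: "\<pi> \<in> B" "u \<in> B" "inverse u \<in> B" "cconst c \<in> B" "1 \<in> B" for c
      unfolding B_def by (auto intro: generate_ring_closed)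
    have Bm: "a * b \<in> B" "a + b \<in> B" if "a \<in> B" "b \<in> B" for a b
      using that unfolding B_def by (auto intro: generate_ring_closed)
    have Bp: "a ^ n \<in> B" if "a \<in> B" for a n
      using that by (induction n) (simp_all add: Bm Bcl)
    have mono: "x powi i * y powi j \<in> B" if "0 \<le> i * int w1 + j * int w2" for i j
    proof -
      have "\<pi> powi (i * int w1 + j * int w2) \<in> B" using that by (simp add: power_int_def Bp Bcl)
      moreover have "u powi k \<in> B" for k by (simp add: power_int_def Bp Bcl)
      ultimately show ?thesis
        using monomial_decomp[OF rs, of i j] Bm unfolding \<pi>_def[symmetric] u_def[symmetric] by simp
    qed
    have Bs: "sum f S \<in> B" if "\<And>a. a \<in> S \<Longrightarrow> f a \<in> B" for f and S :: "(nat \<times> nat) set"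
      using that Bcl(4)[of 0] by (induction S rule: infinite_finite_induct) (simp_all add: Bm)
    obtain g i j where z: "z = to_fract g / (x ^ i * y ^ j)" "vge val 0 z"
      using \<open>z \<in> model\<close> by (auto simp: model_def laurent_def)
    show "z \<in> B"
    proof (cases "g = 0")
      case True then show ?thesis using z Bcl(4)[of 0] by simp
    next
      case False
      define S where "S = {(a, b). cf (\<sigma> g) a b \<noteq> 0}"
      have "z \<noteq> 0" using z False xy_nz by simp
      then have "int (wt g) - (int i * int w1 + int j * int w2) \<ge> 0"
        using z False xy_nz by (simp add: vge_def v_divide v_mult v_power val_poly val_line)
      then have "w1 * i + w2 * j \<le> wt g" by (simp add: mult.commute) (metis of_nat_add of_nat_le_iff of_nat_mult)
      then have S: "w1 * i + w2 * j \<le> w1 * a + w2 * b" if "(a, b) \<in> S" for a b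
        using that wt_ge_iff[OF False] unfolding S_def by blast
      \<comment> \<open>Expansion of the numerator in powers of the two lines; each monomial,
        divided by the denominator, still has nonnegative weight.\<close>
      have "g = \<rho> (\<sigma> g)" by (simp add: \<rho>\<sigma>)
      also have "\<dots> = (\<Sum>(a, b)\<in>S. [:[:cf (\<sigma> g) a b:]:] * (\<l> ^ a * \<l>' ^ b))"
        by (subst poly2_sum[of "\<sigma> g"]) (simp only: \<rho>_simps S_def case_prod_unfold)
      finally have "to_fract g = to_fract (\<Sum>(a, b)\<in>S. [:[:cf (\<sigma> g) a b:]:] * (\<l> ^ a * \<l>' ^ b))"
        by (rule arg_cong)
      then have "to_fract g = (\<Sum>(a, b)\<in>S. cconst (cf (\<sigma> g) a b) * (x ^ a * y ^ b))"
        by (simp only: to_fract_sum case_prod_unfold to_fract_mult to_fract_power)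
      then have "z = (\<Sum>(a, b)\<in>S. cconst (cf (\<sigma> g) a b) * (x ^ a * y ^ b)) / (x ^ i * y ^ j)"
        using z by simp
      also have "\<dots> = (\<Sum>(a, b)\<in>S. cconst (cf (\<sigma> g) a b) * (x powi (int a - int i) * y powi (int b - int j)))"
        using xy_nz by (simp add: sum_divide_distrib case_prod_unfold power_int_diff)
      also have "\<dots> \<in> B"
      proof (rule Bs)
        fix e assume e: "e \<in> S"
        obtain a b where ab: "e = (a, b)" by (cases e)
        have "int (w1 * i + w2 * j) \<le> int (w1 * a + w2 * b)" using S e ab by (simp only: of_nat_le_iff)
        then have "0 \<le> (int a - int i) * int w1 + (int b - int j) * int w2" by (simp add: algebra_simps)
        then show "(case e of (a, b) \<Rightarrow> cconst (cf (\<sigma> g) a b) * (x powi (int a - int i) * y powi (int b - int j))) \<in> B"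
          unfolding ab prod.case by (intro Bm(1) Bcl(4) mono)
      qed
      finally show ?thesis .
    qed
  qed
  ultimately have "model = B" by blast
  moreover have "\<pi> powi n \<in> laurent" for n
  proof -
    have "\<pi> powi n = x powi (r * n) * y powi (s * n)" by (simp add: \<pi>_def power_int_mult_distrib power_int_mult)
    then show ?thesis using laurent_monomial by simp
  qed
  moreover have "log_bounded (int w1 + int w2) \<pi> u"
  proof -
    let ?lb = "log_bounded (int w1 + int w2)"
    have pj: "vge val 0 (to_fract g)" for g using model_closed(3)[of g] by (simp add: model_def)
    \<comment> \<open>The Jacobian of two polynomials is a polynomial, so its value is at least 0,
      which is the sum of the values of the two lines minus \<open>w1 + w2\<close>.\<close>
    have xy: "?lb x y" using pj by (simp add: log_bounded_def val_line jac_to_fract)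
    have xx: "?lb x x" "?lb y y" by (simp_all add: log_bounded_def jac_self)
    have "?lb (x powi i * y powi j) x" "?lb (x powi i * y powi j) y" for i j
      using xy_nz xy xx log_bounded_sym[OF xy] by (simp_all add: log_bounded_mult log_bounded_powi)
    then have "?lb x \<pi>" "?lb y \<pi>" unfolding \<pi>_def by (auto intro: log_bounded_sym)
    then have "?lb u \<pi>"
      unfolding u_def by (intro log_bounded_mult log_bounded_powi) (use xy_nz in simp_all)
    then show ?thesis by (rule log_bounded_sym)
  qed
  ultimately show ?thesis using that[OF _ refl v nz, folded B_def] by blast
qed


text \<open>In a monic equation the leading power of an element of negative value has strictly
  smaller value than every other term.\<close>

lemma vge_integral:
  assumes "Polynomial.lead_coeff q = 1" "\<And>i. vge val 0 (Polynomial.coeff q i)" "poly q z = 0"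
  shows "vge val 0 z"
proof (rule ccontr)
  assume n: "\<not> vge val 0 z"
  then have z: "z \<noteq> 0" "val z < 0" by (auto simp: vge_def)
  define d where "d = Polynomial.degree q"
  have d: "d > 0"
  proof (rule ccontr)
    assume "\<not> d > 0"
    then obtain c where "q = [:c:]" unfolding d_def by (metis degree_eq_zeroE gr0I)
    then show False using assms(1,3) by auto
  qed
  have "poly q z = (\<Sum>i<d. Polynomial.coeff q i * z ^ i) + z ^ d"
    using assms(1) unfolding poly_altdef d_def by (simp flip: lessThan_Suc_atMost)
  then have e: "z ^ d = - (\<Sum>i<d. Polynomial.coeff q i * z ^ i)" using assms(3) by (simp add: eq_neg_iff_add_eq_0 add.commute)
  have sum: "vge val k (sum f S)" if "\<And>a. a \<in> S \<Longrightarrow> vge val k (f a)" for k f and S :: "nat set"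
    using that by (induction S rule: infinite_finite_induct) (simp_all add: vge_add)
  have "vge val (int (d - 1) * val z) (\<Sum>i<d. Polynomial.coeff q i * z ^ i)"
  proof (rule sum)
    fix i assume "i \<in> {..<d}"
    then have "int (d - 1) * val z \<le> 0 + int i * val z" using z by (simp add: mult_le_cancel_right)
    moreover have "vge val (0 + int i * val z) (Polynomial.coeff q i * z ^ i)"
      using z by (intro vge_mult assms) (simp add: vge_def v_power)
    ultimately show "vge val (int (d - 1) * val z) (Polynomial.coeff q i * z ^ i)" using vge_mono by blast
  qed
  then have "vge val (int (d - 1) * val z) (z ^ d)" unfolding e by (rule vge_uminus)
  then have "int (d - 1) * val z \<le> val (z ^ d)" using z(1) by (simp add: vge_def)
  then have "int (d - 1) * val z \<le> int d * val z" by (simp only: v_power[OF z(1)])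
  moreover have "int (d - 1) = int d - 1" using d by simp
  ultimately have "0 \<le> val z" by (simp add: left_diff_distrib)
  then show False using z by simp
qed

text \<open>The rational root argument, after clearing the coefficients by a power of
  \<open>M = \<l> * \<l>'\<close>: the reduced denominator of \<open>z\<close> divides
  \<open>M ^ N\<close>, so powers of the two lines suffice as denominator.\<close>

lemma laurent_integral:
  assumes q: "Polynomial.lead_coeff q = 1" "\<And>i. Polynomial.coeff q i \<in> laurent" "poly q z = 0"
  shows "z \<in> laurent"
proof -
  define d where "d = Polynomial.degree q"
  define M where "M = \<l> * \<l>'"
  have M: "M \<noteq> 0" using wt_line by (simp add: M_def)
  have cd: "\<exists>N. \<forall>n\<ge>N. \<exists>g. c * to_fract (M ^ n) = to_fract g" if "c \<in> laurent" for c
  proof -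
    obtain g i j where c: "c = to_fract g / (x ^ i * y ^ j)" using \<open>c \<in> laurent\<close> by (auto simp: laurent_def)
    have "c * to_fract (M ^ n) = to_fract (g * \<l> ^ (n - i) * \<l>' ^ (n - j))" if "n \<ge> i + j" for n
    proof -
      have "x ^ n = x ^ (n - i) * x ^ i" "y ^ n = y ^ (n - j) * y ^ j" using that by (simp_all flip: power_add)
      then have "to_fract (M ^ n) = (x ^ (n - i) * x ^ i) * (y ^ (n - j) * y ^ j)"
        by (simp add: M_def to_fract_power power_mult_distrib)
      then show ?thesis using xy_nz by (simp add: c to_fract_power)
    qed
    then show ?thesis by blast
  qed
  obtain N0 where N0: "\<And>i n. n \<ge> N0 i \<Longrightarrow> \<exists>g. Polynomial.coeff q i * to_fract (M ^ n) = to_fract g"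
    using cd[OF q(2)] by metis
  define N where "N = (\<Sum>i\<le>d. N0 i)"
  have "N0 i \<le> N" if "i \<le> d" for i unfolding N_def using that by (intro member_le_sum) auto
  then obtain G where G: "\<And>i. i \<le> d \<Longrightarrow> Polynomial.coeff q i * to_fract (M ^ N) = to_fract (G i)"
  proof -
    have "\<forall>i. \<exists>g. i \<le> d \<longrightarrow> Polynomial.coeff q i * to_fract (M ^ N) = to_fract g"
      using N0 \<open>\<And>i. i \<le> d \<Longrightarrow> N0 i \<le> N\<close> by blast
    then obtain G where "\<forall>i. i \<le> d \<longrightarrow> Polynomial.coeff q i * to_fract (M ^ N) = to_fract (G i)"
      using choice by metis
    then show ?thesis by (intro that[of G]) blast
  qed
  define a b where "a = fst (quot_of_fract z)" and "b = snd (quot_of_fract z)"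
  have b: "b \<noteq> 0" by (simp add: b_def)
  have z: "z = to_fract a / to_fract b" by (simp add: a_def b_def flip: Fract_conv_to_fract)
  have cop: "coprime a b" unfolding a_def b_def by (rule coprime_quot_of_fract)
  have "to_fract (\<Sum>i\<le>d. G i * (a ^ i * b ^ (d - i))) =
      (\<Sum>i\<le>d. to_fract (M ^ N) * to_fract b ^ d * (Polynomial.coeff q i * z ^ i))"
    unfolding to_fract_sum
  proof (rule sum.cong[OF refl])
    fix i assume "i \<in> {..d}"
    then have i: "i \<le> d" by simp
    have "to_fract b ^ d = to_fract b ^ (d - i) * to_fract b ^ i" using i by (simp flip: power_add)
    then have "to_fract a ^ i * to_fract b ^ (d - i) = to_fract b ^ d * z ^ i"
      using b by (simp add: z power_divide)
    then have "to_fract (G i * (a ^ i * b ^ (d - i))) =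
        (Polynomial.coeff q i * to_fract (M ^ N)) * (to_fract b ^ d * z ^ i)"
      using G[OF i] by (simp add: to_fract_power)
    then show "to_fract (G i * (a ^ i * b ^ (d - i))) =
        to_fract (M ^ N) * to_fract b ^ d * (Polynomial.coeff q i * z ^ i)" by (simp only: mult_ac)
  qed
  also have "\<dots> = to_fract (M ^ N) * to_fract b ^ d * poly q z"
    unfolding poly_altdef d_def by (simp add: sum_distrib_left)
  finally have "to_fract (\<Sum>i\<le>d. G i * (a ^ i * b ^ (d - i))) = 0" by (simp only: q(3) mult_zero_right)
  then have "(\<Sum>i\<le>d. G i * (a ^ i * b ^ (d - i))) = 0" by (simp only: to_fract_eq_0_iff)
  then have s: "(\<Sum>i<d. G i * (a ^ i * b ^ (d - i))) + G d * a ^ d = 0"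
    by (simp flip: lessThan_Suc_atMost)
  have "b dvd (\<Sum>i<d. G i * (a ^ i * b ^ (d - i)))"
  proof (rule dvd_sum)
    fix i assume "i \<in> {..<d}"
    then have "b dvd b ^ (d - i)" by (simp add: dvd_power)
    then show "b dvd G i * (a ^ i * b ^ (d - i))" by (simp add: dvd_mult)
  qed
  moreover have "b dvd (\<Sum>i<d. G i * (a ^ i * b ^ (d - i))) + G d * a ^ d" unfolding s by simp
  ultimately have bG: "b dvd G d * a ^ d" by (simp only: dvd_add_right_iff)
  have "to_fract (G d) = to_fract (M ^ N)" using G[of d] q(1) by (simp add: d_def)
  then have "G d = M ^ N" by (simp only: to_fract_eq_iff)
  with bG have "b dvd M ^ N * a ^ d" by simp
  moreover have "coprime b (a ^ d)" using cop by (simp add: coprime_commute)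
  ultimately have "b dvd M ^ N" by (simp add: coprime_dvd_mult_left_iff)
  then obtain k where k: "M ^ N = b * k" by (elim dvdE)
  have "M ^ N \<noteq> 0" using M by simp
  then have k0: "k \<noteq> 0" using k by auto
  have "to_fract (M ^ N) = x ^ N * y ^ N" by (simp add: M_def to_fract_power power_mult_distrib)
  then have "x ^ N * y ^ N = to_fract b * to_fract k" using k by simp
  then have "to_fract (a * k) / (x ^ N * y ^ N) = z" using b k0 by (simp add: z)
  then show ?thesis unfolding laurent_def by blast
qed

section \<open>The prime divisor on the chart\<close>

lemma cring_model: "cring (cfun_field\<lparr>carrier := model\<rparr>)"
proof (rule cringI)
  show "abelian_group (cfun_field\<lparr>carrier := model\<rparr>)"
  proof (rule abelian_groupI)
    fix a assume "a \<in> carrier (cfun_field\<lparr>carrier := model\<rparr>)"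
    then show "\<exists>b\<in>carrier (cfun_field\<lparr>carrier := model\<rparr>). b \<oplus>\<^bsub>cfun_field\<lparr>carrier := model\<rparr>\<^esub> a = \<zero>\<^bsub>cfun_field\<lparr>carrier := model\<rparr>\<^esub>"
      by (intro bexI[of _ "- a"]) (simp_all add: model_closed)
  qed (simp_all add: model_closed zero_model)
  show "comm_monoid (cfun_field\<lparr>carrier := model\<rparr>)"
    by (rule comm_monoidI) (simp_all add: model_closed one_model)
qed (simp add: distrib_right)

lemma prime_div: "primeideal prime_div (cfun_field\<lparr>carrier := model\<rparr>)"
proof (rule primeidealI)
  interpret cring "cfun_field\<lparr>carrier := model\<rparr>" by (rule cring_model)
  have um: "\<ominus>\<^bsub>cfun_field\<lparr>carrier := model\<rparr>\<^esub> a = - a" if "a \<in> model" for a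
    using that by (intro minus_equality) (simp_all add: model_closed)
  show "ideal prime_div (cfun_field\<lparr>carrier := model\<rparr>)"
  proof (rule idealI[OF ring_axioms])
    show "subgroup prime_div (add_monoid (cfun_field\<lparr>carrier := model\<rparr>))"
    proof (rule add.subgroupI)
      show "prime_div \<subseteq> carrier (cfun_field\<lparr>carrier := model\<rparr>)" by (auto simp: prime_div_def)
      show "prime_div \<noteq> {}" using zero_model vge_0 by (auto simp: prime_div_def)
      show "\<ominus>\<^bsub>cfun_field\<lparr>carrier := model\<rparr>\<^esub> a \<in> prime_div" if "a \<in> prime_div" for a
        using that by (simp add: prime_div_def um model_closed vge_uminus)
      show "a \<oplus>\<^bsub>cfun_field\<lparr>carrier := model\<rparr>\<^esub> b \<in> prime_div" if "a \<in> prime_div" "b \<in> prime_div" for a b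
        using that by (simp add: prime_div_def model_closed vge_add)
    qed
    have "vge val 1 (b * a)" if "a \<in> prime_div" "b \<in> model" for a b
      using that vge_mult[of 0 b 1 a] by (simp add: prime_div_def model_def)
    then show "b \<otimes>\<^bsub>cfun_field\<lparr>carrier := model\<rparr>\<^esub> a \<in> prime_div"
      "a \<otimes>\<^bsub>cfun_field\<lparr>carrier := model\<rparr>\<^esub> b \<in> prime_div"
      if "a \<in> prime_div" "b \<in> carrier (cfun_field\<lparr>carrier := model\<rparr>)" for a b
      using that by (simp_all add: prime_div_def model_closed mult.commute)
  qed
  show "cring (cfun_field\<lparr>carrier := model\<rparr>)" by (rule cring_model)
  have "1 \<notin> prime_div" by (simp add: prime_div_def vge_def v_1)
  then show "carrier (cfun_field\<lparr>carrier := model\<rparr>) \<noteq> prime_div" using one_model by auto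
  fix a b assume ab: "a \<in> carrier (cfun_field\<lparr>carrier := model\<rparr>)" "b \<in> carrier (cfun_field\<lparr>carrier := model\<rparr>)"
    "a \<otimes>\<^bsub>cfun_field\<lparr>carrier := model\<rparr>\<^esub> b \<in> prime_div"
  then have m: "a \<in> model" "b \<in> model" "vge val 1 (a * b)" by (simp_all add: prime_div_def)
  show "a \<in> prime_div \<or> b \<in> prime_div"
  proof (cases "a = 0 \<or> b = 0")
    case True
    then show ?thesis using zero_model by (auto simp: prime_div_def)
  next
    case False
    then have nz: "a \<noteq> 0" "b \<noteq> 0" by auto
    then have "1 \<le> val a + val b" "0 \<le> val a" "0 \<le> val b"
      using m v_mult[OF nz] by (simp_all add: model_def vge_def)
    then have "1 \<le> val a \<or> 1 \<le> val b" by linarith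
    then show ?thesis using m by (auto simp: prime_div_def vge_def)
  qed
qed

text \<open>Every nonzero Laurent element is a power of \<open>\<pi>\<close> times an element of the
  chart outside \<open>prime_div\<close>. This factorization shows both that the prime has height
  one and that the localization at it is the valuation ring.\<close>

lemma divisorial: "divisorial_valuation val" and canonical_order_le: "relative_canonical_order val \<le> int w1 + int w2 - 1"
proof -
  obtain H \<pi> u where gen: "model = generate_ring cfun_field (range cconst \<union> H)" and H: "H = {\<pi>, u, inverse u}"
    and v: "val \<pi> = 1" "val u = 0" and nz: "\<pi> \<noteq> 0" "u \<noteq> 0" and lau': "\<forall>n. \<pi> powi n \<in> laurent"
    and lb: "log_bounded (int w1 + int w2) \<pi> u"
    by (rule model_generated)
  have lau: "\<pi> powi n \<in> laurent" for n using lau' by blast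
  have \<pi>m: "\<pi> \<in> model" using lau[of 1] v nz by (simp add: model_def vge_def)
  have normal: "normal_affine_model model"
    unfolding normal_affine_model_def
  proof (intro conjI allI impI)
    show "\<exists>G. finite G \<and> model = generate_ring cfun_field (range cconst \<union> G)"
      using gen H by (intro exI[of _ H]) simp
    show "to_fract var_x \<in> model" "to_fract var_y \<in> model" by (rule model_closed)+
    fix z assume "integral_over model z"
    then obtain q where q: "Polynomial.lead_coeff q = 1" "\<And>i. Polynomial.coeff q i \<in> model" "poly q z = 0"
      by (auto simp: integral_over_def)
    then show "z \<in> model" using laurent_integral[of q z] vge_integral[of q z] by (simp add: model_def)
  qed
  have scale: "\<exists>z'\<in>model. z' \<notin> prime_div \<and> z = z' * \<pi> powi (val z)" if z: "z \<in> laurent" "z \<noteq> 0" for z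
  proof (intro bexI conjI)
    let ?z = "z * \<pi> powi (- val z)"
    have "?z \<noteq> 0" "val ?z = 0" using z nz v by (simp_all add: v_mult v_powi)
    then show "?z \<in> model" "?z \<notin> prime_div"
      using laurent_mult[OF z(1) lau[of "- val z"]] by (simp_all add: model_def prime_div_def vge_def)
    show "z = ?z * \<pi> powi (val z)" using nz by (simp add: power_int_minus)
  qed
  have height: "height_one_prime model prime_div"
    unfolding height_one_prime_def
  proof (intro conjI allI impI; (elim conjE)?)
    show "primeideal prime_div (cfun_field\<lparr>carrier := model\<rparr>)" by (rule prime_div)
    have "\<pi> \<in> prime_div" using \<pi>m v by (simp add: prime_div_def vge_def)
    then show "prime_div \<noteq> {0}" using nz by auto
    fix Q assume Q: "primeideal Q (cfun_field\<lparr>carrier := model\<rparr>)" "Q \<subseteq> prime_div"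
    interpret Q: primeideal Q "cfun_field\<lparr>carrier := model\<rparr>" by (rule Q(1))
    have Q0: "0 \<in> Q" using additive_subgroup.zero_closed[OF Q.additive_subgroup_axioms] by simp
    have Qp: "a \<in> Q \<or> b \<in> Q" if "a \<in> model" "b \<in> model" "a * b \<in> Q" for a b
      using Q.I_prime[of a b] that by simp
    have Qm: "a * b \<in> Q" if "a \<in> Q" "b \<in> model" for a b
      using Q.I_r_closed[of a b] that by simp
    \<comment> \<open>A nonzero element of \<open>Q\<close> is a power of \<open>\<pi>\<close> times
      a factor outside \<open>prime_div\<close>, hence outside \<open>Q\<close>; primality puts
      \<open>\<pi>\<close> into \<open>Q\<close>, and \<open>\<pi>\<close> divides every element of
      \<open>prime_div\<close> within the chart.\<close>
    show "Q = {0} \<or> Q = prime_div"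
    proof (cases "Q = {0}")
      case False
      then obtain z where z: "z \<in> Q" "z \<noteq> 0" using Q0 by auto
      then have zm: "z \<in> model" "1 \<le> val z" using Q(2) by (auto simp: prime_div_def vge_def)
      then obtain z' where z': "z' \<in> model" "z' \<notin> prime_div" "z = z' * \<pi> powi (val z)"
        using scale[of z] z by (auto simp: model_def)
      have pm: "\<pi> ^ n \<in> model" for n by (induction n) (simp_all add: one_model model_closed \<pi>m)
      have e: "\<pi> powi (val z) = \<pi> ^ nat (val z)" using zm by (simp add: power_int_def)
      have "z' * \<pi> ^ nat (val z) \<in> Q" using z(1) z'(3) unfolding e by simp
      then have "\<pi> ^ nat (val z) \<in> Q" using Qp[OF z'(1) pm] z'(2) Q(2) by blast
      moreover have "\<pi> \<in> Q" if "\<pi> ^ Suc n \<in> Q" for n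
        using that
      proof (induction n)
        case (Suc n)
        then show ?case using Qp[OF \<pi>m pm[of "Suc n"]] by auto
      qed simp
      moreover have "nat (val z) = Suc (nat (val z) - 1)" using zm by simp
      ultimately have \<pi>Q: "\<pi> \<in> Q" by metis
      have "p \<in> Q" if p: "p \<in> prime_div" for p
      proof (cases "p = 0")
        case False
        have "p * \<pi> powi (- 1) \<in> laurent"
          using p by (intro laurent_mult lau) (simp add: prime_div_def model_def)
        moreover have "0 \<le> val (p * \<pi> powi (- 1))"
          using p False nz v by (simp add: v_mult v_inverse prime_div_def vge_def)
        ultimately have "p * \<pi> powi (- 1) \<in> model" by (simp add: model_def vge_def)
        then have "\<pi> * (p * \<pi> powi (- 1)) \<in> Q" by (rule Qm[OF \<pi>Q])
        moreover have "\<pi> * (p * \<pi> powi (- 1)) = p" using nz by (simp add: power_int_minus)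
        ultimately show ?thesis by (simp only:)
      qed (simp add: Q0)
      then show ?thesis using Q(2) by blast
    qed simp
  qed
  have ring: "valuation_ring val = {g / h | g h. g \<in> model \<and> h \<in> model - prime_div}"
  proof (intro equalityI subsetI)
    fix z assume "z \<in> valuation_ring val"
    then have vz: "vge val 0 z" by (simp add: valuation_ring_vge)
    show "z \<in> {g / h | g h. g \<in> model \<and> h \<in> model - prime_div}"
    proof (cases "z = 0")
      case True
      have "1 \<notin> prime_div" by (simp add: prime_div_def vge_def v_1)
      moreover have "z = 0 / 1" using True by simp
      ultimately show ?thesis using zero_model one_model by blast
    next
      case False
      obtain g h where gh: "z = to_fract g / to_fract h" "h \<noteq> 0" by (rule fract_cases)
      then obtain h' where h': "h' \<in> model" "h' \<notin> prime_div" "to_fract h = h' * \<pi> powi (val (to_fract h))"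
        using scale[OF laurent_poly[of h]] by auto
      have hn: "h' \<noteq> 0" using h'(3) gh(2) by auto
      have h0: "val h' = 0" using h' hn by (simp add: model_def prime_div_def vge_def)
      have zh: "z * h' = to_fract g * \<pi> powi (- val (to_fract h))"
      proof -
        have "h' = to_fract h * \<pi> powi (- val (to_fract h))"
          using nz by (subst h'(3)) (simp add: power_int_minus)
        then show ?thesis using gh by simp
      qed
      then have "z * h' \<in> laurent" using laurent_mult[OF laurent_poly lau] by simp
      moreover have "vge val 0 (z * h')" using vz False hn h0 by (simp add: vge_def v_mult)
      ultimately have "z * h' \<in> model" by (simp add: model_def)
      moreover have "z = (z * h') / h'" using hn by simp
      ultimately show ?thesis using h' by blast
    qed
  next
    fix z assume "z \<in> {g / h | g h. g \<in> model \<and> h \<in> model - prime_div}"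
    then obtain g h where z: "z = g / h" "g \<in> model" "h \<in> model" "h \<notin> prime_div" by auto
    have "h \<noteq> 0" using z by (auto simp: prime_div_def)
    then have "val h = 0" using z by (auto simp: prime_div_def model_def vge_def)
    then show "z \<in> valuation_ring val"
      using z \<open>h \<noteq> 0\<close> by (cases "g = 0") (simp_all add: valuation_ring_vge vge_def v_divide model_def)
  qed
  show "divisorial_valuation val"
    unfolding divisorial_valuation_def order_of_vanishing_def
    using normal height ring discrete by blast
  let ?k = "int w1 + int w2 - 1"
  \<comment> \<open>Among the generators only \<open>\<pi>\<close> paired with \<open>u\<close> or
    its inverse can have a nonzero Jacobian; the value 1 of \<open>\<pi>\<close> accounts for the
    \<open>- 1\<close> in \<open>?k\<close>.\<close>
  have k: "vge val (- ?k) (jacobian g h)" if gh: "g \<in> range cconst \<union> H" "h \<in> range cconst \<union> H" for g h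
  proof (cases "g \<in> range cconst \<or> h \<in> range cconst")
    case True
    then have "jacobian g h = 0" using jac_const jac_sym[of h g] by auto
    then show ?thesis by simp
  next
    case False
    have lu: "log_bounded (int w1 + int w2) \<pi> (inverse u)"
      using log_bounded_sym[OF log_bounded_inverse[OF nz(2) log_bounded_sym[OF lb]]] .
    have 1: "vge val (- ?k) (jacobian \<pi> u)" "vge val (- ?k) (jacobian \<pi> (inverse u))"
      using lb lu nz v by (simp_all add: log_bounded_def v_inverse)
    have 2: "vge val (- ?k) (jacobian u \<pi>)" "vge val (- ?k) (jacobian (inverse u) \<pi>)"
      using vge_uminus[OF 1(1)] vge_uminus[OF 1(2)] jac_sym[of u \<pi>] jac_sym[of "inverse u" \<pi>] by simp_all
    have 3: "jacobian (inverse u) u = 0" by (simp add: jac_inverse[OF nz(2)] jac_self)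
    then have 4: "jacobian u (inverse u) = 0" using jac_sym[of u "inverse u"] by simp
    show ?thesis using gh False 1 2 3 4 by (auto simp: H jac_self)
  qed
  have P: "0 \<in> prime_div" "1 \<notin> prime_div"
    using zero_model by (simp_all add: prime_div_def) (simp add: vge_def v_1)
  have bound: "vge val (- ?k) (jacobian g h)" if "vge val 0 g" "vge val 0 h" for g h
    by (rule jacobian_bound[OF gen ring P k that])
  show "relative_canonical_order val \<le> ?k"
    unfolding relative_canonical_order_def
  proof (rule cSup_least)
    have "vge val 0 (to_fract var_x)" "vge val 0 (to_fract var_y)"
      using model_closed(3) by (simp_all add: model_def)
    then have "- val (jacobian (to_fract var_x) (to_fract var_y)) \<in> {- val (jacobian g h) | g h.
       g \<in> valuation_ring val \<and> h \<in> valuation_ring val \<and> jacobian g h \<noteq> 0}"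
      by (intro CollectI exI[of _ "to_fract var_x"] exI[of _ "to_fract var_y"]) (simp add: valuation_ring_vge jac_xy)
    then show "{- val (jacobian g h) | g h.
       g \<in> valuation_ring val \<and> h \<in> valuation_ring val \<and> jacobian g h \<noteq> 0} \<noteq> {}" by blast
  next
    fix n assume "n \<in> {- val (jacobian g h) | g h.
       g \<in> valuation_ring val \<and> h \<in> valuation_ring val \<and> jacobian g h \<noteq> 0}"
    then obtain g h where "n = - val (jacobian g h)" "vge val 0 g" "vge val 0 h" "jacobian g h \<noteq> 0"
      by (auto simp: valuation_ring_vge)
    then show "n \<le> ?k" using bound[of g h] by (simp add: vge_def)
  qed
qed

text \<open>An upper bound for the canonical order serves to bound log discrepancies from above.
  With both weights positive the center is the origin; with one weight 0 it is a line through the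
  origin.\<close>

lemma monomial_valuation:
  "\<exists>v. divisorial_valuation v \<and> center_contains_origin v \<and> (0 < w1 \<and> 0 < w2 \<longrightarrow> centered_at_origin v) \<and>
     v (to_fract \<l>) = int w1 \<and> v (to_fract \<l>') = int w2 \<and> relative_canonical_order v \<le> int w1 + int w2 - 1"
proof (intro exI[of _ val] conjI impI)
  show "center_contains_origin val"
    unfolding center_contains_origin_def
  proof (intro allI impI)
    fix g assume "g \<noteq> 0" "0 < val (to_fract g)"
    then show "at_origin g = 0" using wt_origin[of g] by (cases "at_origin g = 0") (simp_all add: val_poly)
  qed
  show "centered_at_origin val" if "0 < w1 \<and> 0 < w2"
    unfolding centered_at_origin_def
  proof (intro allI impI)
    fix g :: "complex poly poly" assume "g \<noteq> 0"
    then show "0 < val (to_fract g) \<longleftrightarrow> at_origin g = 0"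
      using wt_origin[of g] wt_pos[of g] that by (cases "at_origin g = 0") (simp_all add: val_poly)
  qed
qed (rule divisorial canonical_order_le val_line)+

end

section \<open>The three lines\<close>

lemma var_derivs:
  "map_poly pderiv var_x = (1 :: complex poly poly)" "map_poly pderiv var_y = (0 :: complex poly poly)"
  "pderiv var_x = (0 :: complex poly poly)" "pderiv var_y = (1 :: complex poly poly)"
  "map_poly pderiv (var_x + var_y) = (1 :: complex poly poly)" "pderiv (var_x + var_y) = (1 :: complex poly poly)"
proof -
  show 1: "map_poly pderiv var_x = (1 :: complex poly poly)" "map_poly pderiv var_y = (0 :: complex poly poly)"
    "pderiv var_x = (0 :: complex poly poly)" "pderiv var_y = (1 :: complex poly poly)"
    by (simp_all add: var_x_def var_y_def map_poly_pCons pderiv_pCons one_pCons)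
  then show "map_poly pderiv (var_x + var_y) = (1 :: complex poly poly)" "pderiv (var_x + var_y) = (1 :: complex poly poly)"
    by (simp_all add: dx.D_add dy.D_add)
qed

lemma var_nz: "var_x \<noteq> (0 :: complex poly poly)" "var_y \<noteq> (0 :: complex poly poly)" "var_x + var_y \<noteq> (0 :: complex poly poly)"
  by (simp_all add: var_x_def var_y_def)

lemmas line_simps = bieval_simps[OF unital_hom_const] unital_homD[OF unital_hom_bieval[OF unital_hom_const]]

lemma lift_param:
  "poly (map_poly (\<lambda>c::complex. [:[:c:]:]) [:0, 1:]) w = w"
  "poly (map_poly (\<lambda>c::complex. [:[:c:]:]) [:0, - 1:]) w = - w"
proof -
  have 1: "[:[:1::complex:]:] = 1" "[:[:- 1::complex:]:] = - 1" by (simp_all add: one_pCons)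
  show "poly (map_poly (\<lambda>c::complex. [:[:c:]:]) [:0, 1:]) w = w"
    "poly (map_poly (\<lambda>c::complex. [:[:c:]:]) [:0, - 1:]) w = - w"
    by (simp_all add: map_poly_pCons 1 del: pCons_one)
qed

lemma pderiv_param: "pderiv [:0, 1:] = (1 :: complex poly)" "pderiv [:0, - 1:] = (- 1 :: complex poly)"
  by (simp_all add: pderiv_pCons one_pCons)

lemma param_neg: "[:0, - 1:] + [:0, 1:] = (0 :: complex poly)"
  by simp

text \<open>In each of the three instances the last parameter equals the Jacobian of the parameter
  of the line with its equation, which is \<open>1\<close> or \<open>- 1\<close>.\<close>

interpretation line_x: coordinate_line var_x var_y "bieval (\<lambda>c. [:c:]) 0 [:0, 1:]" "- 1"
proof unfold_locales
  show "pderiv (bieval (\<lambda>c. [:c:]) 0 [:0, 1:] var_y) =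
      Polynomial.smult (- 1) (bieval (\<lambda>c. [:c:]) 0 [:0, 1:] (poly_jac var_y var_x))"
    by (simp only: poly_jac_def var_derivs line_simps pderiv_param) simp
qed (simp_all add: unital_hom_bieval unital_hom_const line_simps var_nz poly_jac_def var_derivs lift_param)

interpretation line_y: coordinate_line var_y var_x "bieval (\<lambda>c. [:c:]) [:0, 1:] 0" 1
proof unfold_locales
  show "pderiv (bieval (\<lambda>c. [:c:]) [:0, 1:] 0 var_x) =
      Polynomial.smult 1 (bieval (\<lambda>c. [:c:]) [:0, 1:] 0 (poly_jac var_x var_y))"
    by (simp only: poly_jac_def var_derivs line_simps pderiv_param) simp
qed (simp_all add: unital_hom_bieval unital_hom_const line_simps var_nz poly_jac_def var_derivs lift_param)

interpretation line_z: coordinate_line "var_x + var_y" var_y "bieval (\<lambda>c. [:c:]) [:0, - 1:] [:0, 1:]" "- 1"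
proof unfold_locales
  show "bieval (\<lambda>c. [:c:]) [:0, - 1:] [:0, 1:] (var_x + var_y) = (0 :: complex poly)"
    by (simp only: line_simps param_neg)
  show "var_x + var_y dvd
      var_x - poly (map_poly (\<lambda>c::complex. [:[:c:]:]) (bieval (\<lambda>c. [:c:]) [:0, - 1:] [:0, 1:] var_x)) var_y"
    by (simp only: line_simps lift_param) simp
  show "pderiv (bieval (\<lambda>c. [:c:]) [:0, - 1:] [:0, 1:] var_x) =
      Polynomial.smult (- 1) (bieval (\<lambda>c. [:c:]) [:0, - 1:] [:0, 1:] (poly_jac var_x (var_x + var_y)))"
    "pderiv (bieval (\<lambda>c. [:c:]) [:0, - 1:] [:0, 1:] var_y) =
      Polynomial.smult (- 1) (bieval (\<lambda>c. [:c:]) [:0, - 1:] [:0, 1:] (poly_jac var_y (var_x + var_y)))"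
    by (simp_all only: poly_jac_def var_derivs line_simps pderiv_param) (simp_all add: one_pCons)
qed (simp_all add: unital_hom_bieval unital_hom_const line_simps var_nz lift_param)

lemma frame_x:
  assumes "coprime w1 w2"
  shows "frame var_x var_y (\<lambda>g. g) (\<lambda>g. g) w1 w2"
  using assms by unfold_locales (simp_all add: unital_hom_def)

lemmas plane_hom = unital_hom_bieval[OF unital_hom_const2]
lemmas plane_hom_simps = bieval_simps[OF unital_hom_const2] unital_homD[OF plane_hom]

lemma bieval_origin:
  assumes "at_origin u = 0" "at_origin v = 0"
  shows "at_origin (bieval (\<lambda>c::complex. [:[:c:]:]) u v g) = at_origin g"
  by (induction g rule: poly2_induct) (simp_all add: plane_hom_simps assms)

lemma bieval_inverse:
  assumes "bieval (\<lambda>c::complex. [:[:c:]:]) u v r = var_x" "bieval (\<lambda>c. [:[:c:]:]) u v s = var_y"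
  shows "bieval (\<lambda>c. [:[:c:]:]) u v (bieval (\<lambda>c. [:[:c:]:]) r s g) = g"
  by (induction g rule: poly2_induct) (simp_all add: plane_hom_simps assms)

lemma frame_y:
  assumes "coprime w1 w2"
  shows "frame var_y var_x (bieval (\<lambda>c. [:[:c:]:]) var_y var_x) (bieval (\<lambda>c. [:[:c:]:]) var_y var_x) w1 w2"
  using assms by unfold_locales (simp_all add: plane_hom plane_hom_simps bieval_origin bieval_inverse)

lemma frame_z:
  assumes "coprime w1 w2"
  shows "frame (var_x + var_y) var_y (bieval (\<lambda>c. [:[:c:]:]) (var_x - var_y) var_y)
    (bieval (\<lambda>c. [:[:c:]:]) (var_x + var_y) var_y) w1 w2"
  using assms by unfold_locales (simp_all add: plane_hom plane_hom_simps bieval_origin bieval_inverse)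

section \<open>Values on the three lines and the klt condition\<close>

abbreviation "fx \<equiv> to_fract (var_x :: complex poly poly)"
abbreviation "fy \<equiv> to_fract (var_y :: complex poly poly)"
abbreviation "fz \<equiv> to_fract (var_x + var_y :: complex poly poly)"

context divisorial
begin

lemma lines_nonneg: "0 \<le> v fx" "0 \<le> v fy" "0 \<le> v fz"
  using v_poly_nonneg var_nz by blast+

text \<open>The three lines satisfy a linear relation, so the least of their values is attained at
  least twice.\<close>

lemma lines_ultrametric: "min (v fx) (v fy) \<le> v fz" "min (v fy) (v fz) \<le> v fx" "min (v fx) (v fz) \<le> v fy"
proof -
  have nz: "fx \<noteq> 0" "fy \<noteq> 0" "fz \<noteq> 0" using var_nz by (simp_all del: to_fract_add)
  have e: "fz = fx + fy" "fx = - fy + fz" "fy = - fx + fz" by simp_all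
  show "min (v fx) (v fy) \<le> v fz" using v_add[OF nz(1,2)] nz(3) unfolding e(1) by simp
  have "- fy + fz = fx" "- fx + fz = fy" by simp_all
  then show "min (v fy) (v fz) \<le> v fx" "min (v fx) (v fz) \<le> v fy"
    using v_add[of "- fy" fz] v_add[of "- fx" fz] nz v_uminus[OF nz(1)] v_uminus[OF nz(2)]
    by (simp_all del: to_fract_add)
qed

text \<open>The Jacobian of any two of the lines is \<open>1\<close> or \<open>- 1\<close>, of value
  0, so the logarithmic bound becomes a bound on the sum of two values.\<close>

lemma lines_pairs: "v fx + v fy \<le> A" "v fx + v fz \<le> A" "v fy + v fz \<le> A"
proof -
  have nz: "fx \<noteq> 0" "fy \<noteq> 0" "fz \<noteq> 0" using var_nz by (simp_all del: to_fract_add)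
  have j: "jacobian fx fy = 1" "jacobian fx fz = 1" "jacobian fy fz = - 1"
    by (simp_all only: jac_to_fract poly_jac_def var_derivs) simp_all
  have "v (- 1) = 0" using v_uminus[of 1] v_1 by simp
  then show "v fx + v fy \<le> A" "v fx + v fz \<le> A" "v fy + v fz \<le> A"
    using A_log_bounded[OF nz(1,2)] A_log_bounded[OF nz(1,3)] A_log_bounded[OF nz(2,3)]
    unfolding log_bounded_def j vge_def by (simp_all add: v_1)
qed

lemma log_discrepancy_lines:
  "log_discrepancy (lines a b c) t v =
    of_int A - of_rat t * a * v fx - of_rat t * b * v fy - of_rat t * c * v fz"
proof -
  have nz: "fx \<noteq> 0" "fy \<noteq> 0" "fz \<noteq> 0" using var_nz by (simp_all del: to_fract_add)
  have "to_fract (lines a b c) = fx ^ a * fy ^ b * fz ^ c"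
    by (simp add: to_fract_power del: to_fract_add)
  then have "v (to_fract (lines a b c)) = int a * v fx + int b * v fy + int c * v fz"
    using nz by (simp add: v_mult v_power del: to_fract_add)
  then show ?thesis by (simp add: log_discrepancy_def A_def algebra_simps)
qed

end

text \<open>The discrepancy is at least \<open>(1 - \<alpha>) * (w1 - w3) + (2 - \<alpha> - \<beta>
  - \<gamma>) * w3\<close>: the contribution of one line beyond the minimum plus that of the blow-up
  of the origin. If all weights vanish, \<open>1 \<le> A\<close> decides.\<close>

lemma klt_positive:
  fixes \<alpha> \<beta> \<gamma> A w1 w2 w3 :: real
  assumes "0 \<le> \<alpha>" "0 \<le> \<beta>" "0 \<le> \<gamma>" "\<alpha> < 1" "\<beta> < 1" "\<gamma> < 1" "\<alpha> + \<beta> + \<gamma> < 2"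
    and "1 \<le> A" "w1 + w2 \<le> A" "w2 = w3" "w3 \<le> w1" "0 \<le> w3"
  shows "0 < A - \<alpha> * w1 - \<beta> * w2 - \<gamma> * w3"
proof (cases "w1 = 0")
  case True then show ?thesis using assms by simp
next
  case False
  have "(1 - \<alpha>) * (w1 - w3) + (2 - \<alpha> - \<beta> - \<gamma>) * w3 \<le> A - \<alpha> * w1 - \<beta> * w2 - \<gamma> * w3"
    using assms by (simp add: algebra_simps)
  moreover have "0 < (1 - \<alpha>) * (w1 - w3) + (2 - \<alpha> - \<beta> - \<gamma>) * w3"
  proof (cases "w3 = 0")
    case True then show ?thesis using assms False by simp
  next
    case False
    then have "0 < (2 - \<alpha> - \<beta> - \<gamma>) * w3" using assms by simp
    moreover have "0 \<le> (1 - \<alpha>) * (w1 - w3)" using assms by simp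
    ultimately show ?thesis by linarith
  qed
  ultimately show ?thesis by linarith
qed

text \<open>Four divisors test the condition: the three lines, through the weights 1 and 0, and the
  exceptional curve of the blow-up of the origin, through the weights 1 and 1. They suffice because
  the two lowest of the three values always coincide.\<close>

lemma klt_lines_iff:
  fixes t :: rat and a b c :: nat
  assumes t: "0 \<le> t"
  defines "\<alpha> \<equiv> of_rat t * real a" and "\<beta> \<equiv> of_rat t * real b" and "\<gamma> \<equiv> of_rat t * real c"
  shows "klt_at_origin (lines a b c) t \<longleftrightarrow> \<alpha> < 1 \<and> \<beta> < 1 \<and> \<gamma> < 1 \<and> \<alpha> + \<beta> + \<gamma> < 2"
proof
  have nn: "0 \<le> \<alpha>" "0 \<le> \<beta>" "0 \<le> \<gamma>" using t by (simp_all add: \<alpha>_def \<beta>_def \<gamma>_def)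
  {
    assume klt: "\<alpha> < 1 \<and> \<beta> < 1 \<and> \<gamma> < 1 \<and> \<alpha> + \<beta> + \<gamma> < 2"
    show "klt_at_origin (lines a b c) t"
      unfolding klt_at_origin_def
    proof (intro allI impI; elim conjE)
      fix v assume v: "divisorial_valuation v" "center_contains_origin v"
      interpret divisorial v
        using v(1) by unfold_locales (auto simp: divisorial_valuation_def order_of_vanishing_def)
      note p = lines_pairs and u = lines_ultrametric and n = lines_nonneg
      consider "v fy = v fz" "v fz \<le> v fx" | "v fx = v fz" "v fz \<le> v fy" | "v fx = v fy" "v fy \<le> v fz"
        using u by linarith
      then have "0 < of_int A - \<alpha> * v fx - \<beta> * v fy - \<gamma> * v fz"
      proof cases
        case 1
        then show ?thesis using klt_positive[of \<alpha> \<beta> \<gamma> A "v fx" "v fy" "v fz"] klt nn A_pos p n by simp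
      next
        case 2
        then show ?thesis using klt_positive[of \<beta> \<alpha> \<gamma> A "v fy" "v fx" "v fz"] klt nn A_pos p n by simp
      next
        case 3
        then show ?thesis using klt_positive[of \<gamma> \<alpha> \<beta> A "v fz" "v fx" "v fy"] klt nn A_pos p n by simp
      qed
      then show "0 < log_discrepancy (lines a b c) t v"
        by (simp add: log_discrepancy_lines \<alpha>_def \<beta>_def \<gamma>_def)
    qed
  }
  assume klt: "klt_at_origin (lines a b c) t"
  have pos: "0 < of_int (relative_canonical_order v) + 1 - \<alpha> * v fx - \<beta> * v fy - \<gamma> * v fz \<and>
      0 \<le> v fx \<and> 0 \<le> v fy \<and> 0 \<le> v fz \<and> min (v fx) (v fy) \<le> v fz"
    if v: "divisorial_valuation v" "center_contains_origin v" for v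
  proof -
    interpret divisorial v
      using v(1) by unfold_locales (auto simp: divisorial_valuation_def order_of_vanishing_def)
    have "0 < log_discrepancy (lines a b c) t v" using klt v by (simp add: klt_at_origin_def)
    then show ?thesis
      using lines_nonneg lines_ultrametric by (simp add: log_discrepancy_lines A_def \<alpha>_def \<beta>_def \<gamma>_def)
  qed
  have cop: "coprime 1 (0::nat)" "coprime (1::nat) 1" by simp_all
  obtain v1 where v1: "divisorial_valuation v1" "center_contains_origin v1" "v1 fx = 1" "relative_canonical_order v1 \<le> 0"
    using frame.monomial_valuation[OF frame_x[OF cop(1)]] by auto
  obtain v2 where v2: "divisorial_valuation v2" "center_contains_origin v2" "v2 fy = 1" "relative_canonical_order v2 \<le> 0"
    using frame.monomial_valuation[OF frame_y[OF cop(1)]] by auto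
  obtain v3 where v3: "divisorial_valuation v3" "center_contains_origin v3" "v3 fz = 1" "relative_canonical_order v3 \<le> 0"
    using frame.monomial_valuation[OF frame_z[OF cop(1)]] by (auto simp del: to_fract_add)
  obtain v4 where v4: "divisorial_valuation v4" "center_contains_origin v4" "v4 fx = 1" "v4 fy = 1" "relative_canonical_order v4 \<le> 1"
    using frame.monomial_valuation[OF frame_x[OF cop(2)]] by auto
  have nnv: "0 \<le> \<alpha> * v fx" "0 \<le> \<beta> * v fy" "0 \<le> \<gamma> * v fz"
    if "0 \<le> v fx" "0 \<le> v fy" "0 \<le> v fz" for v :: "cfun \<Rightarrow> int"
    using nn that by simp_all
  show "\<alpha> < 1 \<and> \<beta> < 1 \<and> \<gamma> < 1 \<and> \<alpha> + \<beta> + \<gamma> < 2"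
  proof (intro conjI)
    have "of_int (relative_canonical_order v1) \<le> (0::real)" using v1(4) by simp
    then show "\<alpha> < 1" using pos[OF v1(1,2)] nnv[of v1] v1(3) by simp
    have "of_int (relative_canonical_order v2) \<le> (0::real)" using v2(4) by simp
    then show "\<beta> < 1" using pos[OF v2(1,2)] nnv[of v2] v2(3) by simp
    have "of_int (relative_canonical_order v3) \<le> (0::real)" using v3(4) by simp
    then show "\<gamma> < 1" using pos[OF v3(1,2)] nnv[of v3] v3(3) by simp
    have "1 \<le> v4 fz" using pos[OF v4(1,2)] v4(3,4) by simp
    then have "\<gamma> * 1 \<le> \<gamma> * v4 fz" using nn by (intro mult_left_mono) auto
    moreover have "of_int (relative_canonical_order v4) \<le> (1::real)" using v4(5) by simp
    ultimately show "\<alpha> + \<beta> + \<gamma> < 2" using pos[OF v4(1,2)] v4(3,4) by simp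
  qed
qed

section \<open>The minimizing valuation\<close>

text \<open>The arithmetic-geometric inequality for \<open>P * w\<close> and \<open>Q * z\<close>;
  the volume bound then removes the weights.\<close>

lemma sum_square_lower:
  fixes P Q w z V D :: real
  assumes "0 \<le> P" "0 \<le> Q" "0 < w" "0 < z" "P * w + Q * z \<le> D" "1 \<le> V * w * z"
  shows "4 * (P * Q) \<le> D\<^sup>2 * V"
proof -
  have wz: "0 < w * z" using assms by simp
  have V: "0 \<le> V"
  proof (rule ccontr)
    assume "\<not> 0 \<le> V"
    then have "V * (w * z) < 0" using wz by (simp add: mult_neg_pos)
    then show False using assms(6) by (simp add: mult.assoc)
  qed
  have "4 * (P * w) * (Q * z) \<le> (P * w + Q * z)\<^sup>2"
    using zero_le_power2[of "P * w - Q * z"] by (simp add: power2_eq_square algebra_simps)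
  also have "\<dots> \<le> D\<^sup>2" using assms by (intro power_mono) auto
  finally have "4 * (P * w) * (Q * z) * V \<le> D\<^sup>2 * V" using V by (rule mult_right_mono)
  moreover have "4 * (P * Q) * 1 \<le> 4 * (P * Q) * (V * w * z)" using assms by (intro mult_left_mono) auto
  ultimately show ?thesis by (simp add: mult_ac)
qed

text \<open>The values on the other two lines are at most \<open>A - w1\<close>, so the discrepancy
  dominates the combination of \<open>w1\<close> and \<open>A - w1\<close> whose coefficients are
  the two factors on the left.\<close>

lemma flat_lower:
  fixes \<alpha> \<beta> \<gamma> A w1 w2 w3 V :: real
  assumes "0 \<le> \<beta>" "0 \<le> \<gamma>" "\<alpha> < 1" "\<beta> + \<gamma> \<le> \<alpha>" "0 < w1" "w1 < A" "w1 + w2 \<le> A" "w1 + w3 \<le> A"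
    "1 \<le> V * w1 * (A - w1)"
  shows "4 * ((1 - \<alpha>) * (1 - \<beta> - \<gamma>)) \<le> (A - \<alpha> * w1 - \<beta> * w2 - \<gamma> * w3)\<^sup>2 * V"
proof (rule sum_square_lower[where w = w1 and z = "A - w1"])
  have "\<beta> * w2 \<le> \<beta> * (A - w1)" "\<gamma> * w3 \<le> \<gamma> * (A - w1)" using assms by (intro mult_left_mono; simp)+
  then show "(1 - \<alpha>) * w1 + (1 - \<beta> - \<gamma>) * (A - w1) \<le> A - \<alpha> * w1 - \<beta> * w2 - \<gamma> * w3"
    by (simp add: algebra_simps)
qed (use assms in auto)

text \<open>The triangle inequalities make \<open>(\<alpha> + \<beta> - \<gamma>) / 2\<close> and
  its analogues nonnegative multipliers for the bounds on the pairwise sums. Adding up leaves a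
  multiple of \<open>A\<close> alone, so both coefficients in the arithmetic-geometric inequality
  agree.\<close>

lemma balanced_lower:
  fixes \<alpha> \<beta> \<gamma> A w1 w2 w3 V :: real
  assumes "\<alpha> \<le> \<beta> + \<gamma>" "\<beta> \<le> \<alpha> + \<gamma>" "\<gamma> \<le> \<alpha> + \<beta>" "\<alpha> + \<beta> + \<gamma> < 2" "0 < w1" "w1 < A"
    "w1 + w2 \<le> A" "w1 + w3 \<le> A" "w2 + w3 \<le> A" "1 \<le> V * w1 * (A - w1)"
  shows "4 * (1 - (\<alpha> + \<beta> + \<gamma>) / 2)\<^sup>2 \<le> (A - \<alpha> * w1 - \<beta> * w2 - \<gamma> * w3)\<^sup>2 * V"
proof -
  let ?s = "1 - (\<alpha> + \<beta> + \<gamma>) / 2"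
  have "4 * (?s * ?s) \<le> (A - \<alpha> * w1 - \<beta> * w2 - \<gamma> * w3)\<^sup>2 * V"
  proof (rule sum_square_lower[where w = w1 and z = "A - w1"])
    have "(\<alpha> + \<beta> - \<gamma>) / 2 * (w1 + w2) \<le> (\<alpha> + \<beta> - \<gamma>) / 2 * A"
      "(\<alpha> + \<gamma> - \<beta>) / 2 * (w1 + w3) \<le> (\<alpha> + \<gamma> - \<beta>) / 2 * A"
      "(\<beta> + \<gamma> - \<alpha>) / 2 * (w2 + w3) \<le> (\<beta> + \<gamma> - \<alpha>) / 2 * A"
      using assms by (intro mult_left_mono; simp)+
    then show "?s * w1 + ?s * (A - w1) \<le> A - \<alpha> * w1 - \<beta> * w2 - \<gamma> * w3"
      by (simp add: field_simps)
  qed (use assms in auto)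
  then show ?thesis by (simp add: power2_eq_square)
qed

lemma signature_lower:
  fixes \<alpha> \<beta> \<gamma> A w1 w2 w3 V :: real
  assumes nn: "0 \<le> \<alpha>" "0 \<le> \<beta>" "0 \<le> \<gamma>" and klt: "\<alpha> < 1" "\<beta> < 1" "\<gamma> < 1" "\<alpha> + \<beta> + \<gamma> < 2"
    and w: "0 < w1" "0 < w2" "0 < w3" "w1 + w2 \<le> A" "w1 + w3 \<le> A" "w2 + w3 \<le> A"
    and V: "1 \<le> V * w1 * (A - w1)" "1 \<le> V * w2 * (A - w2)" "1 \<le> V * w3 * (A - w3)"
  shows "4 * limit_signature \<alpha> \<beta> \<gamma> \<le> (A - \<alpha> * w1 - \<beta> * w2 - \<gamma> * w3)\<^sup>2 * V"
proof -
  have e: "A - \<beta> * w2 - \<alpha> * w1 - \<gamma> * w3 = A - \<alpha> * w1 - \<beta> * w2 - \<gamma> * w3"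
    "A - \<gamma> * w3 - \<alpha> * w1 - \<beta> * w2 = A - \<alpha> * w1 - \<beta> * w2 - \<gamma> * w3" by simp_all
  have 1: "4 * ((1 - \<alpha>) * (1 - \<beta> - \<gamma>)) \<le> (A - \<alpha> * w1 - \<beta> * w2 - \<gamma> * w3)\<^sup>2 * V" if "\<beta> + \<gamma> \<le> \<alpha>"
    by (rule flat_lower) (use assms that in auto)
  have 2: "4 * ((1 - \<beta>) * (1 - \<alpha> - \<gamma>)) \<le> (A - \<beta> * w2 - \<alpha> * w1 - \<gamma> * w3)\<^sup>2 * V" if "\<alpha> + \<gamma> \<le> \<beta>"
    by (rule flat_lower) (use assms that in auto)
  have 3: "4 * ((1 - \<gamma>) * (1 - \<alpha> - \<beta>)) \<le> (A - \<gamma> * w3 - \<alpha> * w1 - \<beta> * w2)\<^sup>2 * V" if "\<alpha> + \<beta> \<le> \<gamma>"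
    by (rule flat_lower) (use assms that in auto)
  have 4: "4 * (1 - (\<alpha> + \<beta> + \<gamma>) / 2)\<^sup>2 \<le> (A - \<alpha> * w1 - \<beta> * w2 - \<gamma> * w3)\<^sup>2 * V"
    if "\<alpha> \<le> \<beta> + \<gamma>" "\<beta> \<le> \<alpha> + \<gamma>" "\<gamma> \<le> \<alpha> + \<beta>"
    by (rule balanced_lower) (use assms that in auto)
  show ?thesis
    using 1 2[unfolded e] 3[unfolded e] 4 klt unfolding limit_signature_def by auto
qed

text \<open>Because \<open>t\<close> is rational, the optimal ratio of weights is rational; reduced
  to lowest terms it is realized by a monomial valuation.\<close>

lemma coprime_ratio:
  fixes r s :: rat
  assumes "0 < r" "0 < s"
  obtains m n :: nat where "coprime m n" "0 < m" "0 < n" "of_nat m * s = of_nat n * r"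
proof -
  obtain i j where ij: "quotient_of (r / s) = (i, j)" by (cases "quotient_of (r / s)")
  have j: "j > 0" "coprime i j" using quotient_of_denom_pos[OF ij] quotient_of_coprime[OF ij] .
  have q: "r / s = of_int i / of_int j" by (rule quotient_of_div[OF ij])
  then have "0 < (of_int i / of_int j :: rat)" using assms by (metis divide_pos_pos)
  then have i: "i > 0" using j by (simp add: zero_less_divide_iff)
  have "of_int i * s = of_int j * r" using q assms j by (simp add: field_simps)
  then show ?thesis
    using that[of "nat i" "nat j"] i j by (simp add: coprime_int_iff[symmetric])
qed

lemma flat_upper:
  fixes P Q D V :: real and m n :: nat
  assumes "0 \<le> D" "D \<le> P * m + Q * n" "P * m = Q * n" "0 \<le> V" "V * m * n \<le> 1" "0 \<le> P" "0 \<le> Q"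
  shows "D\<^sup>2 * V \<le> 4 * (P * Q)"
proof -
  have "D\<^sup>2 \<le> (P * m + Q * n)\<^sup>2" using assms by (intro power_mono) auto
  also have "\<dots> = 4 * (P * m) * (Q * n)" unfolding assms(3) by (simp add: power2_eq_square)
  finally have "D\<^sup>2 * V \<le> 4 * (P * m) * (Q * n) * V" using assms(4) by (rule mult_right_mono)
  also have "\<dots> = 4 * (P * Q) * (V * m * n)" by simp
  also have "\<dots> \<le> 4 * (P * Q) * 1" using assms by (intro mult_left_mono) auto
  finally show ?thesis by simp
qed

text \<open>Every line gives its own bounds. The volume is nonnegative because its product with a
  positive number is at least 1.\<close>

lemma volume_nonneg:
  assumes "divisorial_valuation v" "centered_at_origin v"
  shows "0 \<le> valuation_volume v"
    and "1 \<le> valuation_volume v * v fx * (1 + relative_canonical_order v - v fx)"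
    and "1 \<le> valuation_volume v * v fy * (1 + relative_canonical_order v - v fy)"
    and "1 \<le> valuation_volume v * v fz * (1 + relative_canonical_order v - v fz)"
    and "valuation_volume v * v fx * v fy \<le> 1"
    and "valuation_volume v * v fz * v fy \<le> 1"
    and "1 \<le> v fx" "1 \<le> v fy" "1 \<le> v fz"
proof -
  interpret centered v
    using assms by unfold_locales (auto simp: divisorial_valuation_def order_of_vanishing_def)
  interpret lx: centered_line v var_x var_y "bieval (\<lambda>c. [:c:]) 0 [:0, 1:]" "- 1" by unfold_locales
  interpret ly: centered_line v var_y var_x "bieval (\<lambda>c. [:c:]) [:0, 1:] 0" 1 by unfold_locales
  interpret lz: centered_line v "var_x + var_y" var_y "bieval (\<lambda>c. [:c:]) [:0, - 1:] [:0, 1:]" "- 1" by unfold_locales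
  show 1: "1 \<le> valuation_volume v * v fx * (1 + relative_canonical_order v - v fx)"
    "1 \<le> valuation_volume v * v fy * (1 + relative_canonical_order v - v fy)"
    "1 \<le> valuation_volume v * v fz * (1 + relative_canonical_order v - v fz)"
    using lx.volume_bounds(1) ly.volume_bounds(1) lz.volume_bounds(1) by (simp_all add: A_def)
  show "valuation_volume v * v fx * v fy \<le> 1" "valuation_volume v * v fz * v fy \<le> 1"
    using lx.volume_bounds(2) lz.volume_bounds(2) by simp_all
  show v1: "1 \<le> v fx" "1 \<le> v fy" "1 \<le> v fz" using lx.v_x ly.v_x lz.v_x .
  have "v fx + v fy \<le> 1 + relative_canonical_order v" using lines_pairs by (simp add: A_def)
  then have z: "0 < real_of_int (v fx) * (1 + relative_canonical_order v - v fx)"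
    using v1 by (intro mult_pos_pos) linarith+
  show "0 \<le> valuation_volume v"
  proof (rule ccontr)
    assume "\<not> 0 \<le> valuation_volume v"
    then have "valuation_volume v * (real_of_int (v fx) * (1 + relative_canonical_order v - v fx)) < 0"
      using z by (simp add: mult_neg_pos)
    then show False using 1(1) by (simp add: mult.assoc)
  qed
qed

theorem normalized_volume_lines:
  fixes t :: rat and a b c :: nat
  assumes t: "0 \<le> t"
  shows "normalized_volume (lines a b c) t = 4 * limit_signature (of_rat t * a) (of_rat t * b) (of_rat t * c)"
proof -
  define \<alpha> \<beta> \<gamma> where "\<alpha> = of_rat t * real a" and "\<beta> = of_rat t * real b" and "\<gamma> = of_rat t * real c"
  let ?G = "limit_signature \<alpha> \<beta> \<gamma>"
  have nn: "0 \<le> \<alpha>" "0 \<le> \<beta>" "0 \<le> \<gamma>" using t by (simp_all add: \<alpha>_def \<beta>_def \<gamma>_def)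
  note klt_iff = klt_lines_iff[OF t, of a b c, folded \<alpha>_def \<beta>_def \<gamma>_def]
  have "normalized_volume (lines a b c) t = 4 * ?G"
  proof (cases "klt_at_origin (lines a b c) t")
    case False
    then have "\<not> (\<alpha> < 1 \<and> \<beta> < 1 \<and> \<gamma> < 1 \<and> \<alpha> + \<beta> + \<gamma> < 2)" unfolding klt_iff .
    then have "?G = 0" unfolding limit_signature_def by (simp only: if_False)
    then show ?thesis using False by (simp add: normalized_volume_def)
  next
    case True
    then have klt: "\<alpha> < 1" "\<beta> < 1" "\<gamma> < 1" "\<alpha> + \<beta> + \<gamma> < 2" unfolding klt_iff by auto
    let ?E = "\<lambda>v. (log_discrepancy (lines a b c) t v)\<^sup>2 * valuation_volume v"
    let ?S = "{?E v | v. divisorial_valuation v \<and> centered_at_origin v}"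
    have ld: "log_discrepancy (lines a b c) t v =
        (1 + relative_canonical_order v) - \<alpha> * v fx - \<beta> * v fy - \<gamma> * v fz \<and>
        v fx + v fy \<le> 1 + relative_canonical_order v \<and> v fx + v fz \<le> 1 + relative_canonical_order v \<and>
        v fy + v fz \<le> 1 + relative_canonical_order v \<and>
        min (v fx) (v fy) \<le> v fz \<and> min (v fy) (v fz) \<le> v fx \<and> min (v fx) (v fz) \<le> v fy"
      if "divisorial_valuation v" for v
    proof -
      interpret divisorial v
        using that by unfold_locales (auto simp: divisorial_valuation_def order_of_vanishing_def)
      show ?thesis using lines_pairs lines_ultrametric
        by (simp add: log_discrepancy_lines A_def \<alpha>_def \<beta>_def \<gamma>_def)
    qed
    have low: "4 * ?G \<le> ?E v" if v: "divisorial_valuation v" "centered_at_origin v" for v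
    proof -
      note vn = volume_nonneg[OF v] and l = ld[OF v(1)]
      have "4 * ?G \<le> (real_of_int (1 + relative_canonical_order v) - \<alpha> * v fx - \<beta> * v fy - \<gamma> * v fz)\<^sup>2 * valuation_volume v"
        by (rule signature_lower[OF nn klt]) (use vn l in \<open>simp_all flip: of_int_add\<close>)
      then show ?thesis using l by simp
    qed
    have pos: "0 < log_discrepancy (lines a b c) t v" if v: "divisorial_valuation v" "centered_at_origin v" for v
    proof -
      have "center_contains_origin v" using v(2) by (simp add: center_contains_origin_def centered_at_origin_def)
      then show ?thesis using True v by (simp add: klt_at_origin_def)
    qed
    have mono: "\<alpha>' * real_of_int n \<le> \<alpha>' * real_of_int m" if "0 \<le> \<alpha>'" "n \<le> m" for \<alpha>' and n m :: int
      using that by (intro mult_left_mono) simp_all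
    \<comment> \<open>Balancing the two terms of the discrepancy determines \<open>m\<close> and
      \<open>n\<close> up to scaling. The line with the dominant exponent gets the larger weight, so
      \<open>n\<close> is the minimum and the third line has value at least
      \<open>n\<close>.\<close>
    have rat: "\<exists>m n :: nat. coprime m n \<and> 0 < m \<and> 0 < n \<and> (1 - of_rat t * real i) * real m = (1 - of_rat t * real j - of_rat t * real k) * real n \<and> n \<le> m"
      if i: "of_rat t * real i < 1" "of_rat t * real j + of_rat t * real k \<le> of_rat t * real i" for i j k
    proof -
      have e: "of_rat (1 - t * of_nat j - t * of_nat k) = 1 - of_rat t * real j - of_rat t * real k"
        "of_rat (1 - t * of_nat i) = 1 - of_rat t * real i" by (simp_all add: of_rat_diff of_rat_mult)
      have "0 < (of_rat (1 - t * of_nat j - t * of_nat k) :: real)" "0 < (of_rat (1 - t * of_nat i) :: real)"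
        unfolding e using i by simp_all
      then obtain m n :: nat where mn: "coprime m n" "0 < m" "0 < n"
        "of_nat m * (1 - t * of_nat i) = of_nat n * (1 - t * of_nat j - t * of_nat k)"
        using coprime_ratio[of "1 - t * of_nat j - t * of_nat k" "1 - t * of_nat i"] by (metis zero_less_of_rat_iff)
      have "of_rat (of_nat m * (1 - t * of_nat i)) = (of_rat (of_nat n * (1 - t * of_nat j - t * of_nat k)) :: real)"
        by (simp only: mn(4))
      then have r: "(1 - of_rat t * real i) * m = (1 - of_rat t * real j - of_rat t * real k) * n"
        by (simp only: of_rat_mult e) (simp add: mult.commute)
      have "(1 - of_rat t * real i) * n \<le> (1 - of_rat t * real j - of_rat t * real k) * n"
        using i by (intro mult_right_mono) simp_all
      then have "(1 - of_rat t * real i) * n \<le> (1 - of_rat t * real i) * m" using r by simp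
      then have "n \<le> m" using i by simp
      then show ?thesis using mn r by blast
    qed
    have "\<exists>v. divisorial_valuation v \<and> centered_at_origin v \<and> ?E v \<le> 4 * ?G"
    proof -
      consider (x) "\<beta> + \<gamma> \<le> \<alpha>" | (y) "\<not> \<beta> + \<gamma> \<le> \<alpha>" "\<alpha> + \<gamma> \<le> \<beta>"
        | (z) "\<not> \<beta> + \<gamma> \<le> \<alpha>" "\<not> \<alpha> + \<gamma> \<le> \<beta>" "\<alpha> + \<beta> \<le> \<gamma>"
        | (balanced) "\<not> \<beta> + \<gamma> \<le> \<alpha>" "\<not> \<alpha> + \<gamma> \<le> \<beta>" "\<not> \<alpha> + \<beta> \<le> \<gamma>" by blast
      then show ?thesis
      proof cases
        case x
        then obtain m n :: nat where mn: "coprime m n" "0 < m" "0 < n" "(1 - \<alpha>) * m = (1 - \<beta> - \<gamma>) * n" "n \<le> m"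
          using rat[of a b c] klt unfolding \<alpha>_def \<beta>_def \<gamma>_def by blast
        obtain v where v: "divisorial_valuation v" "centered_at_origin v" "v fx = int m" "v fy = int n"
          "relative_canonical_order v \<le> int m + int n - 1"
          using frame.monomial_valuation[OF frame_x[OF mn(1)]] mn by auto
        note vn = volume_nonneg[OF v(1,2)] and l = ld[OF v(1)]
        have "int n \<le> v fz" using l v mn by simp
        then have "\<gamma> * int n \<le> \<gamma> * v fz" using mono nn by blast
        then have "log_discrepancy (lines a b c) t v \<le> (1 - \<alpha>) * m + (1 - \<beta> - \<gamma>) * n"
          using l v by (simp add: algebra_simps)
        then have "?E v \<le> 4 * ((1 - \<alpha>) * (1 - \<beta> - \<gamma>))"
          using pos[OF v(1,2)] mn vn v klt x nn by (intro flat_upper[where m = m and n = n]) simp_all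
        then show ?thesis using v x klt by (auto simp: limit_signature_def)
      next
        case y
        then obtain m n :: nat where mn: "coprime m n" "0 < m" "0 < n" "(1 - \<beta>) * m = (1 - \<alpha> - \<gamma>) * n" "n \<le> m"
          using rat[of b a c] klt unfolding \<alpha>_def \<beta>_def \<gamma>_def by blast
        obtain v where v: "divisorial_valuation v" "centered_at_origin v" "v fy = int m" "v fx = int n"
          "relative_canonical_order v \<le> int m + int n - 1"
          using frame.monomial_valuation[OF frame_y[OF mn(1)]] mn by auto
        note vn = volume_nonneg[OF v(1,2)] and l = ld[OF v(1)]
        have "int n \<le> v fz" using l v mn by simp
        then have "\<gamma> * int n \<le> \<gamma> * v fz" using mono nn by blast
        then have "log_discrepancy (lines a b c) t v \<le> (1 - \<beta>) * m + (1 - \<alpha> - \<gamma>) * n"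
          using l v by (simp add: algebra_simps)
        then have "?E v \<le> 4 * ((1 - \<beta>) * (1 - \<alpha> - \<gamma>))"
          using pos[OF v(1,2)] mn vn v klt y nn by (intro flat_upper[where m = m and n = n]) (simp_all add: mult_ac)
        then show ?thesis using v y klt by (auto simp: limit_signature_def)
      next
        case z
        then obtain m n :: nat where mn: "coprime m n" "0 < m" "0 < n" "(1 - \<gamma>) * m = (1 - \<alpha> - \<beta>) * n" "n \<le> m"
          using rat[of c a b] klt unfolding \<alpha>_def \<beta>_def \<gamma>_def by blast
        obtain v where v: "divisorial_valuation v" "centered_at_origin v" "v fz = int m" "v fy = int n"
          "relative_canonical_order v \<le> int m + int n - 1"
          using frame.monomial_valuation[OF frame_z[OF mn(1)]] mn by (auto simp del: to_fract_add)
        note vn = volume_nonneg[OF v(1,2)] and l = ld[OF v(1)]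
        have "int n \<le> v fx" using l v mn by simp
        then have "\<alpha> * int n \<le> \<alpha> * v fx" using mono nn by blast
        then have "log_discrepancy (lines a b c) t v \<le> (1 - \<gamma>) * m + (1 - \<alpha> - \<beta>) * n"
          using l v by (simp add: algebra_simps)
        then have "?E v \<le> 4 * ((1 - \<gamma>) * (1 - \<alpha> - \<beta>))"
          using pos[OF v(1,2)] mn vn v klt z nn by (intro flat_upper[where m = m and n = n]) simp_all
        then show ?thesis using v z klt by (auto simp: limit_signature_def)
      next
        \<comment> \<open>In this regime the ordinary blow-up of the origin is the
          minimizer.\<close>
        case balanced
        obtain v where v: "divisorial_valuation v" "centered_at_origin v" "v fx = 1" "v fy = 1"
          "relative_canonical_order v \<le> 1"
          using frame.monomial_valuation[OF frame_x[of 1 1]] by auto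
        note vn = volume_nonneg[OF v(1,2)] and l = ld[OF v(1)]
        have "1 \<le> v fz" using l v by simp
        then have "\<gamma> * 1 \<le> \<gamma> * v fz" using mono[of \<gamma> 1 "v fz"] nn by simp
        then have "log_discrepancy (lines a b c) t v \<le> 2 - (\<alpha> + \<beta> + \<gamma>)"
          using l v by (simp add: algebra_simps)
        then have "?E v \<le> (2 - (\<alpha> + \<beta> + \<gamma>))\<^sup>2 * 1"
          using pos[OF v(1,2)] vn v by (intro mult_mono power_mono) simp_all
        also have "\<dots> = 4 * (1 - (\<alpha> + \<beta> + \<gamma>) / 2)\<^sup>2" by (simp add: power2_eq_square field_simps)
        finally show ?thesis using v balanced klt by (auto simp: limit_signature_def)
      qed
    qed
    then obtain v where v: "divisorial_valuation v" "centered_at_origin v" "?E v \<le> 4 * ?G" by blast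
    have "Inf ?S = 4 * ?G"
    proof (rule cInf_eq_minimum)
      have "?E v = 4 * ?G" using v low[of v] by simp
      then show "4 * ?G \<in> ?S" using v by (intro CollectI exI[of _ v]) simp
      show "4 * ?G \<le> z" if "z \<in> ?S" for z using that low by blast
    qed
    then show ?thesis using True by (simp add: normalized_volume_def)
  qed
  then show ?thesis by (simp add: \<alpha>_def \<beta>_def \<gamma>_def)
qed

lemma base_change_lines: "base_change_C (lines a b c) = lines a b c"
proof -
  have h: "unital_hom (of_int :: int \<Rightarrow> complex)" by (simp add: unital_hom_def)
  then have "unital_hom base_change_C"
    unfolding base_change_C_def by (intro unital_hom_map_poly)
  note s = unital_homD[OF this]
  have "base_change_C var_x = var_x" "base_change_C var_y = var_y"
    by (simp_all add: base_change_C_def var_x_def var_y_def map_poly_pCons unital_homD[OF unital_hom_map_poly[OF h]])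
  then show ?thesis by (simp add: s)
qed

theorem corollaryB:
  fixes a b c :: nat and t :: rat and f :: "int poly poly"
  assumes "\<not> (a = 0 \<and> b = 0 \<and> c = 0)"
    and "f = var_x ^ a * var_y ^ b * (var_x + var_y) ^ c"
    and "0 \<le> t"
  shows "((\<lambda>p. F_signature p f t) \<longlongrightarrow> normalized_volume (base_change_C f) t / 4)
           (inf at_top (principal {p :: nat. Factorial_Ring.prime p}))"
  unfolding assms(2) base_change_lines normalized_volume_lines[OF assms(3)]
  using F_signature_tendsto[OF assms(3), of a b c] by simp

end
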